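(* Let $\mathcal{S}$ be any one of the following subsets of $\mathcal{M}$: $\mathcal{X}(u,v,w)$ for some $(u,v,w)\in\{0,1,2\}^3$, or $\mathcal{I}(\mathcal{D})$ for some dimensional function $\mathcal{D}$, or $\mathcal{CA}$. Then for all $(X,d),(Y,e)\in\mathcal{S}$ there exists a topological embedding from the Hilbert cube $\mathbf{Q}=[0,1]^{\mathbb{N}}$ into $\mathcal{S}$ whose image contains $(X,d)$ and $(Y,e)$. In particular, $\mathcal{S}$ is infinite-dimensional.
   Context: $\mathcal{M}$ is the set of all isometry classes of non-empty compact metric spaces, equipped with the Gromov--Hausdorff distance $d_{GH}$; subsets carry the restricted metric. A metric space is called infinite-dimensional if its covering dimension is infinite. $B(x,r)$ denotes the closed ball and $\delta_d(X)$ the diameter. A metric space $(X,d)$ is $N$-doubling ($N\in\mathbb{N}$) if for all $x\in X$, $r\in(0,\infty)$ there is $F\subset X$ with $B(x,r)\subset\bigcup_{y\in F}B(y,r/2)$ and $\mathrm{Card}(F)\le N$; it is doubling if it is $N$-doubling for some $N$. It is $\delta$-uniformly disconnected ($\delta\in(0,\infty)$) if for every non-constant finite sequence $\{z_i\}_{i=1}^N$ in $X$ we have $\delta d(z_1,z_N)\le\max_{1\le i\le N-1}d(z_i,z_{i+1})$; it is uniformly disconnected if this holds for some $\delta\in(0,\infty)$. It is $c$-uniformly perfect ($c\in(0,1)$) if for every $x\in X$ and every $r\in(0,\delta_d(X))$ there is $y\in X$ with $c\cdot r\le d(x,y)\le r$; it is uniformly perfect if this holds for some $c\in(0,1)$.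 Let $\mathcal{Q}_1,\mathcal{Q}_2,\mathcal{Q}_3\subset\mathcal{M}$ be the sets of all doubling, all uniformly disconnected, and all uniformly perfect spaces, respectively. For $k\in\{1,2,3\}$ put $\mathcal{E}_k(0)=\mathcal{M}\setminus\mathcal{Q}_k$, $\mathcal{E}_k(1)=\mathcal{Q}_k$, $\mathcal{E}_k(2)=\mathcal{M}$, and $\mathcal{X}(u,v,w)=\mathcal{E}_1(u)\cap\mathcal{E}_2(v)\cap\mathcal{E}_3(w)$. A map $\mathcal{D}:\mathcal{M}\to[0,\infty]$ is a dimensional function if (i) for every $(X,d)\in\mathcal{M}$ and every (non-empty) closed subset $A$ of $X$ we have $\mathcal{D}(A,d)\le\mathcal{D}(X,d)$, and (ii) for all $\epsilon\in(0,\infty)$ there is a compact metric space $(Y,e)$ with $\mathcal{D}(Y,e)=\infty$ and $\delta_e(Y)\le\epsilon$. Put $\mathcal{I}(\mathcal{D})=\{(X,d)\in\mathcal{M}:\mathcal{D}(X,d)=\infty\}$. $\mathcal{CA}\subset\mathcal{M}$ is the set of all compact metric spaces homeomorphic to the Cantor set. *)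

theory Defs
  imports "HOL-Analysis.Analysis"
begin

section \<open>Isometry classes of compact metric spaces\<close>

definition isometric_embedding :: "'a metric \<Rightarrow> 'b metric \<Rightarrow> ('a \<Rightarrow> 'b) \<Rightarrow> bool" where
  "isometric_embedding X Y f \<longleftrightarrow>
     f ` mspace X \<subseteq> mspace Y \<and>
     (\<forall>x\<in>mspace X. \<forall>y\<in>mspace X. mdist Y (f x) (f y) = mdist X x y)"

definition isometric :: "'a metric \<Rightarrow> 'b metric \<Rightarrow> bool" where
  "isometric X Y \<longleftrightarrow> (\<exists>f. isometric_embedding X Y f \<and> f ` mspace X = mspace Y)"

definition nonempty_compact :: "'a metric \<Rightarrow> bool" where
  "nonempty_compact X \<longleftrightarrow> mspace X \<noteq> {} \<and> compact_space (mtopology_of X)"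

lemma isometric_refl: "isometric X X"
  unfolding isometric_def isometric_embedding_def by (rule exI[of _ "\<lambda>x. x"]) auto

lemma isometric_embeddingD:
  assumes "isometric_embedding X Y f" "x \<in> mspace X"
  shows "f x \<in> mspace Y" "y \<in> mspace X \<Longrightarrow> mdist Y (f x) (f y) = mdist X x y"
  using assms unfolding isometric_embedding_def by blast+

lemma isometric_embedding_inj_on:
  assumes "isometric_embedding X Y f" shows "inj_on f (mspace X)"
proof (rule inj_onI)
  fix x y assume xy: "x \<in> mspace X" "y \<in> mspace X" "f x = f y"
  have "mdist X x y = mdist Y (f x) (f y)"
    using isometric_embeddingD(2)[OF assms xy(1,2)] by (rule sym)
  also have "\<dots> = 0"
    unfolding xy(3) using isometric_embeddingD(1)[OF assms xy(2)] by (subst mdist_zero) simp_all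
  finally show "x = y" using mdist_zero[OF xy(1,2)] by blast
qed

lemma isometric_embedding_comp:
  assumes "isometric_embedding X Y f" "isometric_embedding Y Z g"
  shows "isometric_embedding X Z (g \<circ> f)"
  unfolding isometric_embedding_def
  using isometric_embeddingD[OF assms(1)] isometric_embeddingD[OF assms(2)] by auto

lemma isometric_trans:
  assumes "isometric X Y" "isometric Y Z" shows "isometric X Z"
proof -
  obtain f where f: "isometric_embedding X Y f" "f ` mspace X = mspace Y"
    using assms(1) unfolding isometric_def by blast
  obtain g where g: "isometric_embedding Y Z g" "g ` mspace Y = mspace Z"
    using assms(2) unfolding isometric_def by blast
  have "(g \<circ> f) ` mspace X = mspace Z"
    using image_comp[of g f "mspace X"] f(2) g(2) by simp
  then show ?thesis
    unfolding isometric_def using isometric_embedding_comp[OF f(1) g(1)] by blast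
qed

lemma isometric_sym:
  assumes "isometric X Y" shows "isometric Y X"
proof -
  obtain f where f: "isometric_embedding X Y f" "f ` mspace X = mspace Y"
    using assms unfolding isometric_def by blast
  define g where "g = inv_into (mspace X) f"
  have g1: "g (f x) = x" if "x \<in> mspace X" for x
    using that isometric_embedding_inj_on[OF f(1)] by (simp add: g_def)
  have d: "mdist Y (f x) (f y) = mdist X x y" if "x \<in> mspace X" "y \<in> mspace X" for x y
    using f(1) that by (simp add: isometric_embedding_def)
  have img: "g ` mspace Y = mspace X"
    by (simp add: f(2)[symmetric] image_image g1)
  have "mdist X (g a) (g b) = mdist Y a b" if "a \<in> f ` mspace X" "b \<in> f ` mspace X" for a b
    using that by (auto simp: g1 d)
  then have "isometric_embedding Y X g"
    unfolding isometric_embedding_def f(2) using img by blast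
  with img show ?thesis unfolding isometric_def by blast
qed

text \<open>
  The space of isometry classes of non-empty compact metric spaces. The carriers are taken to be
  subsets of \<^typ>\<open>real\<close>, equipped with an arbitrary metric: a compact metric space has at most
  continuum many points, so each isometry class is represented
  (lemma \<open>nonempty_compact_isometric_real\<close> below).
\<close>

quotient_type gh_space =
  "real metric" / partial: "\<lambda>X Y. nonempty_compact X \<and> nonempty_compact Y \<and> isometric X Y"
  morphisms rep_gh_space isometry_class
proof (rule part_equivpI)
  have "nonempty_compact (metric ({0::real}, dist))"
  proof -
    interpret Metric_space "{0::real}" dist by unfold_locales (auto simp: dist_commute dist_triangle)
    have "compact_space mtopology"
      using finite_imp_compactin[of "{0}" mtopology] by (simp add: compact_space_def)
    then show ?thesis
      by (simp add: nonempty_compact_def)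
  qed
  then show "\<exists>X :: real metric. nonempty_compact X \<and> nonempty_compact X \<and> isometric X X"
    using isometric_refl by blast
next
  show "symp (\<lambda>X Y :: real metric. nonempty_compact X \<and> nonempty_compact Y \<and> isometric X Y)"
    by (rule sympI, elim conjE, intro conjI, assumption, assumption, erule isometric_sym)
  show "transp (\<lambda>X Y :: real metric. nonempty_compact X \<and> nonempty_compact Y \<and> isometric X Y)"
    by (rule transpI, elim conjE, intro conjI, assumption, assumption, erule (1) isometric_trans)
qed

lemma nonempty_compact_isometric_real:
  fixes X :: "'a metric"
  assumes "nonempty_compact X"
  shows "\<exists>Y :: real metric. nonempty_compact Y \<and> isometric X Y"
proof -
  interpret M: Metric_space "mspace X" "mdist X" by (rule Metric_space_mspace_mdist)
  have top: "M.mtopology = mtopology_of X"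
    by (simp add: mtopology_of_def)
  have "M.mtotally_bounded (mspace X)"
    using assms M.compactin_imp_mtotally_bounded[of "mspace X"]
    by (simp add: nonempty_compact_def top compact_space_def)
  then have "\<forall>m::nat. \<exists>K. finite K \<and> K \<subseteq> mspace X \<and> mspace X \<subseteq> (\<Union>c\<in>K. M.mball c (inverse (Suc m)))"
    unfolding M.mtotally_bounded_def by simp
  then obtain K where K: "\<And>m::nat. finite (K m)"
      "\<And>m. mspace X \<subseteq> (\<Union>c\<in>K m. M.mball c (inverse (Suc m)))"
    by metis
  define C where "C = (\<Union>m. K m) \<times> (UNIV :: nat set)"
  have "countable C"
    unfolding C_def using K(1) by (intro countable_SIGMA countable_UN) (auto simp: countable_finite)
  define s where "s x = {p \<in> C. mdist X (fst p) x < inverse (Suc (snd p))}" for x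
  have "inj_on s (mspace X)"
  proof (rule inj_onI, rule ccontr)
    fix x y assume xy: "x \<in> mspace X" "y \<in> mspace X" "s x = s y" "x \<noteq> y"
    then have "mdist X x y / 2 > 0" by simp
    then obtain m where m: "inverse (Suc m) < mdist X x y / 2"
      using reals_Archimedean by blast
    obtain c where c: "c \<in> K m" "x \<in> M.mball c (inverse (Suc m))"
      using K(2)[of m] xy(1) by blast
    then have "(c, m) \<in> s x" by (auto simp: s_def C_def)
    then have "(c, m) \<in> s y" using xy(3) by simp
    then have "mdist X c y < inverse (Suc m)" by (simp add: s_def)
    moreover have "mdist X x y \<le> mdist X c x + mdist X c y"
      using c xy M.triangle'[of x c y] M.commute by simp
    ultimately show False using c m by simp
  qed
  moreover have "inj_on ((`) (to_nat_on C)) (s ` mspace X)"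
    by (rule inj_on_subset[OF inj_on_image_Pow[OF inj_on_to_nat_on[OF \<open>countable C\<close>]]])
       (auto simp: s_def)
  moreover obtain e :: "nat set \<Rightarrow> real" where "inj e"
    using nat_sets_eqpoll_reals bij_betw_imp_inj_on unfolding eqpoll_def by blast
  ultimately have "inj_on (e \<circ> (`) (to_nat_on C) \<circ> s) (mspace X)"
    using comp_inj_on inj_on_subset[OF _ subset_UNIV] by metis
  then obtain h :: "'a \<Rightarrow> real" where h: "inj_on h (mspace X)" by blast
  define g where "g = inv_into (mspace X) h"
  have g: "g (h x) = x" if "x \<in> mspace X" for x
    using h that by (simp add: g_def)
  define d where "d a b = mdist X (g a) (g b)" for a b
  interpret N: Metric_space "h ` mspace X" d
    by unfold_locales (auto simp: d_def g M.commute intro: M.triangle)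
  define Y where "Y = metric (h ` mspace X, d)"
  have Y: "mspace Y = h ` mspace X" "mdist Y = d"
    by (simp_all add: Y_def)
  have "isometric_embedding X Y h"
    unfolding isometric_embedding_def Y by (auto simp: d_def g)
  then have iso: "isometric X Y"
    unfolding isometric_def using Y by blast
  interpret MN: Metric_space12 "mspace X" "mdist X" "h ` mspace X" d ..
  have "homeomorphic_map M.mtopology N.mtopology h"
    by (rule MN.isometry_imp_homeomorphic_map) (auto simp: d_def g)
  then have "mtopology_of X homeomorphic_space mtopology_of Y"
    by (metis top N.mtopology_of Y_def homeomorphic_map_imp_homeomorphic_space)
  then have "nonempty_compact Y"
    using assms by (auto simp: nonempty_compact_def Y homeomorphic_compact_space)
  then show ?thesis using iso by blast
qed

section \<open>The Gromov-Hausdorff distance\<close>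

text \<open>
  The suprema and infima are conditionally complete ones on \<^typ>\<open>real\<close>; below, the distance is only
  applied to non-empty compact sets, where all of them are over non-empty bounded sets.
\<close>

definition hausdorff_distance :: "'a metric \<Rightarrow> 'a set \<Rightarrow> 'a set \<Rightarrow> real" where
  "hausdorff_distance Z A B =
     max (SUP a\<in>A. INF b\<in>B. mdist Z a b) (SUP b\<in>B. INF a\<in>A. mdist Z a b)"

text \<open>
  The ambient space \<open>Z\<close> is an arbitrary metric space with carrier in \<^typ>\<open>real\<close>. This is no
  restriction, since only the union of the two compact images matters.
\<close>

lift_definition gh_dist :: "gh_space \<Rightarrow> gh_space \<Rightarrow> real" is
  "\<lambda>X Y. Inf {hausdorff_distance Z (f ` mspace X) (g ` mspace Y) | (Z :: real metric) f g.
               isometric_embedding X Z f \<and> isometric_embedding Y Z g}"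
proof -
  have *: "{hausdorff_distance Z (f ` mspace X) (g ` mspace Y) | (Z :: real metric) f g.
               isometric_embedding X Z f \<and> isometric_embedding Y Z g}
        \<subseteq> {hausdorff_distance Z (f ` mspace X') (g ` mspace Y') | (Z :: real metric) f g.
               isometric_embedding X' Z f \<and> isometric_embedding Y' Z g}"
    if "isometric X' X" "isometric Y' Y" for X X' Y Y' :: "real metric"
  proof -
    obtain h where h: "isometric_embedding X' X h" "h ` mspace X' = mspace X"
      using \<open>isometric X' X\<close> unfolding isometric_def by blast
    obtain k where k: "isometric_embedding Y' Y k" "k ` mspace Y' = mspace Y"
      using \<open>isometric Y' Y\<close> unfolding isometric_def by blast
    show ?thesis
    proof clarify
      fix Z :: "real metric" and f g
      assume "isometric_embedding X Z f" "isometric_embedding Y Z g"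
      then have "isometric_embedding X' Z (f \<circ> h)" "isometric_embedding Y' Z (g \<circ> k)"
        using h k isometric_embedding_comp by blast+
      moreover have "f ` mspace X = (f \<circ> h) ` mspace X'" "g ` mspace Y = (g \<circ> k) ` mspace Y'"
        unfolding image_comp[symmetric] h(2) k(2) by simp_all
      ultimately show "\<exists>Z' f' g'. hausdorff_distance Z (f ` mspace X) (g ` mspace Y) =
          hausdorff_distance Z' (f' ` mspace X') (g' ` mspace Y') \<and>
          isometric_embedding X' (Z' :: real metric) f' \<and> isometric_embedding Y' Z' g'"
        by metis
    qed
  qed
  fix X1 X2 Y1 Y2 :: "real metric"
  assume "nonempty_compact X1 \<and> nonempty_compact X2 \<and> isometric X1 X2"
    and "nonempty_compact Y1 \<and> nonempty_compact Y2 \<and> isometric Y1 Y2"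
  then have "isometric X1 X2" "isometric X2 X1" "isometric Y1 Y2" "isometric Y2 Y1"
    using isometric_sym by blast+
  then show "?thesis X1 X2 Y1 Y2"
    by (intro arg_cong[where f = Inf] equalityI * )
qed

text \<open>
  The metric topology of a subset of the Gromov-Hausdorff space with the restricted metric:
  \<open>U\<close> is open iff it contains an open ball around each of its points.
\<close>

abbreviation gh_topology :: "gh_space set \<Rightarrow> gh_space topology" where
  "gh_topology S \<equiv> Metric_space.mtopology S gh_dist"

section \<open>Doubling, uniformly disconnected and uniformly perfect spaces\<close>

definition N_doubling :: "nat \<Rightarrow> 'a metric \<Rightarrow> bool" where
  "N_doubling N X \<longleftrightarrow>
     (\<forall>x\<in>mspace X. \<forall>r>0. \<exists>F\<subseteq>mspace X.
        mcball_of X x r \<subseteq> (\<Union>y\<in>F. mcball_of X y (r / 2)) \<and> finite F \<and> card F \<le> N)"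

definition doubling :: "'a metric \<Rightarrow> bool" where
  "doubling X \<longleftrightarrow> (\<exists>N. N_doubling N X)"

definition unif_disconnected_with :: "real \<Rightarrow> 'a metric \<Rightarrow> bool" where
  "unif_disconnected_with \<delta> X \<longleftrightarrow>
     (\<forall>N (z :: nat \<Rightarrow> 'a).
        (\<forall>i\<in>{1..N}. z i \<in> mspace X) \<and> (\<exists>i\<in>{1..N}. \<exists>j\<in>{1..N}. z i \<noteq> z j) \<longrightarrow>
        \<delta> * mdist X (z 1) (z N) \<le> (MAX i\<in>{1..N - 1}. mdist X (z i) (z (i + 1))))"

definition uniformly_disconnected :: "'a metric \<Rightarrow> bool" where
  "uniformly_disconnected X \<longleftrightarrow> (\<exists>\<delta>>0. unif_disconnected_with \<delta> X)"

definition mdiameter :: "'a metric \<Rightarrow> ereal" where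
  "mdiameter X = (SUP x\<in>mspace X. SUP y\<in>mspace X. ereal (mdist X x y))"

definition unif_perfect_with :: "real \<Rightarrow> 'a metric \<Rightarrow> bool" where
  "unif_perfect_with c X \<longleftrightarrow>
     (\<forall>x\<in>mspace X. \<forall>r>0. ereal r < mdiameter X \<longrightarrow>
        (\<exists>y\<in>mspace X. c * r \<le> mdist X x y \<and> mdist X x y \<le> r))"

definition uniformly_perfect :: "'a metric \<Rightarrow> bool" where
  "uniformly_perfect X \<longleftrightarrow> (\<exists>c. 0 < c \<and> c < 1 \<and> unif_perfect_with c X)"

definition classes_of :: "(real metric \<Rightarrow> bool) \<Rightarrow> gh_space set" where
  "classes_of P = {isometry_class X | X. nonempty_compact X \<and> P X}"

definition gh_Q :: "nat \<Rightarrow> gh_space set" where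
  "gh_Q k = (if k = 1 then classes_of doubling
             else if k = 2 then classes_of uniformly_disconnected
             else classes_of uniformly_perfect)"

definition gh_E :: "nat \<Rightarrow> nat \<Rightarrow> gh_space set" where
  "gh_E k u = (if u = 0 then UNIV - gh_Q k else if u = 1 then gh_Q k else UNIV)"

definition gh_X :: "nat \<Rightarrow> nat \<Rightarrow> nat \<Rightarrow> gh_space set" where
  "gh_X u v w = gh_E 1 u \<inter> gh_E 2 v \<inter> gh_E 3 w"

section \<open>Dimensional functions\<close>

definition dimensional_function :: "(gh_space \<Rightarrow> ennreal) \<Rightarrow> bool" where
  "dimensional_function D \<longleftrightarrow>
     (\<forall>(X :: real metric) A. nonempty_compact X \<and> closedin (mtopology_of X) A \<and> A \<noteq> {} \<longrightarrow>
        D (isometry_class (submetric X A)) \<le> D (isometry_class X)) \<and>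
     (\<forall>\<epsilon>::real. \<epsilon> > 0 \<longrightarrow>
        (\<exists>Y :: real metric. nonempty_compact Y \<and> D (isometry_class Y) = \<infinity> \<and>
           mdiameter Y \<le> ereal \<epsilon>))"

definition gh_I :: "(gh_space \<Rightarrow> ennreal) \<Rightarrow> gh_space set" where
  "gh_I D = {x. D x = \<infinity>}"

section \<open>Cantor spaces\<close>

text \<open>The middle-thirds Cantor set, as the intersection of its finite construction stages.\<close>

definition cantor_set :: "real set" where
  "cantor_set = (\<Inter>n. ((\<lambda>C. (\<lambda>x. x / 3) ` C \<union> (\<lambda>x. (x + 2) / 3) ` C) ^^ n) {0..1})"

definition gh_CA :: "gh_space set" where
  "gh_CA = classes_of (\<lambda>X. mtopology_of X homeomorphic_space top_of_set cantor_set)"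

section \<open>Covering dimension and the Hilbert cube\<close>

text \<open>
  Covering dimension in the sense of Lebesgue and Cech: every finite open cover has a finite open
  refinement such that no \<open>n + 2\<close> distinct members have a common point. On metrizable spaces, arbitrary
  open covers give the same notion.
\<close>

definition finite_open_cover :: "'a topology \<Rightarrow> 'a set set \<Rightarrow> bool" where
  "finite_open_cover X \<U> \<longleftrightarrow> finite \<U> \<and> (\<forall>U\<in>\<U>. openin X U) \<and> \<Union>\<U> = topspace X"

definition covering_dim_le :: "'a topology \<Rightarrow> nat \<Rightarrow> bool" where
  "covering_dim_le X n \<longleftrightarrow>
     (\<forall>\<U>. finite_open_cover X \<U> \<longrightarrow>
        (\<exists>\<V>. finite_open_cover X \<V> \<and> (\<forall>V\<in>\<V>. \<exists>U\<in>\<U>. V \<subseteq> U) \<and>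
             (\<forall>\<W>\<subseteq>\<V>. card \<W> = n + 2 \<longrightarrow> \<Inter>\<W> = {})))"

definition infinite_dimensional :: "'a topology \<Rightarrow> bool" where
  "infinite_dimensional X \<longleftrightarrow> (\<forall>n. \<not> covering_dim_le X n)"

definition hilbert_cube :: "(nat \<Rightarrow> real) topology" where
  "hilbert_cube = product_topology (\<lambda>_. top_of_set {0..1}) UNIV"

end

theory Submission
  imports Defs
begin

text \<open>
  Let \<open>X \<noteq> Y\<close> be members of the class. For a point \<open>q\<close> of the Hilbert cube put \<open>t = \<Sum>\<^sub>n q\<^sub>n / 2\<^sup>n\<^sup>+\<^sup>1\<close>,
  \<open>h = t (1 - t)\<close>, \<open>s = min 1 (2 - 2 t)\<close> and \<open>s' = min 1 (2 t)\<close>, and form the chain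
  \<open>h K\<^sub>q - s X - s' Y - h K\<^sub>q\<close>, in which \<open>s X\<close> and \<open>s' Y\<close> are attached at diametral points and \<open>K\<^sub>q\<close> is an
  ultrametric on the Cantor set whose sequence of distances codes \<open>q\<close>. At \<open>t = 0\<close> and \<open>t = 1\<close>, that is at the
  two constant points \<open>0\<close> and \<open>1\<close> of the cube only, the chain collapses to \<open>X\<close> and to \<open>Y\<close>. For other
  \<open>q\<close> the diameter is attained only between the two copies of \<open>K\<^sub>q\<close>, so that \<open>q\<close> can be read off the
  isometry class. The dependence on \<open>q\<close> is uniformly continuous, hence the chains give an embedding.

  Gluing and scaling preserve the three properties, and the negations of the first two pass from a
  subspace to the whole space. Superexponentially decreasing distances in \<open>K\<^sub>q\<close> destroy uniform perfectness, small gaps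
  between the pieces give Cantor sets, and since \<open>s = 1\<close> or \<open>s' = 1\<close> the value of a
  dimensional function stays infinite. Infinite dimensionality of the cube follows from a
  Poincare-Miranda theorem, which is an instance of Kuhn's lemma.
\<close>

section \<open>The Hilbert cube and covering dimension\<close>

text \<open>Two obstacles shape the chain. The factor \<open>h\<close> multiplies every coded
  distance and cannot be seen in the isometry class, so one entry of the code is kept constant; it
  recovers \<open>h\<close>, and the other entries follow. Moreover, the chain of an interior
  \<open>q\<close> might happen to be isometric to X or to Y, which would spoil injectivity; a spare
  entry of the code with three candidate values avoids this, since chains with different values are
  never isometric. The Cantor sets at the ends are ultrametric because such a space has all three
  properties once its scales drop geometrically, and so preserves every positive property of X and
  Y. Failure of uniform perfectness is the one negation that a larger space need not inherit; hence
  it has to be created by the Cantor sets themselves. A continuous injection of the compact cube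
  into a Hausdorff space is an embedding. This is why the Gromov-Hausdorff distance must be known to
  be a metric, above all that distance zero means isometric. A pair of equal members is reduced to a
  pair of distinct ones: two copies of X make a chain of larger diameter.\<close>

definition cube :: "(nat \<Rightarrow> real) set" where
  "cube = {x. \<forall>i. 0 \<le> x i \<and> x i \<le> 1}"

text \<open>The type-class topology on \<open>nat \<Rightarrow> real\<close> makes metric tools such
  as \<open>infdist\<close> available for subsets of the cube.\<close>

lemma hilbert_cube_eq: "hilbert_cube = top_of_set cube"
proof -
  have "hilbert_cube = subtopology (product_topology (\<lambda>_. euclideanreal) UNIV) (PiE UNIV (\<lambda>_. {0..1}))"
    unfolding hilbert_cube_def by (rule subtopology_product_topology[symmetric])
  also have "PiE UNIV (\<lambda>_. {0..1}) = cube"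
    by (auto simp: cube_def PiE_def Pi_def)
  finally show ?thesis
    by (simp add: euclidean_product_topology)
qed

lemma compact_space_hilbert_cube: "compact_space hilbert_cube"
  unfolding hilbert_cube_def
  by (simp add: compact_space_product_topology compact_space_subtopology)

lemma compact_cube: "compact cube"
  using compact_space_hilbert_cube unfolding hilbert_cube_eq
  by (simp add: compact_space_def compactin_subtopology)

lemma topspace_hilbert_cube: "topspace hilbert_cube = cube"
  by (simp add: hilbert_cube_eq)

lemma cubeD: "x \<in> cube \<Longrightarrow> 0 \<le> x i" "x \<in> cube \<Longrightarrow> x i \<le> 1"
  by (auto simp: cube_def)

section \<open>Poincare-Miranda on the cube and its consequences for open covers\<close>

lemma tendsto_fun_iff:
  fixes f :: "'a \<Rightarrow> 'i \<Rightarrow> 'b::topological_space"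
  shows "(f \<longlongrightarrow> l) F \<longleftrightarrow> (\<forall>i. ((\<lambda>n. f n i) \<longlongrightarrow> l i) F)"
  using limitin_componentwise[of "\<lambda>_. euclidean" UNIV f l F]
  by (simp add: euclidean_product_topology)

text \<open>Kuhn's lemma on a grid of mesh \<open>1 / p\<close> in the first \<open>m\<close>
  coordinates finds one grid point near which every \<open>f i\<close> takes values of both signs.
  Compactness of the cube lets the mesh tend to zero.\<close>

lemma Poincare_Miranda_cube:
  fixes f :: "nat \<Rightarrow> (nat \<Rightarrow> real) \<Rightarrow> real"
  assumes cont: "\<And>i. i < m \<Longrightarrow> continuous_on cube (f i)"
    and le: "\<And>i x. \<lbrakk>i < m; x \<in> cube; x i = 0\<rbrakk> \<Longrightarrow> f i x \<le> 0"
    and ge: "\<And>i x. \<lbrakk>i < m; x \<in> cube; x i = 1\<rbrakk> \<Longrightarrow> 0 \<le> f i x"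
  obtains x where "x \<in> cube" "\<And>i. i < m \<Longrightarrow> f i x = 0"
proof -
  have approx: "\<exists>y\<in>cube. \<forall>i<m. \<exists>u\<in>cube. \<exists>v\<in>cube. f i u \<le> 0 \<and> 0 \<le> f i v \<and>
      (\<forall>j. \<bar>u j - y j\<bar> \<le> 1 / real (Suc k) \<and> \<bar>v j - y j\<bar> \<le> 1 / real (Suc k))" for k
  proof -
    define p where "p = Suc k"
    have "p > 0" by (simp add: p_def)
    \<comment> \<open>Coordinates from \<open>m\<close> on are frozen at 0, so the
      finite-dimensional grid sits inside the infinite cube.\<close>
    define g where "g x j = (if j < m then real (x j) / real p else 0)" for x :: "nat \<Rightarrow> nat" and j
    have g: "g x \<in> cube" if "\<forall>i<m. x i \<le> p" for x
      using that \<open>p > 0\<close> by (auto simp: g_def cube_def)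
    \<comment> \<open>Kuhn's lemma prescribes the labels on opposite faces; the boundary hypotheses
      make these forced labels agree with the sign of \<open>f i\<close>.\<close>
    define label where "label x i =
      (if x i = 0 then 0 else if x i = p then 1 else if f i (g x) \<le> 0 then 0 else 1 :: nat)" for x i
    obtain q where q: "\<forall>i<m. q i < p"
      and rs: "\<forall>i<m. \<exists>r s. (\<forall>j<m. q j \<le> r j \<and> r j \<le> q j + 1) \<and>
          (\<forall>j<m. q j \<le> s j \<and> s j \<le> q j + 1) \<and> label r i \<noteq> label s i"
      by (rule kuhn_lemma[of p m label]) (use \<open>p > 0\<close> in \<open>auto simp: label_def\<close>)
    have close: "\<bar>g r j - g q j\<bar> \<le> 1 / real p" if "\<forall>j<m. q j \<le> r j \<and> r j \<le> q j + 1" for r j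
    proof (cases "j < m")
      case True
      have "real (r j) - real (q j) \<le> 1" "real (q j) \<le> real (r j)"
        using that True by force+
      then show ?thesis
        using True \<open>p > 0\<close> by (simp add: g_def diff_divide_distrib[symmetric] divide_simps)
    qed (simp add: g_def)
    have lab: "label r i = 0 \<Longrightarrow> f i (g r) \<le> 0" "label r i \<noteq> 0 \<Longrightarrow> 0 \<le> f i (g r)"
      if "i < m" "\<forall>i<m. r i \<le> p" for r i
      using that le[OF that(1) g[OF that(2)]] ge[OF that(1) g[OF that(2)]] \<open>p > 0\<close>
      by (auto simp: label_def g_def split: if_splits)
      have Suc_q: "q i + 1 \<le> p" if "i < m" for i
        using q that by (simp add: Suc_leI)
      have le_p: "\<forall>i<m. x i \<le> p" if x: "\<forall>j<m. q j \<le> x j \<and> x j \<le> q j + 1" for x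
      proof (intro allI impI)
        fix i assume i: "i < m"
        then have "x i \<le> q i + 1" using x by blast
        then show "x i \<le> p" using Suc_q[OF i] by linarith
      qed
    show ?thesis
    proof (rule bexI[of _ "g q"], intro allI impI)
      fix i assume i: "i < m"
      obtain r s where r: "\<forall>j<m. q j \<le> r j \<and> r j \<le> q j + 1"
        and s: "\<forall>j<m. q j \<le> s j \<and> s j \<le> q j + 1" and ne: "label r i \<noteq> label s i"
        using rs i by blast
      have rp: "\<forall>i<m. r i \<le> p" and sp: "\<forall>i<m. s i \<le> p"
        by (rule le_p[OF r], rule le_p[OF s])
      have two: "label r i = 0 \<or> label s i = 0"
        using ne by (auto simp: label_def split: if_splits)
      show "\<exists>u\<in>cube. \<exists>v\<in>cube. f i u \<le> 0 \<and> 0 \<le> f i v \<and>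
          (\<forall>j. \<bar>u j - g q j\<bar> \<le> 1 / real (Suc k) \<and> \<bar>v j - g q j\<bar> \<le> 1 / real (Suc k))"
      proof (cases "label r i = 0")
        case True
        then show ?thesis
          using ne lab[OF i rp] lab[OF i sp] g[OF rp] g[OF sp] close[OF r] close[OF s]
          unfolding p_def by (intro bexI[of _ "g r"] bexI[of _ "g s"]) auto
      next
        case False
        then show ?thesis
          using two lab[OF i rp] lab[OF i sp] g[OF rp] g[OF sp] close[OF r] close[OF s]
          unfolding p_def by (intro bexI[of _ "g s"] bexI[of _ "g r"]) auto
      qed
    qed (use q in \<open>auto intro!: g simp: less_imp_le\<close>)
  qed
  then obtain y where y: "\<And>k. y k \<in> cube"
    and ex: "\<And>k i. i < m \<Longrightarrow> \<exists>u\<in>cube. \<exists>v\<in>cube. f i u \<le> 0 \<and> 0 \<le> f i v \<and>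
      (\<forall>j. \<bar>u j - y k j\<bar> \<le> 1 / real (Suc k) \<and> \<bar>v j - y k j\<bar> \<le> 1 / real (Suc k))"
    by metis
  have "\<forall>k i. \<exists>u v. i < m \<longrightarrow> u \<in> cube \<and> v \<in> cube \<and> f i u \<le> 0 \<and> 0 \<le> f i v \<and>
      (\<forall>j. \<bar>u j - y k j\<bar> \<le> 1 / real (Suc k) \<and> \<bar>v j - y k j\<bar> \<le> 1 / real (Suc k))"
    (is "\<forall>k i. \<exists>u v. ?P k i u v")
    using ex by blast
  then obtain u v where "\<And>k i. ?P k i (u k i) (v k i)"
    unfolding choice_iff by blast
  then have uv: "\<And>k i. i < m \<Longrightarrow> u k i \<in> cube" "\<And>k i. i < m \<Longrightarrow> v k i \<in> cube"
      "\<And>k i. i < m \<Longrightarrow> f i (u k i) \<le> 0" "\<And>k i. i < m \<Longrightarrow> 0 \<le> f i (v k i)"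
      "\<And>k i j. i < m \<Longrightarrow> \<bar>u k i j - y k j\<bar> \<le> 1 / real (Suc k)"
      "\<And>k i j. i < m \<Longrightarrow> \<bar>v k i j - y k j\<bar> \<le> 1 / real (Suc k)"
    by blast+
  obtain l \<sigma> where l: "l \<in> cube" "strict_mono \<sigma>" "(y \<circ> \<sigma>) \<longlonglongrightarrow> l"
    using compact_cube y unfolding compact_def by metis
  have lim: "(\<lambda>k. w (\<sigma> k)) \<longlonglongrightarrow> l"
    if w: "\<And>k j. \<bar>w k j - y k j\<bar> \<le> 1 / real (Suc k)" for w
    unfolding tendsto_fun_iff
  proof
    fix j
    have "(\<lambda>k. w k j - y k j) \<longlonglongrightarrow> 0"
      by (rule tendsto_rabs_zero_cancel, rule tendsto_sandwich[OF _ _ tendsto_const LIMSEQ_Suc[OF lim_1_over_n]])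
         (use w in auto)
    then have "(\<lambda>k. w (\<sigma> k) j - y (\<sigma> k) j) \<longlonglongrightarrow> 0"
      using LIMSEQ_subseq_LIMSEQ[OF _ l(2)] by (fastforce simp: o_def)
    moreover have "(\<lambda>k. y (\<sigma> k) j) \<longlonglongrightarrow> l j"
      using l(3) by (simp add: tendsto_fun_iff o_def)
    ultimately show "(\<lambda>k. w (\<sigma> k) j) \<longlonglongrightarrow> l j"
      using tendsto_add[of "\<lambda>k. w (\<sigma> k) j - y (\<sigma> k) j" 0 sequentially] by fastforce
  qed
  have "f i l = 0" if i: "i < m" for i
  proof (rule antisym)
    have "(\<lambda>k. f i (u (\<sigma> k) i)) \<longlonglongrightarrow> f i l"
      using continuous_on_tendsto_compose[OF cont[OF i] lim[of "\<lambda>k. u k i"] l(1)] uv i by simp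
    then show "f i l \<le> 0"
      by (rule LIMSEQ_le_const2) (use uv i in auto)
    have "(\<lambda>k. f i (v (\<sigma> k) i)) \<longlonglongrightarrow> f i l"
      using continuous_on_tendsto_compose[OF cont[OF i] lim[of "\<lambda>k. v k i"] l(1)] uv i by simp
    then show "0 \<le> f i l"
      by (rule LIMSEQ_le_const) (use uv i in auto)
  qed
  with l(1) that show thesis by blast
qed

text \<open>Where the distances to the complements of all \<open>W i\<close> agree, they are positive because the \<open>W i\<close>
  cover the cube.\<close>

lemma cube_cover_common_point:
  fixes W :: "nat \<Rightarrow> (nat \<Rightarrow> real) set"
  assumes op: "\<And>i. i \<le> m \<Longrightarrow> openin (top_of_set cube) (W i)"
    and cov: "cube \<subseteq> (\<Union>i\<le>m. W i)"
    and pos: "\<And>i x. \<lbrakk>i < m; x \<in> W i\<rbrakk> \<Longrightarrow> x i > 0"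
    and lt: "\<And>i x. \<lbrakk>i < m; x \<in> W m\<rbrakk> \<Longrightarrow> x i < 1"
    and "m > 0"
  shows "(\<Inter>i\<le>m. W i) \<noteq> {}"
proof -
  define C where "C i = cube - W i" for i
  have "closedin (top_of_set cube) (C i)" if "i \<le> m" for i
    unfolding C_def using op[OF that] by (auto intro: closedin_diff)
  then have clo: "closed (C i)" if "i \<le> m" for i
    using that compact_cube by (meson closedin_closed_trans compact_imp_closed)
  \<comment> \<open>Two corners of the cube show that no complement is empty, so
    \<open>infdist\<close> to it is a genuine distance that vanishes exactly on it.\<close>
  have "(\<lambda>_. 0) \<in> C i" if "i < m" for i
    using pos[OF that] by (force simp: C_def cube_def)
  moreover have "(\<lambda>_. 1) \<in> C m"
    using lt[OF \<open>m > 0\<close>] by (force simp: C_def cube_def)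
  ultimately have ne: "C i \<noteq> {}" if "i \<le> m" for i
    using that le_neq_implies_less by blast
  define \<phi> where "\<phi> i x = infdist x (C i)" for i x
  have \<phi>: "\<phi> i x = 0 \<longleftrightarrow> x \<notin> W i" if "i \<le> m" "x \<in> cube" for i x
    using in_closed_iff_infdist_zero[OF clo ne, of i x] that by (auto simp: \<phi>_def C_def)
  have nn: "\<phi> i x \<ge> 0" for i x by (simp add: \<phi>_def infdist_nonneg)
  have "\<exists>x\<in>cube. \<forall>i<m. \<phi> i x - \<phi> m x = 0"
  proof (rule Poincare_Miranda_cube[of m "\<lambda>i x. \<phi> i x - \<phi> m x"])
    show "continuous_on cube (\<lambda>x. \<phi> i x - \<phi> m x)" for i
      unfolding \<phi>_def by (intro continuous_intros)
    show "\<phi> i x - \<phi> m x \<le> 0" if "i < m" "x \<in> cube" "x i = 0" for i x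
    proof -
      have "x \<notin> W i" using pos that by force
      then show ?thesis using \<phi>[of i x] that nn by simp
    qed
    show "0 \<le> \<phi> i x - \<phi> m x" if "i < m" "x \<in> cube" "x i = 1" for i x
    proof -
      have "x \<notin> W m" using lt that by force
      then show ?thesis using \<phi>[of m x] that nn by simp
    qed
  qed blast
  then obtain x where x: "x \<in> cube" "\<And>i. i < m \<Longrightarrow> \<phi> i x - \<phi> m x = 0"
    by blast
  then have eq: "\<phi> i x = \<phi> m x" if "i \<le> m" for i
    using that by (cases "i = m") auto
  obtain k where k: "k \<le> m" "x \<in> W k" using cov x(1) by blast
  then have "\<phi> m x \<noteq> 0" using \<phi>[of k x] eq[OF k(1)] k x(1) by simp
  then have "x \<in> W i" if "i \<le> m" for i
    using \<phi>[OF that x(1)] eq[OF that] by simp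
  then show ?thesis by blast
qed

text \<open>The cube is covered by the sets \<open>x i > 0\<close> for \<open>i < m\<close> and the
  set where the first \<open>m\<close> coordinates are all below 1. Grouping the members of a
  refinement by the set that contains them yields \<open>m + 1\<close> sets with a common point. The
  image of the cube is compact, hence closed, and its complement completes this to a cover of
  \<open>Y\<close>.\<close>

lemma infinite_dimensional_if_hilbert_cube_embeds:
  assumes emb: "embedding_map hilbert_cube Y f" and "Hausdorff_space Y"
  shows "infinite_dimensional Y"
  unfolding infinite_dimensional_def
proof (intro allI notI)
  fix n assume dim: "covering_dim_le Y n"
  \<comment> \<open>The \<open>m + 1\<close> sets that will meet are then \<open>n + 2\<close>, the
    number forbidden by dimension at most \<open>n\<close>.\<close>
  define m where "m = Suc n"
  have hom: "homeomorphic_map hilbert_cube (subtopology Y (f ` cube)) f"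
    using emb by (simp add: embedding_map_def topspace_hilbert_cube)
  then have cont: "continuous_map hilbert_cube Y f" and inj: "inj_on f cube"
    using homeomorphic_imp_continuous_map[OF hom] homeomorphic_imp_injective_map[OF hom]
    by (auto simp: continuous_map_in_subtopology topspace_hilbert_cube)
  define U where "U i = (if i < m then {x \<in> cube. x i > 0} else {x \<in> cube. \<forall>j<m. x j < 1})" for i
  have opU: "openin hilbert_cube (U i)" for i
  proof -
    have c: "continuous_on cube (\<lambda>x. x j)" for j
      by (rule continuous_on_product_then_coordinatewise[OF continuous_on_id])
    have 1: "openin (top_of_set cube) {x \<in> cube. x j > 0}" "openin (top_of_set cube) {x \<in> cube. x j < 1}" for j
      using continuous_openin_preimage_gen[OF c[of j] open_greaterThan[of 0]]
        continuous_openin_preimage_gen[OF c[of j] open_lessThan[of 1]]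
      by (simp_all add: vimage_def Collect_conj_eq)
    have "{x \<in> cube. \<forall>j<m. x j < 1} = (\<Inter>j\<in>{..<m}. {x \<in> cube. x j < 1})"
      by (auto simp: m_def)
    moreover have "openin (top_of_set cube) \<dots>"
      by (rule openin_INT2) (use 1 in \<open>simp_all add: m_def lessThan_empty_iff\<close>)
    ultimately have "openin (top_of_set cube) {x \<in> cube. \<forall>j<m. x j < 1}"
      by simp
    then show ?thesis
      using 1(1)[of i] by (simp add: hilbert_cube_eq U_def)
  qed
  have "\<exists>T. openin Y T \<and> f ` U i = T \<inter> f ` cube" for i
    using homeomorphic_imp_open_map[OF hom] opU[of i]
    unfolding open_map_def openin_subtopology by blast
  then obtain T where T: "\<And>i. openin Y (T i)" "\<And>i. f ` U i = T i \<inter> f ` cube"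
    by metis
  have clo: "closedin Y (f ` cube)"
    using compact_space_hilbert_cube unfolding compact_space_def topspace_hilbert_cube
    by (intro compactin_imp_closedin[OF \<open>Hausdorff_space Y\<close>] image_compactin[OF _ cont])
  have fsub: "f ` cube \<subseteq> topspace Y"
    using cont by (simp add: clo closedin_subset)
  define \<U> where "\<U> = insert (topspace Y - f ` cube) (T ` {..m})"
  have covU: "cube \<subseteq> (\<Union>i\<le>m. U i)"
  proof
    fix x assume "x \<in> cube"
    show "x \<in> (\<Union>i\<le>m. U i)"
    proof (cases "\<exists>i<m. x i > 0")
      case True
      then show ?thesis using \<open>x \<in> cube\<close> by (auto simp: U_def intro: less_imp_le)
    next
      case False
      then have "x \<in> U m" using \<open>x \<in> cube\<close> by (force simp: U_def)
      then show ?thesis by blast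
    qed
  qed
  have "finite_open_cover Y \<U>"
    unfolding finite_open_cover_def
  proof (intro conjI)
    show "finite \<U>" by (simp add: \<U>_def)
    show op: "\<forall>U\<in>\<U>. openin Y U" using T(1) clo by (auto simp: \<U>_def)
    show "\<Union>\<U> = topspace Y"
    proof
      show "\<Union>\<U> \<subseteq> topspace Y" using op openin_subset by blast
      have "f ` cube \<subseteq> (\<Union>i\<le>m. f ` U i)" using covU by blast
      then show "topspace Y \<subseteq> \<Union>\<U>" using T(2) by (auto simp: \<U>_def)
    qed
  qed
  then obtain \<V> where \<V>: "finite_open_cover Y \<V>" "\<And>V. V \<in> \<V> \<Longrightarrow> \<exists>U\<in>\<U>. V \<subseteq> U"
      "\<And>\<W>. \<lbrakk>\<W> \<subseteq> \<V>; card \<W> = n + 2\<rbrakk> \<Longrightarrow> \<Inter>\<W> = {}"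
    using dim unfolding covering_dim_le_def by meson
  then obtain R where R: "\<And>V. V \<in> \<V> \<Longrightarrow> R V \<in> \<U>" "\<And>V. V \<in> \<V> \<Longrightarrow> V \<subseteq> R V"
    by metis
  \<comment> \<open>Every member gets a single index, so members picked for different indices are
    distinct when they are counted at the end.\<close>
  define I where "I V = (LEAST i. R V = T i)" for V
  have I: "R V = T (I V) \<and> I V \<le> m" if RV: "R V \<in> T ` {..m}" for V
  proof -
    obtain j where j: "R V = T j" "j \<le> m" using RV by blast
    then show ?thesis
      using LeastI[of "\<lambda>i. R V = T i" j] Least_le[of "\<lambda>i. R V = T i" j] unfolding I_def by simp
  qed
  define W where "W i = {x \<in> cube. \<exists>V\<in>\<V>. f x \<in> V \<and> R V \<in> T ` {..m} \<and> I V = i}" for i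
  have WU: "W i \<subseteq> U i" for i
  proof
    fix x assume "x \<in> W i"
    then obtain V where V: "x \<in> cube" "V \<in> \<V>" "f x \<in> V" "R V \<in> T ` {..m}" "I V = i"
      unfolding W_def by blast
    then have "f x \<in> T i" "x \<in> cube"
      using I[OF V(4)] R(2)[OF V(2)] by auto
    then have "f x \<in> f ` U i" using T(2) by blast
    moreover have "U i \<subseteq> cube" by (auto simp: U_def)
    ultimately show "x \<in> U i" using inj \<open>x \<in> cube\<close> by (meson inj_on_image_mem_iff)
  qed
  have "(\<Inter>i\<le>m. W i) \<noteq> {}"
  proof (rule cube_cover_common_point)
    show "openin (top_of_set cube) (W i)" for i
    proof -
      have "W i = (\<Union>V\<in>{V \<in> \<V>. R V \<in> T ` {..m} \<and> I V = i}. {x \<in> cube. f x \<in> V})"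
        by (auto simp: W_def)
      moreover have "openin (top_of_set cube) {x \<in> cube. f x \<in> V}" if "V \<in> \<V>" for V
        using openin_continuous_map_preimage[OF cont, of V] \<V>(1) that
        unfolding finite_open_cover_def topspace_hilbert_cube by (simp add: hilbert_cube_eq)
      ultimately show ?thesis by auto
    qed
    show "cube \<subseteq> (\<Union>i\<le>m. W i)"
    proof
      fix x assume x: "x \<in> cube"
      then have "f x \<in> topspace Y" using fsub by blast
      then have "f x \<in> \<Union>\<V>" using \<V>(1) by (simp add: finite_open_cover_def)
      then obtain V where V: "V \<in> \<V>" "f x \<in> V" by blast
      then have "R V \<in> T ` {..m}"
        using R[of V] x by (auto simp: \<U>_def)
      then have "x \<in> W (I V)" "I V \<le> m" using V x I[of V] unfolding W_def by blast+
      then show "x \<in> (\<Union>i\<le>m. W i)" by blast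
    qed
    show "x i > 0" if "i < m" "x \<in> W i" for i x
      using WU[of i] that by (auto simp: U_def)
    show "x i < 1" if "i < m" "x \<in> W m" for i x
      using WU[of m] that by (auto simp: U_def)
    show "m > 0" by (simp add: m_def)
  qed
  then obtain x where "\<And>i. i \<le> m \<Longrightarrow> x \<in> W i" by blast
  then have "\<forall>i\<in>{..m}. \<exists>V. V \<in> \<V> \<and> f x \<in> V \<and> I V = i" unfolding W_def by blast
  then obtain G where G: "\<And>i. i \<in> {..m} \<Longrightarrow> G i \<in> \<V> \<and> f x \<in> G i \<and> I (G i) = i"
    by metis
  then have "inj_on G {..m}" by (intro inj_on_inverseI[of _ I]) blast
  then have "card (G ` {..m}) = n + 2" by (simp add: card_image m_def)
  moreover have "G ` {..m} \<subseteq> \<V>" using G by blast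
  ultimately have "\<Inter>(G ` {..m}) = {}" by (intro \<V>(3))
  moreover have "f x \<in> \<Inter>(G ` {..m})" using G by blast
  ultimately show False by blast
qed

section \<open>Pseudometrics realizing isometry classes\<close>

text \<open>All the interpolating spaces live on one carrier. Distances are only pseudometrics there, because
  some of the pieces are scaled down to points.\<close>

definition pseudometric_on :: "'a set \<Rightarrow> ('a \<Rightarrow> 'a \<Rightarrow> real) \<Rightarrow> bool" where
  "pseudometric_on M d \<longleftrightarrow>
     (\<forall>x\<in>M. d x x = 0) \<and> (\<forall>x\<in>M. \<forall>y\<in>M. d x y = d y x) \<and>
     (\<forall>x\<in>M. \<forall>y\<in>M. \<forall>z\<in>M. d x z \<le> d x y + d y z)"

lemma pseudometric_onD:
  assumes "pseudometric_on M d"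
  shows "x \<in> M \<Longrightarrow> d x x = 0" "x \<in> M \<Longrightarrow> y \<in> M \<Longrightarrow> d x y = d y x"
    "x \<in> M \<Longrightarrow> y \<in> M \<Longrightarrow> z \<in> M \<Longrightarrow> d x z \<le> d x y + d y z"
  using assms by (auto simp: pseudometric_on_def)

lemma pseudometric_on_nonneg:
  assumes "pseudometric_on M d" "x \<in> M" "y \<in> M" shows "0 \<le> d x y"
  using pseudometric_onD(1)[OF assms(1,2)] pseudometric_onD(2)[OF assms]
    pseudometric_onD(3)[OF assms(1,2,3,2)] by linarith

lemma pseudometric_on_mdist: "pseudometric_on (mspace X) (mdist X)"
  using Metric_space.triangle[OF Metric_space_mspace_mdist[of X]]
    Metric_space.commute[OF Metric_space_mspace_mdist[of X]]
  by (auto simp: pseudometric_on_def)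

text \<open>The sequential form makes sense although limits are only determined up to distance zero,
  and it passes to joins by taking subsequences.\<close>

definition pcompact :: "'a set \<Rightarrow> ('a \<Rightarrow> 'a \<Rightarrow> real) \<Rightarrow> bool" where
  "pcompact M d \<longleftrightarrow> M \<noteq> {} \<and> pseudometric_on M d \<and>
     (\<forall>\<sigma>::nat \<Rightarrow> 'a. range \<sigma> \<subseteq> M \<longrightarrow>
        (\<exists>l\<in>M. \<exists>r. strict_mono (r :: nat \<Rightarrow> nat) \<and> (\<lambda>n. d (\<sigma> (r n)) l) \<longlonglongrightarrow> 0))"

lemma compact_metric_iff_pcompact:
  "compact_space (mtopology_of X) \<and> mspace X \<noteq> {} \<longleftrightarrow> pcompact (mspace X) (mdist X)"
proof -
  interpret Metric_space "mspace X" "mdist X" by (rule Metric_space_mspace_mdist)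
  have lim: "limitin mtopology (\<sigma> \<circ> r) l sequentially \<longleftrightarrow> (\<lambda>n. mdist X (\<sigma> (r n)) l) \<longlonglongrightarrow> 0"
    if "range \<sigma> \<subseteq> mspace X" "l \<in> mspace X" for \<sigma> :: "nat \<Rightarrow> 'a" and r l
    using that by (auto simp: limitin_metric_dist_null o_def range_subsetD)
  show ?thesis
    unfolding mtopology_of_def compact_space_sequentially pcompact_def
    using lim pseudometric_on_mdist[of X] by blast
qed

lemma nonempty_compact_iff_pcompact: "nonempty_compact X \<longleftrightarrow> pcompact (mspace X) (mdist X)"
  using compact_metric_iff_pcompact[of X] by (auto simp: nonempty_compact_def)

lemma pcompact_bounded:
  assumes "pcompact M d"
  obtains K where "K \<ge> 0" "\<And>x y. x \<in> M \<Longrightarrow> y \<in> M \<Longrightarrow> d x y \<le> K"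
proof -
  obtain a where a: "a \<in> M" using assms by (auto simp: pcompact_def)
  have pm: "pseudometric_on M d" using assms by (simp add: pcompact_def)
  have "\<exists>K::nat. \<forall>x\<in>M. d x a \<le> K"
  proof (rule ccontr)
    assume "\<not> ?thesis"
    then have "\<forall>n::nat. \<exists>x. x \<in> M \<and> real n < d x a" by (meson not_le)
    then obtain \<sigma> where \<sigma>: "\<And>n::nat. \<sigma> n \<in> M" "\<And>n. real n < d (\<sigma> n) a" by metis
    then obtain l r where l: "l \<in> M" "strict_mono r" "(\<lambda>n. d (\<sigma> (r n)) l) \<longlonglongrightarrow> 0"
      using assms unfolding pcompact_def by (metis image_subsetI)
    have "\<forall>\<^sub>F n in sequentially. d (\<sigma> (r n)) l < 1"
      using l(3) by (rule order_tendstoD) simp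
    moreover have "\<forall>\<^sub>F n in sequentially. real n > 1 + d l a"
      by (metis eventually_at_top_dense filterlim_iff filterlim_real_sequentially)
    ultimately have "\<forall>\<^sub>F n in sequentially. d (\<sigma> (r n)) l < 1 \<and> real n > 1 + d l a"
      by (rule eventually_conj)
    then obtain n where n: "d (\<sigma> (r n)) l < 1" "real n > 1 + d l a"
      by (metis (mono_tags, lifting) eventually_sequentially order_refl)
    have "n \<le> r n" using l(2) by (rule seq_suble)
    then show False
      using n \<sigma>(2)[of "r n"] pseudometric_onD(3)[OF pm \<sigma>(1)[of "r n"] l(1) a] by linarith
  qed
  then obtain K :: nat where K: "\<And>x. x \<in> M \<Longrightarrow> d x a \<le> K" by blast
  show thesis
  proof (rule that[of "2 * real K"])
    fix x y assume xy: "x \<in> M" "y \<in> M"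
    show "d x y \<le> 2 * real K"
      using pseudometric_onD(3)[OF pm xy(1) a xy(2)] pseudometric_onD(2)[OF pm a xy(2)]
        K[OF xy(1)] K[OF xy(2)] by linarith
  qed simp
qed

definition realizes :: "gh_space \<Rightarrow> 'a set \<Rightarrow> ('a \<Rightarrow> 'a \<Rightarrow> real) \<Rightarrow> bool" where
  "realizes x M d \<longleftrightarrow> (\<exists>X \<phi>. nonempty_compact X \<and> x = isometry_class X \<and> \<phi> ` M = mspace X \<and>
     (\<forall>m\<in>M. \<forall>m'\<in>M. mdist X (\<phi> m) (\<phi> m') = d m m'))"

lemma isometry_class_eq_iff:
  assumes "nonempty_compact X" "nonempty_compact Y"
  shows "isometry_class X = isometry_class Y \<longleftrightarrow> isometric X Y"
  using Quotient3_rel[OF Quotient3_gh_space, of X Y] assms isometric_refl by blast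

lemma ex_isometry_class:
  obtains X where "nonempty_compact X" "x = isometry_class X"
  using Quotient3_rep_reflp[OF Quotient3_gh_space] Quotient3_abs_rep[OF Quotient3_gh_space] by metis

lemma realizes_isometry_class:
  "nonempty_compact X \<Longrightarrow> realizes (isometry_class X) (mspace X) (mdist X)"
  unfolding realizes_def by (rule exI[of _ X], rule exI[of _ id]) simp

lemma realizes_onto:
  assumes "realizes x M d" "nonempty_compact X" "x = isometry_class X"
  obtains \<phi> where "\<phi> ` M = mspace X" "\<And>m m'. m \<in> M \<Longrightarrow> m' \<in> M \<Longrightarrow> mdist X (\<phi> m) (\<phi> m') = d m m'"
proof -
  obtain Y \<phi> where Y: "nonempty_compact Y" "x = isometry_class Y" "\<phi> ` M = mspace Y"
      "\<And>m m'. m \<in> M \<Longrightarrow> m' \<in> M \<Longrightarrow> mdist Y (\<phi> m) (\<phi> m') = d m m'"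
    using assms(1) unfolding realizes_def by blast
  then have "isometric Y X" using isometry_class_eq_iff assms by metis
  then obtain h where h: "isometric_embedding Y X h" "h ` mspace Y = mspace X"
    unfolding isometric_def by blast
  show thesis
  proof (rule that[of "h \<circ> \<phi>"])
    show "(h \<circ> \<phi>) ` M = mspace X" using Y(3) h(2) by (metis image_comp)
    show "mdist X ((h \<circ> \<phi>) m) ((h \<circ> \<phi>) m') = d m m'" if "m \<in> M" "m' \<in> M" for m m'
      using isometric_embeddingD(2)[OF h(1)] Y that by (metis comp_apply imageI)
  qed
qed

lemma realizes_surj:
  assumes "realizes x M d" "p ` N = M"
  shows "realizes x N (\<lambda>u v. d (p u) (p v))"
proof -
  obtain X \<phi> where X: "nonempty_compact X" "x = isometry_class X" "\<phi> ` M = mspace X"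
      "\<And>m m'. m \<in> M \<Longrightarrow> m' \<in> M \<Longrightarrow> mdist X (\<phi> m) (\<phi> m') = d m m'"
    using assms(1) unfolding realizes_def by blast
  have "(\<phi> \<circ> p) ` N = mspace X" using X(3) assms(2) by (metis image_comp)
  then show ?thesis
    unfolding realizes_def using X assms(2) by (intro exI[of _ X] exI[of _ "\<phi> \<circ> p"]) auto
qed

lemma realizes_cong:
  assumes "realizes x M d" "\<And>u v. u \<in> M \<Longrightarrow> v \<in> M \<Longrightarrow> d u v = d' u v"
  shows "realizes x M d'"
  using assms unfolding realizes_def by (metis (no_types, lifting))

text \<open>Both spaces are the quotient of \<open>M\<close> by distance zero: a preimage under the
  first map is unique up to distance zero, which the second map does not see.\<close>

lemma realizes_unique:
  assumes "realizes x M d" "realizes y M d"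
  shows "x = y"
proof -
  obtain X where X: "nonempty_compact X" "x = isometry_class X" by (rule ex_isometry_class)
  obtain Y where Y: "nonempty_compact Y" "y = isometry_class Y" by (rule ex_isometry_class)
  obtain \<phi> where \<phi>: "\<phi> ` M = mspace X" "\<And>m m'. m \<in> M \<Longrightarrow> m' \<in> M \<Longrightarrow> mdist X (\<phi> m) (\<phi> m') = d m m'"
    using realizes_onto[OF assms(1) X] by blast
  obtain \<psi> where \<psi>: "\<psi> ` M = mspace Y" "\<And>m m'. m \<in> M \<Longrightarrow> m' \<in> M \<Longrightarrow> mdist Y (\<psi> m) (\<psi> m') = d m m'"
    using realizes_onto[OF assms(2) Y] by blast
  define s where "s a = (SOME m. m \<in> M \<and> \<phi> m = a)" for a
  have s: "s a \<in> M \<and> \<phi> (s a) = a" if "a \<in> mspace X" for a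
  proof -
    have "a \<in> \<phi> ` M" using that \<phi>(1) by simp
    then show ?thesis unfolding s_def by (intro someI_ex[of "\<lambda>m. m \<in> M \<and> \<phi> m = a"]) blast
  qed
  have e: "isometric_embedding X Y (\<lambda>a. \<psi> (s a))"
    unfolding isometric_embedding_def
  proof (intro conjI ballI)
    show "(\<lambda>a. \<psi> (s a)) ` mspace X \<subseteq> mspace Y" using s \<psi>(1) by blast
    show "mdist Y (\<psi> (s a)) (\<psi> (s b)) = mdist X a b" if "a \<in> mspace X" "b \<in> mspace X" for a b
      using s[OF that(1)] s[OF that(2)] \<phi>(2)[of "s a" "s b"] \<psi>(2)[of "s a" "s b"] by simp
  qed
  have "mspace Y \<subseteq> (\<lambda>a. \<psi> (s a)) ` mspace X"
  proof
    fix b assume "b \<in> mspace Y"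
    then obtain m where m: "m \<in> M" "b = \<psi> m" using \<psi>(1) by blast
    then have a: "\<phi> m \<in> mspace X" using \<phi>(1) by blast
    have "mdist X (\<phi> (s (\<phi> m))) (\<phi> m) = 0" using s[OF a] a by simp
    then have "mdist Y (\<psi> (s (\<phi> m))) b = 0"
      using \<phi>(2)[of "s (\<phi> m)" m] \<psi>(2)[of "s (\<phi> m)" m] s[OF a] m by simp
    then have "\<psi> (s (\<phi> m)) = b"
      using mdist_zero[of "\<psi> (s (\<phi> m))" Y b] s[OF a] m \<psi>(1) by blast
    then show "b \<in> (\<lambda>a. \<psi> (s a)) ` mspace X" using a by blast
  qed
  then have "isometric X Y"
    unfolding isometric_def using e unfolding isometric_embedding_def by blast
  then show ?thesis using isometry_class_eq_iff X Y by blast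
qed

lemma realizes_pcompact:
  assumes "realizes x M d" shows "pcompact M d"
proof -
  obtain X \<phi> where X: "nonempty_compact X" "x = isometry_class X" "\<phi> ` M = mspace X"
      "\<And>m m'. m \<in> M \<Longrightarrow> m' \<in> M \<Longrightarrow> d m m' = mdist X (\<phi> m) (\<phi> m')"
    using assms(1) unfolding realizes_def by metis
  have cX: "pcompact (mspace X) (mdist X)"
    using X(1) nonempty_compact_iff_pcompact by blast
  have mem: "\<phi> m \<in> mspace X" if "m \<in> M" for m using that X(3) by blast
  show ?thesis
    unfolding pcompact_def
  proof (intro conjI allI impI)
    show "M \<noteq> {}" using X(1,3) by (auto simp: nonempty_compact_def)
    show "pseudometric_on M d"
      using pseudometric_onD[OF pseudometric_on_mdist[of X]] mem
      by (auto simp: pseudometric_on_def X(4))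
    fix \<sigma> :: "nat \<Rightarrow> 'a" assume \<sigma>: "range \<sigma> \<subseteq> M"
    then have "range (\<phi> \<circ> \<sigma>) \<subseteq> mspace X" using mem by auto
    then obtain l r where l: "l \<in> mspace X" "strict_mono r" "(\<lambda>n. mdist X ((\<phi> \<circ> \<sigma>) (r n)) l) \<longlonglongrightarrow> 0"
      using cX unfolding pcompact_def by blast
    obtain m where m: "m \<in> M" "l = \<phi> m" using l(1) X(3) by blast
    have "(\<lambda>n. d (\<sigma> (r n)) m) \<longlonglongrightarrow> 0"
      using l(3) \<sigma> m by (simp add: X(4) range_subsetD)
    then show "\<exists>l\<in>M. \<exists>r. strict_mono r \<and> (\<lambda>n. d (\<sigma> (r n)) l) \<longlonglongrightarrow> 0"
      using m(1) l(2) by blast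
  qed
qed

text \<open>The quotient by distance zero is formed with chosen representatives, which keeps its
  carrier in the same type; afterwards it is copied to the reals.\<close>

lemma pcompact_imp_realizes:
  assumes "pcompact M d" shows "\<exists>x. realizes x M d"
proof -
  have pm: "pseudometric_on M d" and ne: "M \<noteq> {}" using assms by (auto simp: pcompact_def)
  \<comment> \<open>The predicate under the choice operator depends only on the class of
    \<open>m\<close>, so equivalent points get the same representative.\<close>
  define c where "c m = (SOME m'. m' \<in> M \<and> d m m' = 0)" for m
  have c: "c m \<in> M \<and> d m (c m) = 0" if "m \<in> M" for m
    unfolding c_def by (rule someI[of _ m]) (use that pseudometric_onD(1)[OF pm] in auto)
  have d_c: "d (c u) (c v) = d u v" if "u \<in> M" "v \<in> M" for u v
    using c[OF that(1)] c[OF that(2)] that pseudometric_onD(2,3)[OF pm]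
    by (smt (verit, ccfv_threshold))
  have eqv: "d u v = 0 \<Longrightarrow> c u = c v" if "u \<in> M" "v \<in> M" for u v
  proof -
    assume uv: "d u v = 0"
    have "d u w = d v w" if "w \<in> M" for w
      using that uv \<open>u \<in> M\<close> \<open>v \<in> M\<close> pseudometric_onD(2,3)[OF pm] by (smt (verit, ccfv_threshold))
    then have "(\<lambda>m'. m' \<in> M \<and> d u m' = 0) = (\<lambda>m'. m' \<in> M \<and> d v m' = 0)" by auto
    then show "c u = c v" by (simp add: c_def)
  qed
  \<comment> \<open>\<open>Metric_space\<close> asks for non-negativity and symmetry on the whole
    type, hence the value 0 outside \<open>M\<close>.\<close>
  interpret N: Metric_space "c ` M" "\<lambda>x y. if x \<in> M \<and> y \<in> M then d x y else 0"
  proof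
    show "0 \<le> (if x \<in> M \<and> y \<in> M then d x y else 0)" for x y
      using pseudometric_on_nonneg[OF pm] by simp
    show "(if x \<in> M \<and> y \<in> M then d x y else 0) = (if y \<in> M \<and> x \<in> M then d y x else 0)" for x y
      using pseudometric_onD(2)[OF pm] by simp
    show "(if x \<in> M \<and> y \<in> M then d x y else 0) = 0 \<longleftrightarrow> x = y" if xy: "x \<in> c ` M" "y \<in> c ` M" for x y
    proof -
      obtain u v where uv: "u \<in> M" "v \<in> M" "x = c u" "y = c v" using xy by blast
      then have "x \<in> M" "y \<in> M" "d x y = d u v" using c d_c by blast+
      then show ?thesis using eqv[OF uv(1,2)] uv(3,4) pseudometric_onD(1)[OF pm \<open>x \<in> M\<close>] by auto
    qed
    show "(if x \<in> M \<and> z \<in> M then d x z else 0)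
        \<le> (if x \<in> M \<and> y \<in> M then d x y else 0) + (if y \<in> M \<and> z \<in> M then d y z else 0)"
      if "x \<in> c ` M" "y \<in> c ` M" "z \<in> c ` M" for x y z
      using that c pseudometric_onD(3)[OF pm] by auto
  qed
  define Y where "Y = metric (c ` M, \<lambda>x y. if x \<in> M \<and> y \<in> M then d x y else 0)"
  have Y: "mspace Y = c ` M" "mdist Y = (\<lambda>x y. if x \<in> M \<and> y \<in> M then d x y else 0)"
    by (simp_all add: Y_def)
  have cM: "c m \<in> M" if "m \<in> M" for m using c that by blast
  have mdY: "mdist Y (c u) (c v) = d u v" if "u \<in> M" "v \<in> M" for u v
    using that cM d_c by (simp add: Y)
  have "pcompact (mspace Y) (mdist Y)"
    unfolding pcompact_def
  proof (intro conjI allI impI)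
    show "mspace Y \<noteq> {}" using ne Y by simp
    show "pseudometric_on (mspace Y) (mdist Y)" by (rule pseudometric_on_mdist)
    fix \<sigma> :: "nat \<Rightarrow> 'a" assume "range \<sigma> \<subseteq> mspace Y"
    then have "\<forall>n. \<exists>u. u \<in> M \<and> \<sigma> n = c u" unfolding Y by blast
    then obtain \<tau> where \<tau>: "\<And>n. \<tau> n \<in> M" "\<And>n. \<sigma> n = c (\<tau> n)" by metis
    then obtain l r where l: "l \<in> M" "strict_mono r" "(\<lambda>n. d (\<tau> (r n)) l) \<longlonglongrightarrow> 0"
      using assms unfolding pcompact_def by (metis image_subsetI)
    have "(\<lambda>n. mdist Y (\<sigma> (r n)) (c l)) \<longlonglongrightarrow> 0"
      using l \<tau> by (simp add: mdY)
    then show "\<exists>l\<in>mspace Y. \<exists>r. strict_mono r \<and> (\<lambda>n. mdist Y (\<sigma> (r n)) l) \<longlonglongrightarrow> 0"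
      using l(1,2) Y(1) by blast
  qed
  then have "nonempty_compact Y" using nonempty_compact_iff_pcompact by blast
  then obtain Z :: "real metric" where Z: "nonempty_compact Z" "isometric Y Z"
    using nonempty_compact_isometric_real by blast
  then obtain h where h: "isometric_embedding Y Z h" "h ` mspace Y = mspace Z"
    unfolding isometric_def by blast
  have "(h \<circ> c) ` M = mspace Z" using h(2) Y(1) by (metis image_comp)
  moreover have "mdist Z ((h \<circ> c) u) ((h \<circ> c) v) = d u v" if "u \<in> M" "v \<in> M" for u v
    using isometric_embeddingD(2)[OF h(1), of "c u" "c v"] that mdY by (simp add: Y(1))
  ultimately show ?thesis
    unfolding realizes_def using Z(1) by blast
qed

section \<open>The Gromov-Hausdorff distance is a metric\<close>

lemma hausdorff_distance_le:
  assumes "A \<noteq> {}" "B \<noteq> {}" "A \<subseteq> mspace Z" "B \<subseteq> mspace Z"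
    and A: "\<And>a. a \<in> A \<Longrightarrow> \<exists>b\<in>B. mdist Z a b \<le> e" and B: "\<And>b. b \<in> B \<Longrightarrow> \<exists>a\<in>A. mdist Z a b \<le> e"
  shows "hausdorff_distance Z A B \<le> e"
proof -
  have "(INF b\<in>B. mdist Z a b) \<le> e" if "a \<in> A" for a
    using A[OF that] by (meson bdd_belowI2 cINF_lower2 mdist_nonneg)
  moreover have "(INF a\<in>A. mdist Z a b) \<le> e" if "b \<in> B" for b
    using B[OF that] by (meson bdd_belowI2 cINF_lower2 mdist_nonneg)
  ultimately show ?thesis
    unfolding hausdorff_distance_def using assms(1,2) by (simp add: cSUP_least)
qed

text \<open>The bound \<open>K\<close> makes the suprema range over bounded sets, so that they
  really are upper bounds.\<close>

lemma hausdorff_distance_lower: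
  assumes "A \<noteq> {}" "B \<noteq> {}" and bdd: "\<And>a b. a \<in> A \<Longrightarrow> b \<in> B \<Longrightarrow> mdist Z a b \<le> K"
  shows "a \<in> A \<Longrightarrow> (INF b\<in>B. mdist Z a b) \<le> hausdorff_distance Z A B"
    and "b \<in> B \<Longrightarrow> (INF a\<in>A. mdist Z a b) \<le> hausdorff_distance Z A B"
proof -
  obtain a0 b0 where "a0 \<in> A" "b0 \<in> B" using assms by blast
  have "(INF b\<in>B. mdist Z a b) \<le> K" if "a \<in> A" for a
    using bdd[OF that \<open>b0 \<in> B\<close>] \<open>b0 \<in> B\<close> by (meson bdd_belowI2 cINF_lower2 mdist_nonneg)
  then have "a \<in> A \<Longrightarrow> (INF b\<in>B. mdist Z a b) \<le> (SUP a\<in>A. INF b\<in>B. mdist Z a b)" for a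
    by (meson bdd_aboveI2 cSUP_upper)
  then show "a \<in> A \<Longrightarrow> (INF b\<in>B. mdist Z a b) \<le> hausdorff_distance Z A B"
    by (simp add: hausdorff_distance_def le_max_iff_disj)
  have "(INF a\<in>A. mdist Z a b) \<le> K" if "b \<in> B" for b
    using bdd[OF \<open>a0 \<in> A\<close> that] \<open>a0 \<in> A\<close> by (meson bdd_belowI2 cINF_lower2 mdist_nonneg)
  then have "b \<in> B \<Longrightarrow> (INF a\<in>A. mdist Z a b) \<le> (SUP b\<in>B. INF a\<in>A. mdist Z a b)" for b
    by (meson bdd_aboveI2 cSUP_upper)
  then show "b \<in> B \<Longrightarrow> (INF a\<in>A. mdist Z a b) \<le> hausdorff_distance Z A B"
    by (simp add: hausdorff_distance_def le_max_iff_disj)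
qed

lemma gh_dist_eq:
  assumes "nonempty_compact X" "nonempty_compact Y"
  shows "gh_dist (isometry_class X) (isometry_class Y) =
     Inf {hausdorff_distance Z (f ` mspace X) (g ` mspace Y) | (Z :: real metric) f g.
               isometric_embedding X Z f \<and> isometric_embedding Y Z g}"
  using gh_dist.abs_eq[of X Y] assms isometric_refl by blast

text \<open>\<open>gh_dist\<close> admits only ambient spaces on the reals, so a glued space has to
  be moved there along an injection.\<close>

lemma ex_real_copy:
  assumes "Metric_space W D" and inj: "inj_on \<iota> W"
  obtains Z :: "real metric" where "mspace Z = \<iota> ` W"
    "\<And>u v. u \<in> W \<Longrightarrow> v \<in> W \<Longrightarrow> mdist Z (\<iota> u) (\<iota> v) = D u v"
proof -
  interpret W: Metric_space W D by fact
  define D' where "D' p q = D (inv_into W \<iota> p) (inv_into W \<iota> q)" for p q :: real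
  interpret Z: Metric_space "\<iota> ` W" D'
    by unfold_locales (use inj in \<open>auto simp: D'_def W.commute intro: W.triangle\<close>)
  show thesis
    by (rule that[of "metric (\<iota> ` W, D')"]) (use inj in \<open>auto simp: D'_def\<close>)
qed

lemma cINF_add_lower:
  fixes f g :: "'a \<Rightarrow> real"
  assumes "M \<noteq> {}" "\<And>m m'. m \<in> M \<Longrightarrow> m' \<in> M \<Longrightarrow> K \<le> f m + g m'"
  shows "K \<le> (INF m\<in>M. f m) + (INF m\<in>M. g m)"
proof -
  have "K - f m \<le> (INF m\<in>M. g m)" if "m \<in> M" for m
    by (rule cINF_greatest[OF assms(1)]) (use assms(2)[OF that] in \<open>simp add: algebra_simps\<close>)
  then have "K - (INF m\<in>M. g m) \<le> (INF m\<in>M. f m)"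
    by (intro cINF_greatest[OF assms(1)]) (simp add: algebra_simps)
  then show ?thesis by simp
qed

text \<open>A correspondence of distortion at most \<open>2\<epsilon>\<close> is given as a common parameter set \<open>M\<close>;
  the two spaces are glued along it at distance \<open>\<epsilon>\<close>.\<close>

lemma ex_gluing:
  fixes X Y :: "real metric"
  assumes "M \<noteq> {}" and \<phi>: "\<phi> ` M = mspace X" and \<psi>: "\<psi> ` M = mspace Y" and "\<epsilon> > 0"
    and dist: "\<And>m m'. m \<in> M \<Longrightarrow> m' \<in> M \<Longrightarrow> \<bar>mdist X (\<phi> m) (\<phi> m') - mdist Y (\<psi> m) (\<psi> m')\<bar> \<le> 2 * \<epsilon>"
  shows "\<exists>(Z :: real metric) f g. isometric_embedding X Z f \<and> isometric_embedding Y Z g \<and>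
     hausdorff_distance Z (f ` mspace X) (g ` mspace Y) \<le> \<epsilon>"
proof -
  \<comment> \<open>Infimal length of a path from \<open>a\<close> to \<open>b\<close> that crosses
    over exactly one link of length \<open>\<epsilon>\<close>.\<close>
  define c where "c a b = (INF m\<in>M. mdist X a (\<phi> m) + \<epsilon> + mdist Y (\<psi> m) b)" for a b
  have \<phi>': "\<phi> m \<in> mspace X" and \<psi>': "\<psi> m \<in> mspace Y" if "m \<in> M" for m
    using \<phi> \<psi> that by blast+
  have bdd: "bdd_below ((\<lambda>m. mdist X a (\<phi> m) + \<epsilon> + mdist Y (\<psi> m) b) ` M)" for a b
  proof (rule bdd_belowI2)
    show "0 \<le> mdist X a (\<phi> m) + \<epsilon> + mdist Y (\<psi> m) b" for m
      using mdist_nonneg[of X a "\<phi> m"] mdist_nonneg[of Y "\<psi> m" b] \<open>\<epsilon> > 0\<close> by linarith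
  qed
  have c_le: "c a b \<le> mdist X a (\<phi> m) + \<epsilon> + mdist Y (\<psi> m) b" if "m \<in> M" for a b m
    unfolding c_def by (rule cINF_lower[OF bdd that])
  have c_ge: "\<epsilon> \<le> c a b" for a b
    unfolding c_def
  proof (rule cINF_greatest[OF \<open>M \<noteq> {}\<close>])
    show "\<epsilon> \<le> mdist X a (\<phi> m) + \<epsilon> + mdist Y (\<psi> m) b" for m
      using mdist_nonneg[of X a "\<phi> m"] mdist_nonneg[of Y "\<psi> m" b] by linarith
  qed
  interpret X: Metric_space "mspace X" "mdist X" by (rule Metric_space_mspace_mdist)
  interpret Y: Metric_space "mspace Y" "mdist Y" by (rule Metric_space_mspace_mdist)
  have tX: "c a b \<le> mdist X a a' + c a' b" if "a \<in> mspace X" "a' \<in> mspace X" for a a' b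
  proof -
    have "c a b - mdist X a a' \<le> c a' b"
      unfolding c_def[of a' b]
    proof (rule cINF_greatest[OF \<open>M \<noteq> {}\<close>])
      fix m assume m: "m \<in> M"
      show "c a b - mdist X a a' \<le> mdist X a' (\<phi> m) + \<epsilon> + mdist Y (\<psi> m) b"
        using c_le[OF m, of a b] X.triangle[OF that \<phi>'[OF m]] by linarith
    qed
    then show ?thesis by simp
  qed
  have tY: "c a b \<le> c a b' + mdist Y b' b" if "b \<in> mspace Y" "b' \<in> mspace Y" for a b b'
  proof -
    have "c a b - mdist Y b' b \<le> c a b'"
      unfolding c_def[of a b']
    proof (rule cINF_greatest[OF \<open>M \<noteq> {}\<close>])
      fix m assume m: "m \<in> M"
      show "c a b - mdist Y b' b \<le> mdist X a (\<phi> m) + \<epsilon> + mdist Y (\<psi> m) b'"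
        using c_le[OF m, of a b] Y.triangle[OF \<psi>'[OF m] that(2,1)] by linarith
    qed
    then show ?thesis by simp
  qed
  \<comment> \<open>Going over and back uses two links, and their total length
    \<open>2 * \<epsilon>\<close> pays for the distortion.\<close>
  have tXX: "mdist X a a' \<le> c a b + c a' b" if "a \<in> mspace X" "a' \<in> mspace X" "b \<in> mspace Y" for a a' b
    unfolding c_def
  proof (rule cINF_add_lower[OF \<open>M \<noteq> {}\<close>])
    fix m m' assume m: "m \<in> M" "m' \<in> M"
    show "mdist X a a' \<le> mdist X a (\<phi> m) + \<epsilon> + mdist Y (\<psi> m) b + (mdist X a' (\<phi> m') + \<epsilon> + mdist Y (\<psi> m') b)"
      using dist[OF m] X.triangle[OF that(1) \<phi>'[OF m(1)] that(2)]
        X.triangle[OF \<phi>'[OF m(1)] \<phi>'[OF m(2)] that(2)] Y.triangle[OF \<psi>'[OF m(1)] that(3) \<psi>'[OF m(2)]]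
        X.commute[of a' "\<phi> m'"] Y.commute[of b "\<psi> m'"] by linarith
  qed
  have tYY: "mdist Y b b' \<le> c a b + c a b'" if "b \<in> mspace Y" "b' \<in> mspace Y" "a \<in> mspace X" for a b b'
    unfolding c_def
  proof (rule cINF_add_lower[OF \<open>M \<noteq> {}\<close>])
    fix m m' assume m: "m \<in> M" "m' \<in> M"
    show "mdist Y b b' \<le> mdist X a (\<phi> m) + \<epsilon> + mdist Y (\<psi> m) b + (mdist X a (\<phi> m') + \<epsilon> + mdist Y (\<psi> m') b')"
      using dist[OF m] Y.triangle[OF that(1) \<psi>'[OF m(1)] that(2)]
        Y.triangle[OF \<psi>'[OF m(1)] \<psi>'[OF m(2)] that(2)] X.triangle[OF \<phi>'[OF m(1)] that(3) \<phi>'[OF m(2)]]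
        X.commute[of a "\<phi> m"] Y.commute[of b "\<psi> m"] by linarith
  qed
  define D where "D p q = (case p of
      Inl a \<Rightarrow> (case q of Inl a' \<Rightarrow> mdist X a a' | Inr b \<Rightarrow> c a b)
    | Inr b \<Rightarrow> (case q of Inl a \<Rightarrow> c a b | Inr b' \<Rightarrow> mdist Y b b'))" for p q :: "real + real"
  have D: "D (Inl a) (Inl a') = mdist X a a'" "D (Inl a) (Inr b) = c a b"
      "D (Inr b) (Inl a) = c a b" "D (Inr b) (Inr b') = mdist Y b b'" for a a' b b'
    by (simp_all add: D_def)
  define W where "W = mspace X <+> mspace Y"
  have W: "Metric_space W D"
  proof
    have c0: "0 \<le> c a b" "c a b \<noteq> 0" for a b using c_ge[of a b] \<open>\<epsilon> > 0\<close> by linarith+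
    show "0 \<le> D p q" for p q by (cases p; cases q) (simp_all add: D c0)
    show "D p q = D q p" for p q by (cases p; cases q) (simp_all add: D X.commute Y.commute)
    show "D p q = 0 \<longleftrightarrow> p = q" if "p \<in> W" "q \<in> W" for p q
      using that by (cases p; cases q) (auto simp: D W_def c0)
    show "D p q \<le> D p r + D r q" if "p \<in> W" "r \<in> W" "q \<in> W" for p q r
    proof (cases p; cases q; cases r)
    qed (use that in \<open>auto simp: W_def D\<close>,
         (use X.triangle Y.triangle tX tY tXX tYY X.commute Y.commute in \<open>metis add.commute\<close>)+)
  qed
  \<comment> \<open>Positive values for one summand and negative ones for the other keep the two
    copies of the reals disjoint.\<close>
  define \<iota> where "\<iota> p = (case p of Inl a \<Rightarrow> exp a | Inr b \<Rightarrow> - exp b)" for p :: "real + real"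
  have "inj_on \<iota> W"
  proof (rule inj_onI)
    fix p q assume "\<iota> p = \<iota> q"
    moreover have "exp a \<noteq> - exp b" "- exp b \<noteq> exp a" for a b :: real
      by (smt (verit) exp_gt_zero)+
    ultimately show "p = q" by (cases p; cases q) (simp_all add: \<iota>_def)
  qed
  then obtain Z :: "real metric" where Z: "mspace Z = \<iota> ` W"
      "\<And>u v. u \<in> W \<Longrightarrow> v \<in> W \<Longrightarrow> mdist Z (\<iota> u) (\<iota> v) = D u v"
    using ex_real_copy[OF W] by blast
  have WI: "Inl a \<in> W \<longleftrightarrow> a \<in> mspace X" "Inr b \<in> W \<longleftrightarrow> b \<in> mspace Y" for a b
    by (auto simp: W_def)
  have eX: "isometric_embedding X Z (\<iota> \<circ> Inl)" and eY: "isometric_embedding Y Z (\<iota> \<circ> Inr)"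
    using Z WI D by (auto simp: isometric_embedding_def)
  have cm: "c (\<phi> m) (\<psi> m) \<le> \<epsilon>" if "m \<in> M" for m
    using c_le[OF that, of "\<phi> m" "\<psi> m"] \<phi>'[OF that] \<psi>'[OF that] by simp
  have "hausdorff_distance Z ((\<iota> \<circ> Inl) ` mspace X) ((\<iota> \<circ> Inr) ` mspace Y) \<le> \<epsilon>"
  proof (rule hausdorff_distance_le)
    show "(\<iota> \<circ> Inl) ` mspace X \<noteq> {}" "(\<iota> \<circ> Inr) ` mspace Y \<noteq> {}" using \<phi> \<psi> \<open>M \<noteq> {}\<close> by auto
    show "(\<iota> \<circ> Inl) ` mspace X \<subseteq> mspace Z" "(\<iota> \<circ> Inr) ` mspace Y \<subseteq> mspace Z"
      using eX eY by (auto simp: isometric_embedding_def)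
    show "\<exists>b\<in>(\<iota> \<circ> Inr) ` mspace Y. mdist Z p b \<le> \<epsilon>" if p: "p \<in> (\<iota> \<circ> Inl) ` mspace X" for p
    proof -
      obtain m where m: "m \<in> M" "p = \<iota> (Inl (\<phi> m))" using p \<phi>[symmetric] by auto
      then have "mdist Z p (\<iota> (Inr (\<psi> m))) \<le> \<epsilon>"
        using Z(2)[of "Inl (\<phi> m)" "Inr (\<psi> m)"] WI D cm \<phi>' \<psi>' by simp
      then show ?thesis using \<psi>'[OF m(1)] by auto
    qed
    show "\<exists>a\<in>(\<iota> \<circ> Inl) ` mspace X. mdist Z a p \<le> \<epsilon>" if p: "p \<in> (\<iota> \<circ> Inr) ` mspace Y" for p
    proof -
      obtain m where m: "m \<in> M" "p = \<iota> (Inr (\<psi> m))" using p \<psi>[symmetric] by auto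
      then have "mdist Z (\<iota> (Inl (\<phi> m))) p \<le> \<epsilon>"
        using Z(2)[of "Inl (\<phi> m)" "Inr (\<psi> m)"] WI D cm \<phi>' \<psi>' by simp
      then show ?thesis using \<phi>'[OF m(1)] by auto
    qed
  qed
  then show ?thesis using eX eY by blast
qed

text \<open>A detour over fixed base points bounds all distances between the two images, because
  compact spaces have finite diameter.\<close>

lemma hausdorff_distance_bounds:
  fixes Z :: "real metric"
  assumes X: "nonempty_compact X" and Y: "nonempty_compact Y"
    and f: "isometric_embedding X Z f" and g: "isometric_embedding Y Z g"
  shows "a \<in> mspace X \<Longrightarrow> (INF b\<in>g ` mspace Y. mdist Z (f a) b) \<le> hausdorff_distance Z (f ` mspace X) (g ` mspace Y)"
    and "b \<in> mspace Y \<Longrightarrow> (INF a\<in>f ` mspace X. mdist Z a (g b)) \<le> hausdorff_distance Z (f ` mspace X) (g ` mspace Y)"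
    and "0 \<le> hausdorff_distance Z (f ` mspace X) (g ` mspace Y)"
proof -
  obtain KX where KX: "\<And>x y. x \<in> mspace X \<Longrightarrow> y \<in> mspace X \<Longrightarrow> mdist X x y \<le> KX"
    using pcompact_bounded[OF X[unfolded nonempty_compact_iff_pcompact]] by metis
  obtain KY where KY: "\<And>x y. x \<in> mspace Y \<Longrightarrow> y \<in> mspace Y \<Longrightarrow> mdist Y x y \<le> KY"
    using pcompact_bounded[OF Y[unfolded nonempty_compact_iff_pcompact]] by metis
  have ne: "f ` mspace X \<noteq> {}" "g ` mspace Y \<noteq> {}" using X Y by (auto simp: nonempty_compact_def)
  then obtain a0 b0 where ab: "a0 \<in> mspace X" "b0 \<in> mspace Y" by blast
  have bd: "mdist Z p q \<le> KX + mdist Z (f a0) (g b0) + KY" if "p \<in> f ` mspace X" "q \<in> g ` mspace Y" for p q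
  proof -
    obtain a b where p: "p = f a" "a \<in> mspace X" "q = g b" "b \<in> mspace Y" using \<open>p \<in> _\<close> \<open>q \<in> _\<close> by blast
    note mem = isometric_embeddingD(1)[OF f ab(1)] isometric_embeddingD(1)[OF g ab(2)]
      isometric_embeddingD(1)[OF f p(2)] isometric_embeddingD(1)[OF g p(4)]
    show ?thesis
      using pseudometric_onD(3)[OF pseudometric_on_mdist mem(3,1,4)]
        pseudometric_onD(3)[OF pseudometric_on_mdist mem(1,2,4)]
        isometric_embeddingD(2)[OF f p(2) ab(1)] isometric_embeddingD(2)[OF g ab(2) p(4)]
        KX[OF p(2) ab(1)] KY[OF ab(2) p(4)]
      unfolding p(1,3) by linarith
  qed
  note low = hausdorff_distance_lower[OF ne bd]
  show 1: "a \<in> mspace X \<Longrightarrow> (INF b\<in>g ` mspace Y. mdist Z (f a) b) \<le> hausdorff_distance Z (f ` mspace X) (g ` mspace Y)" for a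
    using low(1) by blast
  show "b \<in> mspace Y \<Longrightarrow> (INF a\<in>f ` mspace X. mdist Z a (g b)) \<le> hausdorff_distance Z (f ` mspace X) (g ` mspace Y)"
    using low(2) by blast
  have "0 \<le> (INF b\<in>g ` mspace Y. mdist Z (f a0) b)"
    by (rule cINF_greatest[OF ne(2)]) simp
  then show "0 \<le> hausdorff_distance Z (f ` mspace X) (g ` mspace Y)"
    using 1[OF ab(1)] by linarith
qed

text \<open>A common parameter set is a correspondence between the two spaces, and gluing along it
  supplies the ambient space.\<close>

lemma gh_dist_le:
  assumes "realizes x M d" "realizes y M d'" "\<epsilon> > 0"
    and dist: "\<And>m m'. m \<in> M \<Longrightarrow> m' \<in> M \<Longrightarrow> \<bar>d m m' - d' m m'\<bar> \<le> 2 * \<epsilon>"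
  shows "gh_dist x y \<le> \<epsilon>"
proof -
  obtain X where X: "nonempty_compact X" "x = isometry_class X" by (rule ex_isometry_class)
  obtain Y where Y: "nonempty_compact Y" "y = isometry_class Y" by (rule ex_isometry_class)
  obtain \<phi> where \<phi>: "\<phi> ` M = mspace X" "\<And>m m'. m \<in> M \<Longrightarrow> m' \<in> M \<Longrightarrow> mdist X (\<phi> m) (\<phi> m') = d m m'"
    using realizes_onto[OF assms(1) X] by blast
  obtain \<psi> where \<psi>: "\<psi> ` M = mspace Y" "\<And>m m'. m \<in> M \<Longrightarrow> m' \<in> M \<Longrightarrow> mdist Y (\<psi> m) (\<psi> m') = d' m m'"
    using realizes_onto[OF assms(2) Y] by blast
  have "M \<noteq> {}" using \<phi>(1) X(1) by (auto simp: nonempty_compact_def)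
  then obtain Z :: "real metric" and f g where Z: "isometric_embedding X Z f" "isometric_embedding Y Z g"
     "hausdorff_distance Z (f ` mspace X) (g ` mspace Y) \<le> \<epsilon>"
    using ex_gluing[OF _ \<phi>(1) \<psi>(1) \<open>\<epsilon> > 0\<close>] \<phi>(2) \<psi>(2) dist by force
  have "gh_dist x y \<le> hausdorff_distance Z (f ` mspace X) (g ` mspace Y)"
    unfolding X(2) Y(2) gh_dist_eq[OF X(1) Y(1)]
    by (rule cInf_lower) (use Z hausdorff_distance_bounds(3)[OF X(1) Y(1)] in \<open>auto intro!: bdd_belowI[of _ 0]\<close>)
  with Z(3) show ?thesis by linarith
qed

text \<open>The infimum in \<open>gh_dist\<close> has to be over a non-empty set; the correspondence
  relating every point to every point provides an element.\<close>

lemma ex_hausdorff_distance: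
  fixes X Y :: "real metric"
  assumes X: "nonempty_compact X" and Y: "nonempty_compact Y"
  shows "{hausdorff_distance Z (f ` mspace X) (g ` mspace Y) | (Z :: real metric) f g.
               isometric_embedding X Z f \<and> isometric_embedding Y Z g} \<noteq> {}"
proof -
  obtain KX where KX: "KX \<ge> 0" "\<And>x y. x \<in> mspace X \<Longrightarrow> y \<in> mspace X \<Longrightarrow> mdist X x y \<le> KX"
    using pcompact_bounded[OF X[unfolded nonempty_compact_iff_pcompact]] by metis
  obtain KY where KY: "KY \<ge> 0" "\<And>x y. x \<in> mspace Y \<Longrightarrow> y \<in> mspace Y \<Longrightarrow> mdist Y x y \<le> KY"
    using pcompact_bounded[OF Y[unfolded nonempty_compact_iff_pcompact]] by metis
  have ne: "mspace X \<noteq> {}" "mspace Y \<noteq> {}" using X Y by (auto simp: nonempty_compact_def)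
  have "\<exists>(Z :: real metric) f g. isometric_embedding X Z f \<and> isometric_embedding Y Z g \<and>
     hausdorff_distance Z (f ` mspace X) (g ` mspace Y) \<le> KX + KY + 1"
  proof (rule ex_gluing[of "mspace X \<times> mspace Y" fst _ snd])
    show "\<bar>mdist X (fst m) (fst m') - mdist Y (snd m) (snd m')\<bar> \<le> 2 * (KX + KY + 1)"
      if "m \<in> mspace X \<times> mspace Y" "m' \<in> mspace X \<times> mspace Y" for m m'
    proof -
      have "mdist X (fst m) (fst m') \<le> KX" "mdist Y (snd m) (snd m') \<le> KY"
        using that by (auto intro: KX(2) KY(2))
      then show ?thesis
        using KX(1) KY(1) mdist_nonneg[of X "fst m" "fst m'"] mdist_nonneg[of Y "snd m" "snd m'"]
        unfolding abs_le_iff distrib_left by (intro conjI; linarith)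
    qed
  qed (use ne KX(1) KY(1) in auto)
  then show ?thesis by blast
qed

lemma gh_dist_nonneg: "0 \<le> gh_dist x y"
proof -
  obtain X where X: "nonempty_compact X" "x = isometry_class X" by (rule ex_isometry_class)
  obtain Y where Y: "nonempty_compact Y" "y = isometry_class Y" by (rule ex_isometry_class)
  show ?thesis
    unfolding X(2) Y(2) gh_dist_eq[OF X(1) Y(1)]
    by (rule cInf_greatest[OF ex_hausdorff_distance[OF X(1) Y(1)]])
       (use hausdorff_distance_bounds(3)[OF X(1) Y(1)] in auto)
qed

text \<open>Converse of the gluing estimate: the pairs at distance below \<open>\<epsilon>\<close>
  in a common ambient space form a correspondence that is onto both spaces.\<close>

lemma gh_dist_lessE:
  assumes "gh_dist x y < \<epsilon>"
  obtains M :: "(real \<times> real) set" and d d' where "realizes x M d" "realizes y M d'"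
    "\<And>m m'. m \<in> M \<Longrightarrow> m' \<in> M \<Longrightarrow> \<bar>d m m' - d' m m'\<bar> \<le> 2 * \<epsilon>"
proof -
  obtain X where X: "nonempty_compact X" "x = isometry_class X" by (rule ex_isometry_class)
  obtain Y where Y: "nonempty_compact Y" "y = isometry_class Y" by (rule ex_isometry_class)
  have ne: "mspace X \<noteq> {}" "mspace Y \<noteq> {}" using X Y by (auto simp: nonempty_compact_def)
  obtain Z :: "real metric" and f g where Z: "isometric_embedding X Z f" "isometric_embedding Y Z g"
     "hausdorff_distance Z (f ` mspace X) (g ` mspace Y) < \<epsilon>"
    using cInf_lessD[OF ex_hausdorff_distance[OF X(1) Y(1)], of \<epsilon>] assms
    unfolding X(2) Y(2) gh_dist_eq[OF X(1) Y(1)] by blast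
  define M where "M = {p \<in> mspace X \<times> mspace Y. mdist Z (f (fst p)) (g (snd p)) < \<epsilon>}"
  have 1: "fst ` M = mspace X"
  proof
    show "mspace X \<subseteq> fst ` M"
    proof
      fix a assume a: "a \<in> mspace X"
      have "(INF b\<in>g ` mspace Y. mdist Z (f a) b) < \<epsilon>"
        using hausdorff_distance_bounds(1)[OF X(1) Y(1) Z(1,2) a] Z(3) by linarith
      then obtain b where "b \<in> mspace Y" "mdist Z (f a) (g b) < \<epsilon>"
        using cInf_lessD[of "(\<lambda>b. mdist Z (f a) b) ` g ` mspace Y" \<epsilon>] ne by auto
      then show "a \<in> fst ` M" using a by (force simp: M_def)
    qed
  qed (auto simp: M_def)
  have 2: "snd ` M = mspace Y"
  proof
    show "mspace Y \<subseteq> snd ` M"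
    proof
      fix b assume b: "b \<in> mspace Y"
      have "(INF a\<in>f ` mspace X. mdist Z a (g b)) < \<epsilon>"
        using hausdorff_distance_bounds(2)[OF X(1) Y(1) Z(1,2) b] Z(3) by linarith
      then obtain a where "a \<in> mspace X" "mdist Z (f a) (g b) < \<epsilon>"
        using cInf_lessD[of "(\<lambda>a. mdist Z a (g b)) ` f ` mspace X" \<epsilon>] ne by auto
      then show "b \<in> snd ` M" using b by (force simp: M_def)
    qed
  qed (auto simp: M_def)
  show thesis
  proof (rule that)
    show "realizes x M (\<lambda>m m'. mdist X (fst m) (fst m'))"
      unfolding X(2) by (rule realizes_surj[OF realizes_isometry_class[OF X(1)] 1])
    show "realizes y M (\<lambda>m m'. mdist Y (snd m) (snd m'))"
      unfolding Y(2) by (rule realizes_surj[OF realizes_isometry_class[OF Y(1)] 2])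
    fix m m' assume m: "m \<in> M" "m' \<in> M"
    interpret Z: Metric_space "mspace Z" "mdist Z" by (rule Metric_space_mspace_mdist)
    have mem: "fst m \<in> mspace X" "fst m' \<in> mspace X" "snd m \<in> mspace Y" "snd m' \<in> mspace Y"
      and lt: "mdist Z (f (fst m)) (g (snd m)) < \<epsilon>" "mdist Z (f (fst m')) (g (snd m')) < \<epsilon>"
      using m by (auto simp: M_def)
    note em = isometric_embeddingD(1)[OF Z(1) mem(1)] isometric_embeddingD(1)[OF Z(1) mem(2)]
      isometric_embeddingD(1)[OF Z(2) mem(3)] isometric_embeddingD(1)[OF Z(2) mem(4)]
    show "\<bar>mdist X (fst m) (fst m') - mdist Y (snd m) (snd m')\<bar> \<le> 2 * \<epsilon>"
      using lt Z.triangle[OF em(1,3,2)] Z.triangle[OF em(3,4,2)] Z.triangle[OF em(3,1,4)]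
        Z.triangle[OF em(1,2,4)] Z.commute[of "f (fst m')" "g (snd m')"] Z.commute[of "f (fst m)" "g (snd m)"]
        isometric_embeddingD(2)[OF Z(1) mem(1,2)] isometric_embeddingD(2)[OF Z(2) mem(3,4)]
      by linarith
  qed
qed

lemma gh_dist_self: "gh_dist x x = 0"
proof -
  obtain X where X: "nonempty_compact X" "x = isometry_class X" by (rule ex_isometry_class)
  have "gh_dist x x \<le> e" if "e > 0" for e
    by (rule gh_dist_le[of _ "mspace X" "mdist X" _ "mdist X"])
       (use X that realizes_isometry_class[OF X(1)] in auto)
  then have "gh_dist x x \<le> 0" by (rule field_le_epsilon) simp
  then show ?thesis using gh_dist_nonneg[of x x] by linarith
qed

lemma gh_dist_commute_le: "gh_dist y x \<le> gh_dist x y"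
proof (rule field_le_epsilon)
  fix e :: real assume "e > 0"
  then have "gh_dist x y < gh_dist x y + e" by simp
  then obtain M :: "(real \<times> real) set" and d d' where M: "realizes x M d" "realizes y M d'"
    "\<And>m m'. m \<in> M \<Longrightarrow> m' \<in> M \<Longrightarrow> \<bar>d m m' - d' m m'\<bar> \<le> 2 * (gh_dist x y + e)"
    by (rule gh_dist_lessE) blast
  show "gh_dist y x \<le> gh_dist x y + e"
    by (rule gh_dist_le[OF M(2,1)]) (use M(3) gh_dist_nonneg[of x y] \<open>e > 0\<close> in \<open>auto simp: abs_minus_commute\<close>)
qed

text \<open>Correspondences are composed: \<open>P\<close> pairs the parameters that stand for the
  same point of \<open>Y\<close>, and the distortions add.\<close>

lemma gh_dist_triangle: "gh_dist x z \<le> gh_dist x y + gh_dist y z"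
proof (rule field_le_epsilon)
  fix e :: real assume "e > 0"
  then have "gh_dist x y < gh_dist x y + e / 2" by simp
  then obtain M :: "(real \<times> real) set" and d d' where M: "realizes x M d" "realizes y M d'"
    "\<And>m m'. m \<in> M \<Longrightarrow> m' \<in> M \<Longrightarrow> \<bar>d m m' - d' m m'\<bar> \<le> 2 * (gh_dist x y + e / 2)"
    by (rule gh_dist_lessE) blast
  have "gh_dist y z < gh_dist y z + e / 2" using \<open>e > 0\<close> by simp
  then obtain N :: "(real \<times> real) set" and k k' where N: "realizes y N k" "realizes z N k'"
    "\<And>m m'. m \<in> N \<Longrightarrow> m' \<in> N \<Longrightarrow> \<bar>k m m' - k' m m'\<bar> \<le> 2 * (gh_dist y z + e / 2)"
    by (rule gh_dist_lessE) blast
  obtain Y where Y: "nonempty_compact Y" "y = isometry_class Y" by (rule ex_isometry_class)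
  obtain \<phi> where \<phi>: "\<phi> ` M = mspace Y" "\<And>m m'. m \<in> M \<Longrightarrow> m' \<in> M \<Longrightarrow> mdist Y (\<phi> m) (\<phi> m') = d' m m'"
    using realizes_onto[OF M(2) Y] by blast
  obtain \<psi> where \<psi>: "\<psi> ` N = mspace Y" "\<And>m m'. m \<in> N \<Longrightarrow> m' \<in> N \<Longrightarrow> mdist Y (\<psi> m) (\<psi> m') = k m m'"
    using realizes_onto[OF N(1) Y] by blast
  define P where "P = {p \<in> M \<times> N. \<phi> (fst p) = \<psi> (snd p)}"
  have 1: "fst ` P = M"
  proof
    show "M \<subseteq> fst ` P"
    proof
      fix m assume m: "m \<in> M"
      then have "\<phi> m \<in> \<psi> ` N" using \<phi>(1) \<psi>(1) by blast
      then obtain n where "n \<in> N" "\<phi> m = \<psi> n" by blast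
      then show "m \<in> fst ` P" using m by (force simp: P_def)
    qed
  qed (auto simp: P_def)
  have 2: "snd ` P = N"
  proof
    show "N \<subseteq> snd ` P"
    proof
      fix n assume n: "n \<in> N"
      then have "\<psi> n \<in> \<phi> ` M" using \<phi>(1) \<psi>(1) by blast
      then obtain m where "m \<in> M" "\<phi> m = \<psi> n" by force
      then show "n \<in> snd ` P" using n by (force simp: P_def)
    qed
  qed (auto simp: P_def)
  show "gh_dist x z \<le> gh_dist x y + gh_dist y z + e"
  proof (rule gh_dist_le[OF realizes_surj[OF M(1) 1] realizes_surj[OF N(2) 2]])
    show "gh_dist x y + gh_dist y z + e > 0"
      using gh_dist_nonneg[of x y] gh_dist_nonneg[of y z] \<open>e > 0\<close> by linarith
    fix p p' assume p: "p \<in> P" "p' \<in> P"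
    have mem: "fst p \<in> M" "fst p' \<in> M" "snd p \<in> N" "snd p' \<in> N"
      and eq: "\<phi> (fst p) = \<psi> (snd p)" "\<phi> (fst p') = \<psi> (snd p')"
      using p by (auto simp: P_def)
    have "d' (fst p) (fst p') = k (snd p) (snd p')"
      using \<phi>(2)[OF mem(1,2)] \<psi>(2)[OF mem(3,4)] eq by simp
    then show "\<bar>d (fst p) (fst p') - k' (snd p) (snd p')\<bar> \<le> 2 * (gh_dist x y + gh_dist y z + e)"
      using M(3)[OF mem(1,2)] N(3)[OF mem(3,4)] unfolding abs_le_iff distrib_left by (intro conjI; linarith)
  qed
qed

text \<open>A cluster point, in \<open>Y\<^sup>X \<times> X\<^sup>Y\<close>, of approximate isometries with approximate inverses
  is an isometry with its inverse.\<close>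

lemma gh_dist_zeroD:
  assumes "gh_dist x y = 0" shows "x = y"
proof -
  obtain X where X: "nonempty_compact X" "x = isometry_class X" by (rule ex_isometry_class)
  obtain Y where Y: "nonempty_compact Y" "y = isometry_class Y" by (rule ex_isometry_class)
  define T where "T = prod_topology (product_topology (\<lambda>_. mtopology_of Y) (mspace X))
                                    (product_topology (\<lambda>_. mtopology_of X) (mspace Y))"
  have topT: "topspace T = (PiE (mspace X) (\<lambda>_. mspace Y)) \<times> (PiE (mspace Y) (\<lambda>_. mspace X))"
    by (simp add: T_def)
  have "compact_space T"
    using X(1) Y(1) by (simp add: T_def compact_space_prod_topology compact_space_product_topology nonempty_compact_def)
  define e where "e n = 2 / real (Suc n)" for n
  \<comment> \<open>The second clause says that \<open>snd p\<close> is an approximate inverse of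
    \<open>fst p\<close>, in a form that is a closed condition on the pair.\<close>
  define C where "C n = {p \<in> topspace T.
      (\<forall>a\<in>mspace X. \<forall>a'\<in>mspace X. \<bar>mdist X a a' - mdist Y (fst p a) (fst p a')\<bar> \<le> e n) \<and>
      (\<forall>a\<in>mspace X. \<forall>b\<in>mspace Y. \<bar>mdist X a (snd p b) - mdist Y (fst p a) b\<bar> \<le> e n)}" for n
  have ne: "C n \<noteq> {}" for n
  proof -
    have "gh_dist x y < 1 / real (Suc n)" using assms by simp
    then obtain M :: "(real \<times> real) set" and d d' where M: "realizes x M d" "realizes y M d'"
      "\<And>m m'. m \<in> M \<Longrightarrow> m' \<in> M \<Longrightarrow> \<bar>d m m' - d' m m'\<bar> \<le> 2 * (1 / real (Suc n))"
      by (rule gh_dist_lessE) blast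
    obtain \<phi> where \<phi>: "\<phi> ` M = mspace X" "\<And>m m'. m \<in> M \<Longrightarrow> m' \<in> M \<Longrightarrow> mdist X (\<phi> m) (\<phi> m') = d m m'"
      using realizes_onto[OF M(1) X] by blast
    obtain \<psi> where \<psi>: "\<psi> ` M = mspace Y" "\<And>m m'. m \<in> M \<Longrightarrow> m' \<in> M \<Longrightarrow> mdist Y (\<psi> m) (\<psi> m') = d' m m'"
      using realizes_onto[OF M(2) Y] by blast
    define s where "s = inv_into M \<phi>"
    define t where "t = inv_into M \<psi>"
    have s: "s a \<in> M" "\<phi> (s a) = a" if "a \<in> mspace X" for a
      using that \<phi>(1) unfolding s_def by (metis inv_into_into, metis f_inv_into_f)
    have t: "t b \<in> M" "\<psi> (t b) = b" if "b \<in> mspace Y" for b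
      using that \<psi>(1) unfolding t_def by (metis inv_into_into, metis f_inv_into_f)
    have img: "\<phi> m \<in> mspace X" "\<psi> m \<in> mspace Y" if "m \<in> M" for m using that \<phi>(1) \<psi>(1) by blast+
    have "(restrict (\<psi> \<circ> s) (mspace X), restrict (\<phi> \<circ> t) (mspace Y)) \<in> C n"
      unfolding C_def mem_Collect_eq topT
    proof (intro conjI ballI)
      show "(restrict (\<psi> \<circ> s) (mspace X), restrict (\<phi> \<circ> t) (mspace Y))
          \<in> (mspace X \<rightarrow>\<^sub>E mspace Y) \<times> (mspace Y \<rightarrow>\<^sub>E mspace X)"
        using s t img by auto
      show "\<bar>mdist X a a' - mdist Y (fst (restrict (\<psi> \<circ> s) (mspace X), restrict (\<phi> \<circ> t) (mspace Y)) a)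
          (fst (restrict (\<psi> \<circ> s) (mspace X), restrict (\<phi> \<circ> t) (mspace Y)) a')\<bar> \<le> e n"
        if "a \<in> mspace X" "a' \<in> mspace X" for a a'
        using that s M(3)[of "s a" "s a'"] \<phi>(2)[of "s a" "s a'"] \<psi>(2)[of "s a" "s a'"]
        by (simp add: e_def)
      show "\<bar>mdist X a (snd (restrict (\<psi> \<circ> s) (mspace X), restrict (\<phi> \<circ> t) (mspace Y)) b) -
          mdist Y (fst (restrict (\<psi> \<circ> s) (mspace X), restrict (\<phi> \<circ> t) (mspace Y)) a) b\<bar> \<le> e n"
        if "a \<in> mspace X" "b \<in> mspace Y" for a b
        using that s t M(3)[of "s a" "t b"] \<phi>(2)[of "s a" "t b"] \<psi>(2)[of "s a" "t b"]
        by (simp add: e_def)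
    qed
    then show ?thesis by blast
  qed
  have "decseq C"
  proof (rule decseq_SucI)
    fix n
    have "e (Suc n) \<le> e n" by (simp add: e_def field_simps)
    then show "C (Suc n) \<subseteq> C n"
      unfolding C_def using order_trans[OF _ \<open>e (Suc n) \<le> e n\<close>] by blast
  qed
  have cf: "continuous_map T (mtopology_of Y) (\<lambda>p. fst p a)" if "a \<in> mspace X" for a
    using continuous_map_compose[OF continuous_map_fst continuous_map_product_projection[OF that]]
    unfolding T_def by (auto simp: o_def)
  have cg: "continuous_map T (mtopology_of X) (\<lambda>p. snd p b)" if "b \<in> mspace Y" for b
    using continuous_map_compose[OF continuous_map_snd continuous_map_product_projection[OF that]]
    unfolding T_def by (auto simp: o_def)
  have clo: "closedin T (C n)" for n
  proof -
    have le: "closedin T {p \<in> topspace T. \<bar>u p - v p\<bar> \<le> e n}"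
      if "continuous_map T euclideanreal u" "continuous_map T euclideanreal v" for u v
    proof -
      have "continuous_map T euclideanreal (\<lambda>p. \<bar>u p - v p\<bar>)"
        using that by (intro continuous_intros)
      from closedin_continuous_map_preimage[OF this, of "{..e n}"] show ?thesis by simp
    qed
    have c1: "closedin T {p \<in> topspace T. \<bar>mdist X a a' - mdist Y (fst p a) (fst p a')\<bar> \<le> e n}"
      if "a \<in> mspace X" "a' \<in> mspace X" for a a'
      by (rule le) (use that in \<open>auto intro!: continuous_map_mdist cf\<close>)
    have c2: "closedin T {p \<in> topspace T. \<bar>mdist X a (snd p b) - mdist Y (fst p a) b\<bar> \<le> e n}"
      if "a \<in> mspace X" "b \<in> mspace Y" for a b
      by (rule le) (use that in \<open>auto intro!: continuous_map_mdist cf cg\<close>)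
    have "C n = topspace T \<inter>
       (\<Inter>i\<in>mspace X \<times> mspace X. {p \<in> topspace T. \<bar>mdist X (fst i) (snd i) - mdist Y (fst p (fst i)) (fst p (snd i))\<bar> \<le> e n}) \<inter>
       (\<Inter>i\<in>mspace X \<times> mspace Y. {p \<in> topspace T. \<bar>mdist X (fst i) (snd p (snd i)) - mdist Y (fst p (fst i)) (snd i)\<bar> \<le> e n})"
      unfolding C_def by auto
    moreover have "mspace X \<times> mspace X \<noteq> {}" "mspace X \<times> mspace Y \<noteq> {}"
      using X(1) Y(1) by (auto simp: nonempty_compact_def)
    ultimately show ?thesis
      using c1 c2 by (auto intro!: closedin_Int closedin_INT)
  qed
  have "(\<Inter>n. C n) \<noteq> {}"
    by (rule compact_space_imp_nest[OF \<open>compact_space T\<close> clo ne \<open>decseq C\<close>])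
  then obtain p where p: "\<And>n. p \<in> C n" by blast
  define f where "f = fst p"
  define g where "g = snd p"
  have fg: "f \<in> mspace X \<rightarrow>\<^sub>E mspace Y" "g \<in> mspace Y \<rightarrow>\<^sub>E mspace X"
    using p[of 0] by (auto simp: C_def topT f_def g_def)
  have zero: "u = v" if "\<And>n. \<bar>u - v\<bar> \<le> e n" for u v
  proof -
    have "(\<lambda>n. e n) \<longlonglongrightarrow> 0" unfolding e_def using LIMSEQ_Suc[OF lim_const_over_n[of 2]] by simp
    then have "\<bar>u - v\<bar> \<le> 0" by (rule LIMSEQ_le_const) (use that in auto)
    then show ?thesis by simp
  qed
  have iso: "mdist X a a' = mdist Y (f a) (f a')" if "a \<in> mspace X" "a' \<in> mspace X" for a a'
    by (rule zero) (use p that in \<open>auto simp: C_def f_def\<close>)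
  have inv: "mdist X a (g b) = mdist Y (f a) b" if "a \<in> mspace X" "b \<in> mspace Y" for a b
    by (rule zero) (use p that in \<open>auto simp: C_def f_def g_def\<close>)
  have emb: "isometric_embedding X Y f"
    unfolding isometric_embedding_def using fg iso by auto
  have "b \<in> f ` mspace X" if "b \<in> mspace Y" for b
  proof -
    have gb: "g b \<in> mspace X" using fg that by auto
    \<comment> \<open>The relation \<open>inv\<close> at \<open>a = g b\<close> has left-hand side
      zero; this is where surjectivity of \<open>f\<close> comes from.\<close>
    then have "mdist Y (f (g b)) b = 0" using inv[OF gb that] gb mdist_zero by metis
    then have "f (g b) = b" using mdist_zero[of "f (g b)" Y b] fg gb that by auto
    then show ?thesis using gb by force
  qed
  then have "f ` mspace X = mspace Y" using emb by (auto simp: isometric_embedding_def)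
  then have "isometric X Y" unfolding isometric_def using emb by blast
  then show ?thesis using isometry_class_eq_iff X Y by blast
qed

lemma Metric_space_gh_dist: "Metric_space S gh_dist"
proof
  show "gh_dist x y = gh_dist y x" for x y
    using gh_dist_commute_le[of x y] gh_dist_commute_le[of y x] by linarith
qed (auto simp: gh_dist_nonneg gh_dist_self gh_dist_triangle dest: gh_dist_zeroD)

section \<open>Doubling, uniform disconnectedness and uniform perfectness of pseudometrics\<close>

text \<open>Bounding separated sets of a given diameter, instead of covering balls, avoids centres. This makes
  doubling evidently hereditary and stable under unions.\<close>

definition separated_card_le :: "nat \<Rightarrow> 'a set \<Rightarrow> ('a \<Rightarrow> 'a \<Rightarrow> real) \<Rightarrow> bool" where
  "separated_card_le N M d \<longleftrightarrow> (\<forall>r F. r > 0 \<and> finite F \<and> F \<subseteq> M \<and> (\<forall>x\<in>F. \<forall>y\<in>F. d x y \<le> r) \<and>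
     (\<forall>x\<in>F. \<forall>y\<in>F. x \<noteq> y \<longrightarrow> r / 4 < d x y) \<longrightarrow> card F \<le> N)"

definition pdoubling :: "'a set \<Rightarrow> ('a \<Rightarrow> 'a \<Rightarrow> real) \<Rightarrow> bool" where
  "pdoubling M d \<longleftrightarrow> (\<exists>N. separated_card_le N M d)"

text \<open>Chains start at index 0, and the largest step is replaced by an arbitrary bound
  \<open>e \<ge> 0\<close>. Thus constant chains need no exclusion and no maximum over an empty set
  arises.\<close>

definition punif_disconnected :: "'a set \<Rightarrow> ('a \<Rightarrow> 'a \<Rightarrow> real) \<Rightarrow> bool" where
  "punif_disconnected M d \<longleftrightarrow> (\<exists>\<delta>>0. \<forall>n z e. (\<forall>i\<le>n. z i \<in> M) \<and> 0 \<le> e \<and>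
     (\<forall>i<n. d (z i) (z (Suc i)) \<le> e) \<longrightarrow> \<delta> * d (z 0) (z n) \<le> e)"

text \<open>That \<open>r\<close> lies below the diameter is expressed by a witnessing pair
  \<open>u\<close>, \<open>v\<close>.\<close>

definition punif_perfect :: "'a set \<Rightarrow> ('a \<Rightarrow> 'a \<Rightarrow> real) \<Rightarrow> bool" where
  "punif_perfect M d \<longleftrightarrow> (\<exists>c>0. \<forall>x\<in>M. \<forall>u\<in>M. \<forall>v\<in>M. \<forall>r>0. r < d u v \<longrightarrow>
     (\<exists>y\<in>M. c * r \<le> d x y \<and> d x y \<le> r))"

text \<open>On a compact metric space a continuous bijection onto a Hausdorff space is a
  homeomorphism, so the inverse is not mentioned. Continuity and injectivity of
  \<open>\<theta>\<close> leave no two distinct points at distance zero.\<close>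

definition pcantor :: "'a set \<Rightarrow> ('a \<Rightarrow> 'a \<Rightarrow> real) \<Rightarrow> bool" where
  "pcantor M d \<longleftrightarrow> (\<exists>\<theta>. bij_betw \<theta> M cantor_set \<and>
     (\<forall>x\<in>M. \<forall>e>0. \<exists>\<delta>>0. \<forall>y\<in>M. d x y < \<delta> \<longrightarrow> \<bar>\<theta> x - \<theta> y\<bar> < e))"

section \<open>Heredity and invariance under isometries\<close>

lemma pdoublingI:
  assumes "\<And>r F. \<lbrakk>r > 0; finite F; F \<subseteq> M; \<And>x y. x \<in> F \<Longrightarrow> y \<in> F \<Longrightarrow> d x y \<le> r;
      \<And>x y. x \<in> F \<Longrightarrow> y \<in> F \<Longrightarrow> x \<noteq> y \<Longrightarrow> r / 4 < d x y\<rbrakk> \<Longrightarrow> card F \<le> N"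
  shows "pdoubling M d"
  unfolding pdoubling_def separated_card_le_def
proof (intro exI[of _ N] allI impI, elim conjE)
  fix r F assume F: "(r::real) > 0" "finite F" "F \<subseteq> M" "\<forall>x\<in>F. \<forall>y\<in>F. d x y \<le> r"
    "\<forall>x\<in>F. \<forall>y\<in>F. x \<noteq> y \<longrightarrow> r / 4 < d x y"
  show "card F \<le> N"
    by (rule assms[OF F(1-3)]) (use F(4,5) in blast)+
qed

lemma separated_card_leD:
  assumes "separated_card_le N M d" "r > 0" "finite F" "F \<subseteq> M"
    "\<And>x y. x \<in> F \<Longrightarrow> y \<in> F \<Longrightarrow> d x y \<le> r" "\<And>x y. x \<in> F \<Longrightarrow> y \<in> F \<Longrightarrow> x \<noteq> y \<Longrightarrow> r / 4 < d x y"
  shows "card F \<le> N"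
  by (rule assms(1)[unfolded separated_card_le_def, rule_format, of r])
     (intro conjI ballI impI assms(2-); assumption)

text \<open>Distinct points of a separated set have positive distance, so the map is injective on it
  even where \<open>d\<close> is degenerate elsewhere.\<close>

lemma pdoubling_isometric:
  assumes "pdoubling N dN" "\<phi> ` M \<subseteq> N" "\<And>m m'. m \<in> M \<Longrightarrow> m' \<in> M \<Longrightarrow> dN (\<phi> m) (\<phi> m') = d m m'"
    and "pseudometric_on M d"
  shows "pdoubling M d"
proof -
  obtain K1 where "separated_card_le K1 N dN"
    using assms(1) by (auto simp: pdoubling_def)
  note K = separated_card_leD[OF this]
  show ?thesis
  proof (rule pdoublingI)
    fix r F assume F: "(r::real) > 0" "finite F" "F \<subseteq> M" "\<And>x y. x \<in> F \<Longrightarrow> y \<in> F \<Longrightarrow> d x y \<le> r"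
      "\<And>x y. x \<in> F \<Longrightarrow> y \<in> F \<Longrightarrow> x \<noteq> y \<Longrightarrow> r / 4 < d x y"
    have dd: "dN (\<phi> x) (\<phi> y) = d x y" if "x \<in> F" "y \<in> F" for x y
      using that F(3) assms(3) by blast
    have "inj_on \<phi> F"
    proof (rule inj_onI, rule ccontr)
      fix x y assume xy: "x \<in> F" "y \<in> F" "\<phi> x = \<phi> y" "x \<noteq> y"
      have "d x y = d x x" using dd[OF xy(1,2)] dd[OF xy(1,1)] xy(3) by simp
      also have "\<dots> = 0" using pseudometric_onD(1)[OF assms(4)] F(3) xy(1) by blast
      finally show False using F(5)[OF xy(1,2,4)] F(1) by simp
    qed
    moreover have "card (\<phi> ` F) \<le> K1"
    proof (rule K[OF F(1)])
      show "finite (\<phi> ` F)" using F(2) by simp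
      show "\<phi> ` F \<subseteq> N" using F(3) assms(2) by blast
      fix x y assume "x \<in> \<phi> ` F" "y \<in> \<phi> ` F"
      then obtain u v where uv: "u \<in> F" "v \<in> F" "x = \<phi> u" "y = \<phi> v" by blast
      show "dN x y \<le> r" using dd[OF uv(1,2)] F(4)[OF uv(1,2)] uv by simp
      show "r / 4 < dN x y" if "x \<noteq> y" using dd[OF uv(1,2)] F(5)[OF uv(1,2)] uv that by auto
    qed
    ultimately show "card F \<le> K1" by (simp add: card_image)
  qed
qed

lemma punif_disconnected_isometric:
  assumes "punif_disconnected N dN" "\<phi> ` M \<subseteq> N" "\<And>m m'. m \<in> M \<Longrightarrow> m' \<in> M \<Longrightarrow> dN (\<phi> m) (\<phi> m') = d m m'"
  shows "punif_disconnected M d"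
proof -
  obtain \<delta> where \<delta>: "\<delta> > 0" "\<And>n z e. \<lbrakk>\<forall>i\<le>n. z i \<in> N; 0 \<le> e; \<forall>i<n. dN (z i) (z (Suc i)) \<le> e\<rbrakk> \<Longrightarrow> \<delta> * dN (z 0) (z n) \<le> e"
    using assms(1) unfolding punif_disconnected_def by blast
  have "\<delta> * d (z 0) (z n) \<le> e" if "\<forall>i\<le>n. z i \<in> M" "0 \<le> e" "\<forall>i<n. d (z i) (z (Suc i)) \<le> e" for n z e
  proof -
    have "\<delta> * dN (\<phi> (z 0)) (\<phi> (z n)) \<le> e"
      using \<delta>(2)[of n "\<lambda>i. \<phi> (z i)" e] that assms(2,3) by auto
    then show ?thesis using that(1) assms(3) by simp
  qed
  then show ?thesis unfolding punif_disconnected_def using \<delta>(1) by blast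
qed

text \<open>A surjective isometry of pseudometrics has an isometric section; hereditary properties
  therefore transfer in both directions.\<close>

lemma ex_isometric_section:
  assumes "\<phi> ` M = N" "\<And>m m'. m \<in> M \<Longrightarrow> m' \<in> M \<Longrightarrow> dN (\<phi> m) (\<phi> m') = d m m'"
  obtains s where "s ` N \<subseteq> M" "\<And>x y. x \<in> N \<Longrightarrow> y \<in> N \<Longrightarrow> d (s x) (s y) = dN x y"
proof (rule that[of "inv_into M \<phi>"])
  show "inv_into M \<phi> ` N \<subseteq> M" using assms(1) by (auto intro: inv_into_into)
  show "d (inv_into M \<phi> x) (inv_into M \<phi> y) = dN x y" if "x \<in> N" "y \<in> N" for x y
    using assms that by (metis f_inv_into_f inv_into_into)
qed

lemma pdoubling_surj:
  assumes "\<phi> ` M = N" "\<And>m m'. m \<in> M \<Longrightarrow> m' \<in> M \<Longrightarrow> dN (\<phi> m) (\<phi> m') = d m m'"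
    and "pseudometric_on M d" "pseudometric_on N dN"
  shows "pdoubling M d \<longleftrightarrow> pdoubling N dN"
proof
  obtain s where s: "s ` N \<subseteq> M" "\<And>x y. x \<in> N \<Longrightarrow> y \<in> N \<Longrightarrow> d (s x) (s y) = dN x y"
    using ex_isometric_section[of \<phi> M N dN d, OF assms(1,2)] by blast
  show "pdoubling M d \<Longrightarrow> pdoubling N dN"
    by (rule pdoubling_isometric[where N = M and dN = d and \<phi> = s]) (use s assms(4) in auto)
  show "pdoubling N dN \<Longrightarrow> pdoubling M d"
    by (rule pdoubling_isometric[of N dN \<phi>]) (use assms in auto)
qed

lemma punif_disconnected_surj:
  assumes "\<phi> ` M = N" "\<And>m m'. m \<in> M \<Longrightarrow> m' \<in> M \<Longrightarrow> dN (\<phi> m) (\<phi> m') = d m m'"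
  shows "punif_disconnected M d \<longleftrightarrow> punif_disconnected N dN"
proof
  obtain s where s: "s ` N \<subseteq> M" "\<And>x y. x \<in> N \<Longrightarrow> y \<in> N \<Longrightarrow> d (s x) (s y) = dN x y"
    using ex_isometric_section[of \<phi> M N dN d, OF assms] by blast
  show "punif_disconnected M d \<Longrightarrow> punif_disconnected N dN"
    by (rule punif_disconnected_isometric[where N = M and dN = d and \<phi> = s]) (use s in auto)
  show "punif_disconnected N dN \<Longrightarrow> punif_disconnected M d"
    by (rule punif_disconnected_isometric[of N dN \<phi>]) (use assms in auto)
qed

lemma punif_perfect_surj:
  assumes "\<phi> ` M = N" "\<And>m m'. m \<in> M \<Longrightarrow> m' \<in> M \<Longrightarrow> dN (\<phi> m) (\<phi> m') = d m m'"
  shows "punif_perfect M d \<longleftrightarrow> punif_perfect N dN"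
  unfolding punif_perfect_def assms(1)[symmetric] by (simp add: assms(2))

section \<open>Comparison with the three properties of metric spaces\<close>

lemma N_doubling_iterate:
  assumes "N_doubling N X" "x \<in> mspace X" "r > 0"
  shows "\<exists>G\<subseteq>mspace X. finite G \<and> card G \<le> N ^ k \<and> mcball_of X x r \<subseteq> (\<Union>y\<in>G. mcball_of X y (r / 2 ^ k))"
proof (induction k)
  case 0
  show ?case using assms(2) by (intro exI[of _ "{x}"]) auto
next
  case (Suc k)
  then obtain G where G: "G \<subseteq> mspace X" "finite G" "card G \<le> N ^ k"
    "mcball_of X x r \<subseteq> (\<Union>y\<in>G. mcball_of X y (r / 2 ^ k))" by blast
  have "\<forall>y\<in>G. \<exists>F\<subseteq>mspace X. mcball_of X y (r / 2 ^ k) \<subseteq> (\<Union>z\<in>F. mcball_of X z (r / 2 ^ k / 2)) \<and> finite F \<and> card F \<le> N"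
    using assms(1,3) G(1) unfolding N_doubling_def by (meson divide_pos_pos subsetD zero_less_numeral zero_less_power)
  then obtain F where F: "\<And>y. y \<in> G \<Longrightarrow> F y \<subseteq> mspace X" "\<And>y. y \<in> G \<Longrightarrow> finite (F y)" "\<And>y. y \<in> G \<Longrightarrow> card (F y) \<le> N"
     "\<And>y. y \<in> G \<Longrightarrow> mcball_of X y (r / 2 ^ k) \<subseteq> (\<Union>z\<in>F y. mcball_of X z (r / 2 ^ k / 2))"
    by metis
  show ?case
  proof (intro exI[of _ "\<Union>y\<in>G. F y"] conjI)
    show "(\<Union>y\<in>G. F y) \<subseteq> mspace X" using F(1) by blast
    show "finite (\<Union>y\<in>G. F y)" using F(2) G(2) by blast
    have "card (\<Union>y\<in>G. F y) \<le> (\<Sum>y\<in>G. card (F y))" by (rule card_UN_le[OF G(2)])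
    also have "\<dots> \<le> card G * N" using sum_bounded_above[of G "\<lambda>y. card (F y)" N] F(3) by simp
    also have "\<dots> \<le> N ^ Suc k" using G(3) by (simp add: mult.commute)
    finally show "card (\<Union>y\<in>G. F y) \<le> N ^ Suc k" .
    have "mcball_of X x r \<subseteq> (\<Union>y\<in>G. \<Union>z\<in>F y. mcball_of X z (r / 2 ^ k / 2))"
      using G(4) F(4) by blast
    then show "mcball_of X x r \<subseteq> (\<Union>y\<in>(\<Union>y\<in>G. F y). mcball_of X y (r / 2 ^ Suc k))"
      by (simp add: mult.commute)
  qed
qed

lemma mem_mcball_of: "y \<in> mcball_of X x r \<longleftrightarrow> x \<in> mspace X \<and> y \<in> mspace X \<and> mdist X x y \<le> r"
  unfolding mcball_of_def by (rule Metric_space.in_mcball[OF Metric_space_mspace_mdist])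

text \<open>Three halvings cover a ball of radius \<open>r\<close> by \<open>N ^ 3\<close> balls of
  radius \<open>r / 8\<close>, each too small for two points at distance above \<open>r / 4\<close>.
  Conversely, a maximal \<open>r / 2\<close>-separated subset of a ball is a set of centres as
  required.\<close>

lemma doubling_iff_pdoubling: "doubling X \<longleftrightarrow> pdoubling (mspace X) (mdist X)"
proof
  note pm = pseudometric_on_mdist[of X]
  assume "doubling X"
  then obtain N where N: "N_doubling N X" by (auto simp: doubling_def)
  show "pdoubling (mspace X) (mdist X)"
  proof (rule pdoublingI)
    fix r F assume F: "(r::real) > 0" "finite F" "F \<subseteq> mspace X" "\<And>x y. x \<in> F \<Longrightarrow> y \<in> F \<Longrightarrow> mdist X x y \<le> r"
      "\<And>x y. x \<in> F \<Longrightarrow> y \<in> F \<Longrightarrow> x \<noteq> y \<Longrightarrow> r / 4 < mdist X x y"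
    show "card F \<le> N ^ 3"
    proof (cases "F = {}")
      case False
      then obtain x where x: "x \<in> F" by blast
      obtain G where G: "G \<subseteq> mspace X" "finite G" "card G \<le> N ^ 3"
          "mcball_of X x r \<subseteq> (\<Union>y\<in>G. mcball_of X y (r / 2 ^ 3))"
        using N_doubling_iterate[OF N _ F(1), of x 3] x F(3) by blast
      have "\<exists>z. z \<in> G \<and> y \<in> mcball_of X z (r / 8)" if "y \<in> F" for y
      proof -
        have "y \<in> mcball_of X x r" using F(3,4) x that by (auto simp: mem_mcball_of)
        then have "y \<in> (\<Union>z\<in>G. mcball_of X z (r / 2 ^ 3))" using G(4) by blast
        then show ?thesis by force
      qed
      then obtain c where c: "\<And>y. y \<in> F \<Longrightarrow> c y \<in> G" "\<And>y. y \<in> F \<Longrightarrow> y \<in> mcball_of X (c y) (r / 8)"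
        by metis
      have "inj_on c F"
      proof (rule inj_onI, rule ccontr)
        fix y z assume yz: "y \<in> F" "z \<in> F" "c y = c z" "y \<noteq> z"
        have "mdist X (c y) y \<le> r / 8" "mdist X (c y) z \<le> r / 8" "c y \<in> mspace X" "y \<in> mspace X" "z \<in> mspace X"
          using c(2)[OF yz(1)] c(2)[OF yz(2)] yz(3) by (auto simp: mem_mcball_of)
        then have "mdist X y z \<le> r / 4"
          using pseudometric_onD(3)[OF pm, of y "c y" z] pseudometric_onD(2)[OF pm, of y "c y"] by simp
        then show False using F(5)[OF yz(1,2,4)] by simp
      qed
      then have "card F \<le> card G"
        using card_inj_on_le[of c F G] c(1) G(2) by blast
      then show ?thesis using G(3) by linarith
    qed simp
  qed
next
  assume "pdoubling (mspace X) (mdist X)"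
  then obtain N0 where "separated_card_le N0 (mspace X) (mdist X)"
    by (auto simp: pdoubling_def)
  note N = separated_card_leD[OF this]
  interpret Metric_space "mspace X" "mdist X" by (rule Metric_space_mspace_mdist)
  have "N_doubling N0 X"
    unfolding N_doubling_def
  proof (intro ballI allI impI)
    fix x and r :: real assume x: "x \<in> mspace X" and "r > 0"
    define S where "S F \<longleftrightarrow> finite F \<and> F \<subseteq> mcball_of X x r \<and> (\<forall>u\<in>F. \<forall>v\<in>F. u \<noteq> v \<longrightarrow> r / 2 < mdist X u v)" for F
    \<comment> \<open>The ball has diameter at most \<open>2 * r\<close>, and \<open>r / 2\<close>
      is a quarter of that.\<close>
    have bound: "card F \<le> N0" if "S F" for F
    proof (rule N[of "2 * r"])
      have F: "F \<subseteq> mspace X" "\<And>u. u \<in> F \<Longrightarrow> mdist X x u \<le> r"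
        using that by (auto simp: S_def mem_mcball_of)
      show "F \<subseteq> mspace X" by fact
      show "mdist X u v \<le> 2 * r" if "u \<in> F" "v \<in> F" for u v
        using F that triangle[of u x v] x commute[of u x] F(2)[of u] F(2)[of v] by fastforce
      show "2 * r / 4 < mdist X u v" if "u \<in> F" "v \<in> F" "u \<noteq> v" for u v
        using \<open>S F\<close> that by (auto simp: S_def)
    qed (use that \<open>r > 0\<close> in \<open>auto simp: S_def\<close>)
    have "S {}" by (simp add: S_def)
    then obtain F where F: "S F" "\<And>F'. S F' \<Longrightarrow> card F' \<le> card F"
      using ex_has_greatest_nat[of S "{}" card "Suc N0"] bound by (metis le_imp_less_Suc)
    show "\<exists>F\<subseteq>mspace X. mcball_of X x r \<subseteq> (\<Union>y\<in>F. mcball_of X y (r / 2)) \<and> finite F \<and> card F \<le> N0"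
    proof (intro exI[of _ F] conjI)
      show "F \<subseteq> mspace X" using F(1) by (auto simp: S_def mem_mcball_of)
      show "finite F" "card F \<le> N0" using F(1) bound by (auto simp: S_def)
      show "mcball_of X x r \<subseteq> (\<Union>y\<in>F. mcball_of X y (r / 2))"
      proof
        fix z assume z: "z \<in> mcball_of X x r"
        show "z \<in> (\<Union>y\<in>F. mcball_of X y (r / 2))"
        proof (rule ccontr)
          assume "\<not> ?thesis"
          then have far: "r / 2 < mdist X y z" if "y \<in> F" for y
            using that z F(1) by (force simp: S_def mem_mcball_of)
          have "z \<notin> F" using far[of z] z \<open>r > 0\<close> by (auto simp: mem_mcball_of)
          have "S (insert z F)"
          proof -
            have "r / 2 < mdist X y z" "r / 2 < mdist X z y" if "y \<in> F" for y
              using far[OF that] commute[of y z] by simp_all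
            then show ?thesis using F(1) z by (simp add: S_def)
          qed
          then have "card (insert z F) \<le> card F" by (rule F(2))
          then show False using \<open>z \<notin> F\<close> F(1) by (simp add: S_def)
        qed
      qed
    qed
  qed
  then show "doubling X" by (auto simp: doubling_def)
qed

lemma uniformly_disconnected_iff: "uniformly_disconnected X \<longleftrightarrow> punif_disconnected (mspace X) (mdist X)"
proof
  assume "uniformly_disconnected X"
  then obtain \<delta> where \<delta>: "\<delta> > 0" "unif_disconnected_with \<delta> X" by (auto simp: uniformly_disconnected_def)
  have "\<delta> * mdist X (z 0) (z n) \<le> e"
    if z: "\<forall>i\<le>n. z i \<in> mspace X" "0 \<le> e" "\<forall>i<n. mdist X (z i) (z (Suc i)) \<le> e" for n z e
  proof (cases "z 0 = z n")
    case True
    have "mdist X (z 0) (z n) = 0" using True z(1) mdist_zero by (metis order_refl)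
    then show ?thesis using z(2) by simp
  next
    case False
    then have "n > 0" by (metis gr0I)
    \<comment> \<open>Shift of the indices from \<open>0..n\<close> to
      \<open>1..n + 1\<close>.\<close>
    define w where "w i = z (i - 1)" for i
    have "\<forall>i\<in>{1..n + 1}. w i \<in> mspace X" using z(1) by (auto simp: w_def)
    moreover have "\<exists>i\<in>{1..n + 1}. \<exists>j\<in>{1..n + 1}. w i \<noteq> w j"
      by (rule bexI[of _ 1], rule bexI[of _ "n + 1"]) (use False in \<open>auto simp: w_def\<close>)
    ultimately have "\<delta> * mdist X (w 1) (w (n + 1)) \<le> (MAX i\<in>{1..n + 1 - 1}. mdist X (w i) (w (i + 1)))"
      using \<delta>(2) unfolding unif_disconnected_with_def by blast
    also have "\<dots> \<le> e"
    proof (rule Max.boundedI)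
      show "(\<lambda>i. mdist X (w i) (w (i + 1))) ` {1..n + 1 - 1} \<noteq> {}" using \<open>n > 0\<close> by simp
      fix t assume "t \<in> (\<lambda>i. mdist X (w i) (w (i + 1))) ` {1..n + 1 - 1}"
      then obtain i where "1 \<le> i" "i \<le> n" and t: "t = mdist X (w i) (w (i + 1))" by auto
      then obtain j where "i = Suc j" "j < n" by (metis One_nat_def Suc_le_D Suc_le_lessD)
      then show "t \<le> e" using z(3) t by (simp add: w_def)
    qed simp
    finally show ?thesis by (simp add: w_def)
  qed
  then show "punif_disconnected (mspace X) (mdist X)"
    unfolding punif_disconnected_def using \<delta>(1) by blast
next
  assume "punif_disconnected (mspace X) (mdist X)"
  then obtain \<delta> where \<delta>: "\<delta> > 0" "\<And>n z e. \<lbrakk>\<forall>i\<le>n. z i \<in> mspace X; 0 \<le> e;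
      \<forall>i<n. mdist X (z i) (z (Suc i)) \<le> e\<rbrakk> \<Longrightarrow> \<delta> * mdist X (z 0) (z n) \<le> e"
    unfolding punif_disconnected_def by blast
  have "unif_disconnected_with \<delta> X"
    unfolding unif_disconnected_with_def
  proof (intro allI impI, elim conjE)
    fix N and z :: "nat \<Rightarrow> 'a"
    assume z: "\<forall>i\<in>{1..N}. z i \<in> mspace X" "\<exists>i\<in>{1..N}. \<exists>j\<in>{1..N}. z i \<noteq> z j"
    \<comment> \<open>A non-constant sequence has at least two entries, so the maximum is over a
      non-empty set of steps.\<close>
    have "N \<ge> 2"
    proof (rule ccontr)
      assume "\<not> N \<ge> 2"
      then have "{1..N} \<subseteq> {1}" by auto
      then show False using z(2) by blast
    qed
    define e where "e = (MAX i\<in>{1..N - 1}. mdist X (z i) (z (i + 1)))"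
    have le: "mdist X (z i) (z (i + 1)) \<le> e" if "i \<in> {1..N - 1}" for i
      unfolding e_def using that by (intro Max_ge) auto
    have "mdist X (z 1) (z (1 + 1)) \<le> e" by (rule le) (use \<open>N \<ge> 2\<close> in auto)
    then have "0 \<le> e" by (rule order_trans[OF mdist_nonneg])
    then have "\<delta> * mdist X (z (0 + 1)) (z ((N - 1) + 1)) \<le> e"
      using z(1) le \<open>N \<ge> 2\<close> by (intro \<delta>(2)) auto
    then show "\<delta> * mdist X (z 1) (z N) \<le> (MAX i\<in>{1..N - 1}. mdist X (z i) (z (i + 1)))"
      using \<open>N \<ge> 2\<close> by (simp add: e_def)
  qed
  then show "uniformly_disconnected X" using \<delta>(1) by (auto simp: uniformly_disconnected_def)
qed

lemma uniformly_perfect_iff: "uniformly_perfect X \<longleftrightarrow> punif_perfect (mspace X) (mdist X)"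
proof -
  have diam: "ereal r < mdiameter X \<longleftrightarrow> (\<exists>u\<in>mspace X. \<exists>v\<in>mspace X. r < mdist X u v)" for r
    by (simp add: mdiameter_def less_SUP_iff)
  show ?thesis
  proof
    show "uniformly_perfect X \<Longrightarrow> punif_perfect (mspace X) (mdist X)"
      unfolding uniformly_perfect_def punif_perfect_def unif_perfect_with_def diam by blast
    assume "punif_perfect (mspace X) (mdist X)"
    then obtain c where c: "c > 0" "\<And>x u v r. \<lbrakk>x \<in> mspace X; u \<in> mspace X; v \<in> mspace X; r > 0; r < mdist X u v\<rbrakk>
        \<Longrightarrow> \<exists>y\<in>mspace X. c * r \<le> mdist X x y \<and> mdist X x y \<le> r"
      unfolding punif_perfect_def by blast
    \<comment> \<open>Shrinking the constant is harmless and brings it below 1.\<close>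
    have "unif_perfect_with (min c (1/2)) X"
      unfolding unif_perfect_with_def diam
    proof (intro ballI allI impI)
      fix x r assume x: "x \<in> mspace X" "(r::real) > 0" "\<exists>u\<in>mspace X. \<exists>v\<in>mspace X. r < mdist X u v"
      then obtain y where y: "y \<in> mspace X" "c * r \<le> mdist X x y" "mdist X x y \<le> r"
        using c(2) by blast
      moreover have "min c (1/2) * r \<le> c * r" using x(2) by (intro mult_right_mono) auto
      ultimately show "\<exists>y\<in>mspace X. min c (1/2) * r \<le> mdist X x y \<and> mdist X x y \<le> r"
        by (meson order_trans)
    qed
    then show "uniformly_perfect X"
      unfolding uniformly_perfect_def using c(1) by (intro exI[of _ "min c (1/2)"]) auto
  qed
qed

section \<open>Membership of a class, read off a realizing pseudometric\<close>

lemma realizes_gh_Q: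
  assumes "realizes x M d"
  shows "x \<in> gh_Q 1 \<longleftrightarrow> pdoubling M d" "x \<in> gh_Q 2 \<longleftrightarrow> punif_disconnected M d"
    "x \<in> gh_Q 3 \<longleftrightarrow> punif_perfect M d"
proof -
  have pm: "pseudometric_on M d" using realizes_pcompact[OF assms] by (simp add: pcompact_def)
  have *: "x \<in> classes_of P \<longleftrightarrow> Q"
    if PQ: "\<And>X \<phi>. \<lbrakk>\<phi> ` M = mspace X; \<And>m m'. m \<in> M \<Longrightarrow> m' \<in> M \<Longrightarrow> mdist X (\<phi> m) (\<phi> m') = d m m'\<rbrakk> \<Longrightarrow> Q \<longleftrightarrow> P X"
    for P Q
  proof -
    have *: "Q \<longleftrightarrow> P X" if X: "nonempty_compact X" "x = isometry_class X" for X
    proof -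
      obtain \<phi> where "\<phi> ` M = mspace X" "\<And>m m'. m \<in> M \<Longrightarrow> m' \<in> M \<Longrightarrow> mdist X (\<phi> m) (\<phi> m') = d m m'"
        using realizes_onto[OF assms X] by blast
      then show ?thesis by (rule PQ)
    qed
    obtain X where "nonempty_compact X" "x = isometry_class X" by (rule ex_isometry_class)
    then show ?thesis
      unfolding classes_of_def mem_Collect_eq using * by blast
  qed
  show "x \<in> gh_Q 1 \<longleftrightarrow> pdoubling M d"
    unfolding gh_Q_def doubling_iff_pdoubling
    by (simp, rule *, rule pdoubling_surj) (use pm pseudometric_on_mdist in auto)
  show "x \<in> gh_Q 2 \<longleftrightarrow> punif_disconnected M d"
    unfolding gh_Q_def uniformly_disconnected_iff
    by (simp, rule *, rule punif_disconnected_surj) auto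
  show "x \<in> gh_Q 3 \<longleftrightarrow> punif_perfect M d"
    unfolding gh_Q_def uniformly_perfect_iff
    by (simp, rule *, rule punif_perfect_surj) auto
qed

lemma realizes_gh_E:
  assumes "realizes x M d"
  shows "x \<in> gh_E 1 u \<longleftrightarrow> (u = 0 \<longrightarrow> \<not> pdoubling M d) \<and> (u = 1 \<longrightarrow> pdoubling M d)"
    "x \<in> gh_E 2 u \<longleftrightarrow> (u = 0 \<longrightarrow> \<not> punif_disconnected M d) \<and> (u = 1 \<longrightarrow> punif_disconnected M d)"
    "x \<in> gh_E 3 u \<longleftrightarrow> (u = 0 \<longrightarrow> \<not> punif_perfect M d) \<and> (u = 1 \<longrightarrow> punif_perfect M d)"
  using realizes_gh_Q[OF assms] by (auto simp: gh_E_def)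

lemma compact_pcantor_iff_homeomorphic:
  assumes "compact_space (mtopology_of X)"
  shows "mtopology_of X homeomorphic_space top_of_set cantor_set \<longleftrightarrow> pcantor (mspace X) (mdist X)"
proof -
  interpret Metric_space "mspace X" "mdist X" by (rule Metric_space_mspace_mdist)
  have cont: "continuous_map (mtopology_of X) (top_of_set cantor_set) \<theta> \<longleftrightarrow> \<theta> ` mspace X \<subseteq> cantor_set \<and>
      (\<forall>x\<in>mspace X. \<forall>e>0. \<exists>\<delta>>0. \<forall>y\<in>mspace X. mdist X x y < \<delta> \<longrightarrow> \<bar>\<theta> x - \<theta> y\<bar> < e)" for \<theta>
    unfolding continuous_map_in_subtopology mtopology_of_def
    using metric_continuous_map[OF Met_TC.Metric_space_axioms, of \<theta>]
    by (simp add: dist_real_def image_subset_iff_funcset Ball_def imp_conjL conj_commute)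
  show ?thesis
  proof
    assume "mtopology_of X homeomorphic_space top_of_set cantor_set"
    then obtain \<theta> where \<theta>: "homeomorphic_map (mtopology_of X) (top_of_set cantor_set) \<theta>"
      using homeomorphic_space by blast
    then have "continuous_map (mtopology_of X) (top_of_set cantor_set) \<theta>" "\<theta> ` mspace X = cantor_set" "inj_on \<theta> (mspace X)"
      using homeomorphic_imp_continuous_map[OF \<theta>] homeomorphic_imp_surjective_map[OF \<theta>] homeomorphic_imp_injective_map[OF \<theta>]
      by auto
    then show "pcantor (mspace X) (mdist X)"
      unfolding pcantor_def cont bij_betw_def by blast
  next
    assume "pcantor (mspace X) (mdist X)"
    then obtain \<theta> where "bij_betw \<theta> (mspace X) cantor_set" "continuous_map (mtopology_of X) (top_of_set cantor_set) \<theta>"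
      unfolding pcantor_def cont bij_betw_def by blast
    then have "homeomorphic_map (mtopology_of X) (top_of_set cantor_set) \<theta>"
      by (intro continuous_imp_homeomorphic_map assms) (auto simp: bij_betw_def Hausdorff_space_subtopology)
    then show "mtopology_of X homeomorphic_space top_of_set cantor_set"
      using homeomorphic_space by blast
  qed
qed

text \<open>Since \<open>\<theta>\<close> is continuous and injective, points at distance zero
  coincide. Hence \<open>\<phi>\<close> is injective and \<open>\<theta>\<close> can be carried
  along its inverse.\<close>

lemma pcantor_surj:
  assumes "pcantor M d" "\<phi> ` M = N" "\<And>m m'. m \<in> M \<Longrightarrow> m' \<in> M \<Longrightarrow> dN (\<phi> m) (\<phi> m') = d m m'"
    and zero: "\<And>x. x \<in> N \<Longrightarrow> dN x x = 0"
  shows "pcantor N dN"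
proof -
  obtain \<theta> where \<theta>: "bij_betw \<theta> M cantor_set"
     "\<And>x e. x \<in> M \<Longrightarrow> e > 0 \<Longrightarrow> \<exists>\<delta>>0. \<forall>y\<in>M. d x y < \<delta> \<longrightarrow> \<bar>\<theta> x - \<theta> y\<bar> < e"
    using assms(1) unfolding pcantor_def by blast
  have "inj_on \<phi> M"
  proof (rule inj_onI)
    fix x y assume xy: "x \<in> M" "y \<in> M" "\<phi> x = \<phi> y"
    then have 0: "d x y = 0" using assms(2,3) zero by (metis imageI)
    have "\<bar>\<theta> x - \<theta> y\<bar> < e" if "e > 0" for e using \<theta>(2)[OF xy(1) that] 0 xy(2) by force
    then have "\<theta> x = \<theta> y" by (metis abs_0_eq abs_le_zero_iff eq_iff_diff_eq_0 less_irrefl not_le)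
    then show "x = y" using \<theta>(1) xy by (auto simp: bij_betw_def inj_on_def)
  qed
  then have inv: "inv_into M \<phi> (\<phi> x) = x" if "x \<in> M" for x using that by simp
  have "bij_betw (inv_into M \<phi>) N M"
    by (rule bij_betw_inv_into) (use \<open>inj_on \<phi> M\<close> assms(2) in \<open>simp add: bij_betw_def\<close>)
  then have "bij_betw (\<theta> \<circ> inv_into M \<phi>) N cantor_set" using \<theta>(1) by (rule bij_betw_trans)
  moreover have "\<exists>\<delta>>0. \<forall>y\<in>N. dN x y < \<delta> \<longrightarrow> \<bar>(\<theta> \<circ> inv_into M \<phi>) x - (\<theta> \<circ> inv_into M \<phi>) y\<bar> < e"
    if x: "x \<in> N" "e > 0" for x e
  proof -
    obtain m where m: "m \<in> M" "x = \<phi> m" using x(1) assms(2) by blast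
    obtain \<delta> where "\<delta> > 0" "\<forall>y\<in>M. d m y < \<delta> \<longrightarrow> \<bar>\<theta> m - \<theta> y\<bar> < e" using \<theta>(2)[OF m(1) x(2)] by blast
    then show ?thesis using m assms(2,3) inv by (intro exI[of _ \<delta>]) auto
  qed
  ultimately show ?thesis unfolding pcantor_def by blast
qed

lemma realizes_gh_CA:
  assumes "realizes x M d" "pcantor M d"
  shows "x \<in> gh_CA"
proof -
  obtain X \<phi> where X: "nonempty_compact X" "x = isometry_class X" "\<phi> ` M = mspace X"
      "\<And>m m'. m \<in> M \<Longrightarrow> m' \<in> M \<Longrightarrow> mdist X (\<phi> m) (\<phi> m') = d m m'"
    using assms(1) unfolding realizes_def by blast
  have "pcantor (mspace X) (mdist X)" by (rule pcantor_surj[OF assms(2) X(3,4)]) auto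
  then show ?thesis
    using compact_pcantor_iff_homeomorphic X(1,2) unfolding gh_CA_def classes_of_def nonempty_compact_def by blast
qed

lemma gh_CA_realization:
  assumes "x \<in> gh_CA"
  obtains X where "nonempty_compact X" "x = isometry_class X" "pcantor (mspace X) (mdist X)"
  using assms compact_pcantor_iff_homeomorphic unfolding gh_CA_def classes_of_def nonempty_compact_def by blast

lemma pcompact_surj:
  assumes "pcompact M d" "\<phi> ` M = N" "\<And>m m'. m \<in> M \<Longrightarrow> m' \<in> M \<Longrightarrow> dN (\<phi> m) (\<phi> m') = d m m'"
  shows "pcompact N dN"
  unfolding pcompact_def
proof (intro conjI allI impI)
  have pm: "pseudometric_on M d" using assms(1) by (simp add: pcompact_def)
  show "N \<noteq> {}" using assms(1,2) by (auto simp: pcompact_def)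
  show "pseudometric_on N dN"
    unfolding pseudometric_on_def assms(2)[symmetric]
    using pseudometric_onD[OF pm] by (auto simp: assms(3))
  fix \<sigma> :: "nat \<Rightarrow> 'b" assume "range \<sigma> \<subseteq> N"
  then have "\<forall>n. \<exists>u. u \<in> M \<and> \<sigma> n = \<phi> u" using assms(2) by blast
  then obtain \<tau> where \<tau>: "\<And>n. \<tau> n \<in> M" "\<And>n. \<sigma> n = \<phi> (\<tau> n)" by metis
  then obtain l r where l: "l \<in> M" "strict_mono r" "(\<lambda>n. d (\<tau> (r n)) l) \<longlonglongrightarrow> 0"
    using assms unfolding pcompact_def by (metis image_subsetI)
  have "(\<lambda>n. dN (\<sigma> (r n)) (\<phi> l)) \<longlonglongrightarrow> 0" using l \<tau> by (simp add: assms(3))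
  then show "\<exists>l\<in>N. \<exists>r. strict_mono r \<and> (\<lambda>n. dN (\<sigma> (r n)) l) \<longlonglongrightarrow> 0"
    using l(1,2) assms(2) by blast
qed

text \<open>Monotonicity is given only for closed subspaces: the image of \<open>A\<close> is
  compact, hence closed, and its submetric represents the class \<open>y\<close>.\<close>

lemma dimensional_function_mono:
  assumes D: "dimensional_function D" and x: "realizes x M d" and y: "realizes y A dA"
    and \<phi>: "\<phi> ` A \<subseteq> M" "\<And>m m'. m \<in> A \<Longrightarrow> m' \<in> A \<Longrightarrow> d (\<phi> m) (\<phi> m') = dA m m'"
  shows "D y \<le> D x"
proof -
  obtain X \<psi> where X: "nonempty_compact X" "x = isometry_class X" "\<psi> ` M = mspace X"
      "\<And>m m'. m \<in> M \<Longrightarrow> m' \<in> M \<Longrightarrow> mdist X (\<psi> m) (\<psi> m') = d m m'"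
    using x unfolding realizes_def by blast
  define B where "B = \<psi> ` \<phi> ` A"
  have B: "B \<subseteq> mspace X" using X(3) \<phi>(1) by (auto simp: B_def)
  have sub: "mspace (submetric X B) = B" "mdist (submetric X B) = mdist X" using B by auto
  have iso: "(\<psi> \<circ> \<phi>) ` A = B" "\<And>m m'. m \<in> A \<Longrightarrow> m' \<in> A \<Longrightarrow> mdist X ((\<psi> \<circ> \<phi>) m) ((\<psi> \<circ> \<phi>) m') = dA m m'"
    using \<phi> X(4) by (auto simp: B_def image_subset_iff)
  have "pcompact B (mdist X)"
    by (rule pcompact_surj[OF realizes_pcompact[OF y] iso])
  then have nc: "nonempty_compact (submetric X B)"
    using nonempty_compact_iff_pcompact[of "submetric X B"] sub by simp
  have "realizes (isometry_class (submetric X B)) A dA"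
    using realizes_surj[OF realizes_isometry_class[OF nc], of "\<psi> \<circ> \<phi>" A] iso sub
    by (auto intro: realizes_cong)
  then have yB: "isometry_class (submetric X B) = y" using y realizes_unique by blast
  have "compactin (mtopology_of X) B"
    using nc B unfolding nonempty_compact_def mtopology_of_submetric
    by (simp add: compactin_subspace)
  then have "closedin (mtopology_of X) B"
    using compactin_imp_closedin Metric_space.Hausdorff_space_mtopology[OF Metric_space_mspace_mdist]
    by (metis mtopology_of_def)
  moreover have "B \<noteq> {}" using realizes_pcompact[OF y] by (auto simp: B_def pcompact_def)
  ultimately show ?thesis
    using D X(1) yB unfolding dimensional_function_def X(2) by blast
qed

section \<open>Scaling and gluing\<close>

lemma pseudometric_on_scale:
  assumes "pseudometric_on M d" "s \<ge> 0" shows "pseudometric_on M (\<lambda>x y. s * d x y)"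
  unfolding pseudometric_on_def
proof (intro conjI ballI)
  show "s * d x z \<le> s * d x y + s * d y z" if "x \<in> M" "y \<in> M" "z \<in> M" for x y z
    using mult_left_mono[OF pseudometric_onD(3)[OF assms(1) that] assms(2)] by (simp add: distrib_left)
qed (use pseudometric_onD(1,2)[OF assms(1)] in auto)

lemma pcompact_scale:
  assumes "pcompact M d" "s \<ge> 0" shows "pcompact M (\<lambda>x y. s * d x y)"
  unfolding pcompact_def
proof (intro conjI allI impI)
  fix \<sigma> :: "nat \<Rightarrow> 'a" assume "range \<sigma> \<subseteq> M"
  then obtain l r where "l \<in> M" "strict_mono r" "(\<lambda>n. d (\<sigma> (r n)) l) \<longlonglongrightarrow> 0"
    using assms unfolding pcompact_def by blast
  then show "\<exists>l\<in>M. \<exists>r. strict_mono r \<and> (\<lambda>n. s * d (\<sigma> (r n)) l) \<longlonglongrightarrow> 0"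
    using tendsto_mult_right_zero by blast
qed (use assms in \<open>auto simp: pcompact_def pseudometric_on_scale\<close>)

lemma pdoubling_scale:
  assumes "pdoubling M d" "s > 0" shows "pdoubling M (\<lambda>x y. s * d x y)"
proof -
  obtain N0 where "separated_card_le N0 M d"
    using assms(1) by (auto simp: pdoubling_def)
  note N = separated_card_leD[OF this]
  show ?thesis
  proof (rule pdoublingI)
    fix r F assume F: "(r::real) > 0" "finite F" "F \<subseteq> M" "\<And>x y. x \<in> F \<Longrightarrow> y \<in> F \<Longrightarrow> s * d x y \<le> r"
      "\<And>x y. x \<in> F \<Longrightarrow> y \<in> F \<Longrightarrow> x \<noteq> y \<Longrightarrow> r / 4 < s * d x y"
    show "card F \<le> N0"
      by (rule N[of "r / s"]) (use F \<open>s > 0\<close> in \<open>auto simp: field_simps\<close>)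
  qed
qed

lemma pdoubling_scale_iff:
  assumes "s > 0" shows "pdoubling M (\<lambda>x y. s * d x y) \<longleftrightarrow> pdoubling M d"
  using pdoubling_scale[of M d s] pdoubling_scale[of M "\<lambda>x y. s * d x y" "1 / s"] assms by auto

lemma punif_disconnected_scale:
  assumes "punif_disconnected M d" "s > 0" shows "punif_disconnected M (\<lambda>x y. s * d x y)"
proof -
  obtain \<delta> where \<delta>: "\<delta> > 0" "\<And>n z e. \<lbrakk>\<forall>i\<le>n. z i \<in> M; 0 \<le> e; \<forall>i<n. d (z i) (z (Suc i)) \<le> e\<rbrakk> \<Longrightarrow> \<delta> * d (z 0) (z n) \<le> e"
    using assms(1) unfolding punif_disconnected_def by blast
  have "\<delta> * (s * d (z 0) (z n)) \<le> e"
    if "\<forall>i\<le>n. z i \<in> M" "0 \<le> e" "\<forall>i<n. s * d (z i) (z (Suc i)) \<le> e" for n z e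
    using \<delta>(2)[of n z "e / s"] that \<open>s > 0\<close> by (simp add: field_simps)
  then show ?thesis unfolding punif_disconnected_def using \<delta>(1) by blast
qed

lemma punif_disconnected_scale_iff:
  assumes "s > 0" shows "punif_disconnected M (\<lambda>x y. s * d x y) \<longleftrightarrow> punif_disconnected M d"
  using punif_disconnected_scale[of M d s] punif_disconnected_scale[of M "\<lambda>x y. s * d x y" "1 / s"] assms by auto

lemma punif_perfect_scale:
  assumes "punif_perfect M d" "s > 0" shows "punif_perfect M (\<lambda>x y. s * d x y)"
proof -
  obtain c where c: "c > 0" "\<And>x u v r. \<lbrakk>x \<in> M; u \<in> M; v \<in> M; r > 0; r < d u v\<rbrakk>
        \<Longrightarrow> \<exists>y\<in>M. c * r \<le> d x y \<and> d x y \<le> r"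
    using assms(1) unfolding punif_perfect_def by blast
  have "\<exists>y\<in>M. c * r \<le> s * d x y \<and> s * d x y \<le> r"
    if "x \<in> M" "u \<in> M" "v \<in> M" "r > 0" "r < s * d u v" for x u v r
    using c(2)[of x u v "r / s"] that \<open>s > 0\<close> by (simp add: field_simps)
  then show ?thesis unfolding punif_perfect_def using c(1) by blast
qed

lemma pcantor_scale:
  assumes "pcantor M d" "s > 0" shows "pcantor M (\<lambda>x y. s * d x y)"
proof -
  obtain \<theta> where \<theta>: "bij_betw \<theta> M cantor_set"
     "\<And>x e. x \<in> M \<Longrightarrow> e > 0 \<Longrightarrow> \<exists>\<delta>>0. \<forall>y\<in>M. d x y < \<delta> \<longrightarrow> \<bar>\<theta> x - \<theta> y\<bar> < e"
    using assms(1) unfolding pcantor_def by blast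
  have "\<exists>\<delta>>0. \<forall>y\<in>M. s * d x y < \<delta> \<longrightarrow> \<bar>\<theta> x - \<theta> y\<bar> < e" if x: "x \<in> M" "e > 0" for x e
  proof -
    obtain \<delta> where "\<delta> > 0" "\<forall>y\<in>M. d x y < \<delta> \<longrightarrow> \<bar>\<theta> x - \<theta> y\<bar> < e" using \<theta>(2)[OF x] by blast
    then show ?thesis using \<open>s > 0\<close> by (intro exI[of _ "s * \<delta>"]) auto
  qed
  then show ?thesis unfolding pcantor_def using \<theta>(1) by blast
qed

lemma Inl_Inr_mem_Plus [simp]: "Inl x \<in> A <+> B \<longleftrightarrow> x \<in> A" "Inr y \<in> A <+> B \<longleftrightarrow> y \<in> B"
  by auto

section \<open>Self-similarity of the Cantor set\<close>

definition cantor_step :: "real set \<Rightarrow> real set" where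
  "cantor_step C = (\<lambda>x. x / 3) ` C \<union> (\<lambda>x. (x + 2) / 3) ` C"

lemma cantor_set_eq: "cantor_set = (\<Inter>n. (cantor_step ^^ n) {0..1})"
  unfolding cantor_set_def by (simp add: cantor_step_def[abs_def])

lemma cantor_stage_subset: "(cantor_step ^^ n) {0..1} \<subseteq> {0..1}"
  by (induction n) (auto simp: cantor_step_def)

lemma cantor_set_self_similar:
  "cantor_set = (\<lambda>x. x / 3) ` cantor_set \<union> (\<lambda>x. (x + 2) / 3) ` cantor_set"
proof -
  define S where "S n = (cantor_step ^^ n) {0..1}" for n
  have S_Suc: "S (Suc n) = (\<lambda>x. x / 3) ` S n \<union> (\<lambda>x. (x + 2) / 3) ` S n" for n
    by (simp add: S_def cantor_step_def)
  have sub: "S n \<subseteq> {0..1}" for n unfolding S_def by (rule cantor_stage_subset)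
  have C: "cantor_set = (\<Inter>n. S n)" by (simp add: cantor_set_eq S_def)
  have dec: "S (Suc n) \<subseteq> S n" for n
  proof (induction n)
    case 0
    show ?case using sub[of 1] by (simp add: S_def)
  next
    case (Suc n)
    then show ?case unfolding S_Suc[of "Suc n"] S_Suc[of n] by blast
  qed
  then have tail: "(\<Inter>n. S n) = (\<Inter>n. S (Suc n))" by blast
  show ?thesis
  proof
    show "cantor_set \<subseteq> (\<lambda>x. x / 3) ` cantor_set \<union> (\<lambda>x. (x + 2) / 3) ` cantor_set"
    proof
      fix c assume c: "c \<in> cantor_set"
      have mem: "c \<in> (\<lambda>x. x / 3) ` S n \<union> (\<lambda>x. (x + 2) / 3) ` S n" for n
        using c unfolding C tail S_Suc by blast
      show "c \<in> (\<lambda>x. x / 3) ` cantor_set \<union> (\<lambda>x. (x + 2) / 3) ` cantor_set"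
      \<comment> \<open>The two copies lie in \<open>[0, 1/3]\<close> and \<open>[2/3, 1]\<close>,
        so the side of \<open>c\<close> is the same for all stages.\<close>
      proof (cases "c \<le> 1 / 2")
        case True
        have "3 * c \<in> S n" for n
        proof -
          have "c \<notin> (\<lambda>x. (x + 2) / 3) ` S n" using True sub[of n] by force
          then obtain x where x: "x \<in> S n" "c = x / 3" using mem[of n] by blast
          then have "3 * c = x" by simp
          then show ?thesis using x(1) by metis
        qed
        then show ?thesis unfolding C by (intro UnI1 image_eqI[of _ _ "3 * c"]) auto
      next
        case False
        have "3 * c - 2 \<in> S n" for n
        proof -
          have "c \<notin> (\<lambda>x. x / 3) ` S n" using False sub[of n] by force
          then obtain x where x: "x \<in> S n" "c = (x + 2) / 3" using mem[of n] by blast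
          then have "3 * c - 2 = x" by (simp add: field_simps)
          then show ?thesis using x(1) by simp
        qed
        then show ?thesis unfolding C by (intro UnI2 image_eqI[of _ _ "3 * c - 2"]) auto
      qed
    qed
    show "(\<lambda>x. x / 3) ` cantor_set \<union> (\<lambda>x. (x + 2) / 3) ` cantor_set \<subseteq> cantor_set"
      unfolding C by (subst (3) tail) (auto simp: S_Suc)
  qed
qed

section \<open>Joins of pointed pseudometric spaces\<close>

definition join_dist ::
  "('a \<Rightarrow> 'a \<Rightarrow> real) \<Rightarrow> 'a \<Rightarrow> ('b \<Rightarrow> 'b \<Rightarrow> real) \<Rightarrow> 'b \<Rightarrow> real \<Rightarrow> 'a + 'b \<Rightarrow> 'a + 'b \<Rightarrow> real" where
  "join_dist dA a dB b g p q = (case p of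
      Inl x \<Rightarrow> (case q of Inl x' \<Rightarrow> dA x x' | Inr y \<Rightarrow> dA x a + g + dB b y)
    | Inr y \<Rightarrow> (case q of Inl x \<Rightarrow> dA x a + g + dB b y | Inr y' \<Rightarrow> dB y y'))"

lemma join_dist_simps [simp]:
  "join_dist dA a dB b g (Inl x) (Inl x') = dA x x'"
  "join_dist dA a dB b g (Inl x) (Inr y) = dA x a + g + dB b y"
  "join_dist dA a dB b g (Inr y) (Inl x) = dA x a + g + dB b y"
  "join_dist dA a dB b g (Inr y) (Inr y') = dB y y'"
  by (simp_all add: join_dist_def)

lemma pcompact_subseq:
  assumes "pcompact M d" "\<And>n. \<sigma> n \<in> M"
  obtains l r where "l \<in> M" "strict_mono (r :: nat \<Rightarrow> nat)" "(\<lambda>n. d (\<sigma> (r n)) l) \<longlonglongrightarrow> 0"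
proof -
  have "range \<sigma> \<subseteq> M" using assms(2) by blast
  then show thesis using assms(1) that unfolding pcompact_def by blast
qed

text \<open>The base points are linked by an edge of length \<open>g\<close> that every path between
  the parts has to use. For \<open>g = 0\<close> this is the wedge: its two base points remain
  distinct elements, at distance zero.\<close>

locale pointed_join =
  fixes A :: "'a set" and dA a and B :: "'b set" and dB b and g :: real
  assumes pm_A: "pseudometric_on A dA" and pm_B: "pseudometric_on B dB"
    and a: "a \<in> A" and b: "b \<in> B" and g: "g \<ge> 0"
begin

abbreviation J where "J \<equiv> join_dist dA a dB b g"

lemma pseudometric_on_join: "pseudometric_on (A <+> B) J"
  unfolding pseudometric_on_def
proof (intro conjI ballI)
  note A = pseudometric_onD[OF pm_A] and B = pseudometric_onD[OF pm_B]
  show "J p p = 0" if "p \<in> A <+> B" for p using that A B by auto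
  show "J p q = J q p" if "p \<in> A <+> B" "q \<in> A <+> B" for p q using that A(2) B(2) by auto
  show "J p q \<le> J p r + J r q" if pqr: "p \<in> A <+> B" "r \<in> A <+> B" "q \<in> A <+> B" for p r q
  proof (cases p; cases q; cases r)
    fix x y z assume s: "p = Inl x" "q = Inl y" "r = Inl z"
    then show ?thesis using A(3)[of x z y] pqr by simp
  next
    fix x y z assume s: "p = Inl x" "q = Inl y" "r = Inr z"
    then show ?thesis using A(3)[of x a y] A(2)[of a y] pqr a b g pseudometric_on_nonneg[OF pm_B, of b z] by simp
  next
    fix x y z assume s: "p = Inl x" "q = Inr y" "r = Inl z"
    then show ?thesis using A(3)[of x z a] pqr a by simp
  next
    fix x y z assume s: "p = Inl x" "q = Inr y" "r = Inr z"
    then show ?thesis using B(3)[of b z y] pqr b by simp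
  next
    fix x y z assume s: "p = Inr x" "q = Inl y" "r = Inl z"
    then show ?thesis using A(3)[of y z a] A(2)[of y z] pqr a by simp
  next
    fix x y z assume s: "p = Inr x" "q = Inl y" "r = Inr z"
    then show ?thesis using B(3)[of b z x] B(2)[of x z] pqr b by simp
  next
    fix x y z assume s: "p = Inr x" "q = Inr y" "r = Inl z"
    then show ?thesis using B(3)[of x b y] B(2)[of b x] pqr a b g pseudometric_on_nonneg[OF pm_A, of z a] by simp
  next
    fix x y z assume s: "p = Inr x" "q = Inr y" "r = Inr z"
    then show ?thesis using B(3)[of x z y] pqr by simp
  qed
qed

text \<open>One of the parts contains infinitely many terms of the sequence, and its compactness
  applies to them.\<close>

lemma pcompact_join:
  assumes "pcompact A dA" "pcompact B dB"
  shows "pcompact (A <+> B) J"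
  unfolding pcompact_def
proof (intro conjI allI impI)
  show "A <+> B \<noteq> {}" using a by blast
  show "pseudometric_on (A <+> B) J" by (rule pseudometric_on_join)
  fix \<sigma> :: "nat \<Rightarrow> 'a + 'b" assume \<sigma>: "range \<sigma> \<subseteq> A <+> B"
  have "infinite {n. \<sigma> n \<in> Inl ` A} \<or> infinite {n. \<sigma> n \<in> Inr ` B}"
  proof (rule ccontr)
    assume "\<not> ?thesis"
    moreover have "\<sigma> n \<in> Inl ` A \<union> Inr ` B" for n using \<sigma> unfolding Plus_def by blast
    then have "{n. \<sigma> n \<in> Inl ` A} \<union> {n. \<sigma> n \<in> Inr ` B} = UNIV" by blast
    ultimately show False by (metis finite_Un infinite_UNIV_nat)
  qed
  then show "\<exists>l\<in>A <+> B. \<exists>r. strict_mono r \<and> (\<lambda>n. J (\<sigma> (r n)) l) \<longlonglongrightarrow> 0"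
  proof
    assume "infinite {n. \<sigma> n \<in> Inl ` A}"
    then obtain r0 :: "nat \<Rightarrow> nat" where r0: "strict_mono r0" "\<forall>n. r0 n \<in> {n. \<sigma> n \<in> Inl ` A}"
      using infinite_enumerate by blast
    then have "\<forall>n. \<exists>t. t \<in> A \<and> \<sigma> (r0 n) = Inl t" by blast
    then obtain \<tau> where \<tau>: "\<And>n. \<tau> n \<in> A" "\<And>n. \<sigma> (r0 n) = Inl (\<tau> n)" unfolding choice_iff by blast
    then obtain l r where l: "l \<in> A" "strict_mono r" "(\<lambda>n. dA (\<tau> (r n)) l) \<longlonglongrightarrow> 0"
      using pcompact_subseq[OF assms(1)] by metis
    have "(\<lambda>n. J (\<sigma> ((r0 \<circ> r) n)) (Inl l)) \<longlonglongrightarrow> 0" using l(3) \<tau>(2) by simp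
    then show ?thesis using l(1) strict_mono_o[OF r0(1) l(2)] by blast
  next
    assume "infinite {n. \<sigma> n \<in> Inr ` B}"
    then obtain r0 :: "nat \<Rightarrow> nat" where r0: "strict_mono r0" "\<forall>n. r0 n \<in> {n. \<sigma> n \<in> Inr ` B}"
      using infinite_enumerate by blast
    then have "\<forall>n. \<exists>t. t \<in> B \<and> \<sigma> (r0 n) = Inr t" by blast
    then obtain \<tau> where \<tau>: "\<And>n. \<tau> n \<in> B" "\<And>n. \<sigma> (r0 n) = Inr (\<tau> n)" unfolding choice_iff by blast
    then obtain l r where l: "l \<in> B" "strict_mono r" "(\<lambda>n. dB (\<tau> (r n)) l) \<longlonglongrightarrow> 0"
      using pcompact_subseq[OF assms(2)] by metis
    have "(\<lambda>n. J (\<sigma> ((r0 \<circ> r) n)) (Inr l)) \<longlonglongrightarrow> 0" using l(3) \<tau>(2) by simp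
    then show ?thesis using l(1) strict_mono_o[OF r0(1) l(2)] by blast
  qed
qed

text \<open>A separated set splits into its traces on the two parts, which are separated at the same
  scale; the bounds add.\<close>

lemma pdoubling_join_iff: "pdoubling (A <+> B) J \<longleftrightarrow> pdoubling A dA \<and> pdoubling B dB"
proof (intro iffI conjI)
  assume J: "pdoubling (A <+> B) J"
  show "pdoubling A dA" by (rule pdoubling_isometric[OF J, of Inl]) (use pm_A in auto)
  show "pdoubling B dB" by (rule pdoubling_isometric[OF J, of Inr]) (use pm_B in auto)
next
  assume "pdoubling A dA \<and> pdoubling B dB"
  then obtain NA NB where N: "separated_card_le NA A dA" "separated_card_le NB B dB"
    by (auto simp: pdoubling_def)
  show "pdoubling (A <+> B) J"
  proof (rule pdoublingI)
    fix r F assume F: "(r::real) > 0" "finite F" "F \<subseteq> A <+> B" "\<And>x y. x \<in> F \<Longrightarrow> y \<in> F \<Longrightarrow> J x y \<le> r"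
      "\<And>x y. x \<in> F \<Longrightarrow> y \<in> F \<Longrightarrow> x \<noteq> y \<Longrightarrow> r / 4 < J x y"
    have fin: "finite (Inl -` F)" "finite (Inr -` F)" using F(2) by (auto intro!: finite_vimageI)
    have "card (Inl -` F) \<le> NA"
    proof (rule separated_card_leD[OF N(1) F(1) fin(1)])
      show "Inl -` F \<subseteq> A" using F(3) by auto
      show "dA x y \<le> r" if "x \<in> Inl -` F" "y \<in> Inl -` F" for x y using F(4)[of "Inl x" "Inl y"] that by simp
      show "r / 4 < dA x y" if "x \<in> Inl -` F" "y \<in> Inl -` F" "x \<noteq> y" for x y using F(5)[of "Inl x" "Inl y"] that by simp
    qed
    moreover have "card (Inr -` F) \<le> NB"
    proof (rule separated_card_leD[OF N(2) F(1) fin(2)])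
      show "Inr -` F \<subseteq> B" using F(3) by auto
      show "dB x y \<le> r" if "x \<in> Inr -` F" "y \<in> Inr -` F" for x y using F(4)[of "Inr x" "Inr y"] that by simp
      show "r / 4 < dB x y" if "x \<in> Inr -` F" "y \<in> Inr -` F" "x \<noteq> y" for x y using F(5)[of "Inr x" "Inr y"] that by simp
    qed
    moreover have "F = (Inl -` F) <+> (Inr -` F)"
    proof (rule set_eqI)
      fix p show "p \<in> F \<longleftrightarrow> p \<in> (Inl -` F) <+> (Inr -` F)" by (cases p) auto
    qed
    ultimately show "card F \<le> NA + NB" using card_Plus[OF fin] by simp
  qed
qed

text \<open>The distance is the sum of the distances of the projections to \<open>A\<close> and to \<open>B\<close> and of the
  gap; each of the three summands is dominated by the distance.\<close>

lemma punif_disconnected_join_iff: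
  "punif_disconnected (A <+> B) J \<longleftrightarrow> punif_disconnected A dA \<and> punif_disconnected B dB"
proof (intro iffI conjI)
  assume J: "punif_disconnected (A <+> B) J"
  show "punif_disconnected A dA" by (rule punif_disconnected_isometric[OF J, of Inl]) auto
  show "punif_disconnected B dB" by (rule punif_disconnected_isometric[OF J, of Inr]) auto
next
  assume ud: "punif_disconnected A dA \<and> punif_disconnected B dB"
  obtain \<delta>A where \<delta>A: "\<delta>A > 0" "\<And>n z e. \<lbrakk>\<forall>i\<le>n. z i \<in> A; 0 \<le> e; \<forall>i<n. dA (z i) (z (Suc i)) \<le> e\<rbrakk> \<Longrightarrow> \<delta>A * dA (z 0) (z n) \<le> e"
    using ud[THEN conjunct1] unfolding punif_disconnected_def by blast
  obtain \<delta>B where \<delta>B: "\<delta>B > 0" "\<And>n z e. \<lbrakk>\<forall>i\<le>n. z i \<in> B; 0 \<le> e; \<forall>i<n. dB (z i) (z (Suc i)) \<le> e\<rbrakk> \<Longrightarrow> \<delta>B * dB (z 0) (z n) \<le> e"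
    using ud[THEN conjunct2] unfolding punif_disconnected_def by blast
  define \<pi>A where "\<pi>A = case_sum (\<lambda>x. x) (\<lambda>_::'b. a)"
  define \<pi>B where "\<pi>B = case_sum (\<lambda>_::'a. b) (\<lambda>y. y)"
  \<comment> \<open>The gap counts as a third distance: a chain that changes sides has a step of
    size at least \<open>g\<close>.\<close>
  define G where "G p q = (if isl p = isl q then 0 else g)" for p q :: "'a + 'b"
  have J_eq: "J p q = dA (\<pi>A p) (\<pi>A q) + G p q + dB (\<pi>B p) (\<pi>B q)"
    if "p \<in> A <+> B" "q \<in> A <+> B" for p q
    using that a b pseudometric_onD(1,2)[OF pm_A] pseudometric_onD(1,2)[OF pm_B]
    by (auto simp: \<pi>A_def \<pi>B_def G_def elim!: PlusE)
  have \<pi>A: "\<pi>A p \<in> A" and \<pi>B: "\<pi>B p \<in> B" if "p \<in> A <+> B" for p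
    using that a b by (auto simp: \<pi>A_def \<pi>B_def)
  \<comment> \<open>Each of the three summands of the distance may use up a third of
    \<open>e\<close>.\<close>
  define \<delta> where "\<delta> = min (min \<delta>A \<delta>B) 1 / 3"
  have "\<delta> > 0" using \<delta>A \<delta>B by (simp add: \<delta>_def)
  have "\<delta> * J (z 0) (z n) \<le> e"
    if z: "\<forall>i\<le>n. z i \<in> A <+> B" "0 \<le> e" "\<forall>i<n. J (z i) (z (Suc i)) \<le> e" for n z e
  proof -
    have nn: "0 \<le> dA (\<pi>A p) (\<pi>A q)" "0 \<le> dB (\<pi>B p) (\<pi>B q)" "0 \<le> G p q"
      if "p \<in> A <+> B" "q \<in> A <+> B" for p q
      using pseudometric_on_nonneg[OF pm_A \<pi>A[OF that(1)] \<pi>A[OF that(2)]]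
        pseudometric_on_nonneg[OF pm_B \<pi>B[OF that(1)] \<pi>B[OF that(2)]] g by (auto simp: G_def)
    have step: "dA (\<pi>A (z i)) (\<pi>A (z (Suc i))) \<le> e" "dB (\<pi>B (z i)) (\<pi>B (z (Suc i))) \<le> e" "G (z i) (z (Suc i)) \<le> e"
      if "i < n" for i
    proof -
      have "z i \<in> A <+> B" "z (Suc i) \<in> A <+> B" "J (z i) (z (Suc i)) \<le> e" using z that by auto
      then show "dA (\<pi>A (z i)) (\<pi>A (z (Suc i))) \<le> e" "dB (\<pi>B (z i)) (\<pi>B (z (Suc i))) \<le> e" "G (z i) (z (Suc i)) \<le> e"
        using nn[of "z i" "z (Suc i)"] J_eq[of "z i" "z (Suc i)"] by linarith+
    qed
    have mem: "z 0 \<in> A <+> B" "z n \<in> A <+> B" using z(1) by auto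
    have A: "\<delta>A * dA (\<pi>A (z 0)) (\<pi>A (z n)) \<le> e"
      by (rule \<delta>A(2)[of n "\<lambda>i. \<pi>A (z i)"]) (use z \<pi>A step in auto)
    have B: "\<delta>B * dB (\<pi>B (z 0)) (\<pi>B (z n)) \<le> e"
      by (rule \<delta>B(2)[of n "\<lambda>i. \<pi>B (z i)"]) (use z \<pi>B step in auto)
    have C: "G (z 0) (z m) \<le> e" if "m \<le> n" for m
      using that
    proof (induction m)
      case 0 then show ?case using z(2) by (simp add: G_def)
    next
      case (Suc m)
      then have "G (z 0) (z m) \<le> e" "G (z m) (z (Suc m)) \<le> e" using step(3)[of m] by auto
      then show ?case using z(2) by (auto simp: G_def split: if_splits)
    qed
    have "\<delta> * dA (\<pi>A (z 0)) (\<pi>A (z n)) \<le> (\<delta>A / 3) * dA (\<pi>A (z 0)) (\<pi>A (z n))"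
      by (rule mult_right_mono) (use nn[OF mem] in \<open>auto simp: \<delta>_def\<close>)
    moreover have "\<delta> * dB (\<pi>B (z 0)) (\<pi>B (z n)) \<le> (\<delta>B / 3) * dB (\<pi>B (z 0)) (\<pi>B (z n))"
      by (rule mult_right_mono) (use nn[OF mem] in \<open>auto simp: \<delta>_def\<close>)
    moreover have "\<delta> * G (z 0) (z n) \<le> (1 / 3) * G (z 0) (z n)"
      by (rule mult_right_mono) (use nn[OF mem] in \<open>auto simp: \<delta>_def\<close>)
    ultimately have "\<delta> * J (z 0) (z n) \<le> e / 3 + e / 3 + e / 3"
      unfolding J_eq[OF mem] distrib_left using A B C[of n] by linarith
    then show ?thesis by simp
  qed
  then show "punif_disconnected (A <+> B) J"
    unfolding punif_disconnected_def using \<open>\<delta> > 0\<close> by blast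
qed

text \<open>The diameter of a join may exceed those of its parts, so radii up to a common bound
  \<open>K\<close> have to be served. A radius beyond half of one fixed positive distance
  \<open>\<eta>\<close> is cut down to \<open>\<eta> / 2\<close>, at the cost of the factor
  \<open>\<eta> / (2 * K)\<close>.\<close>

lemma punif_perfect_bounded:
  assumes "punif_perfect M d" "pseudometric_on M d" "K > 0"
  obtains c where "c > 0"
    "\<And>x r. \<lbrakk>x \<in> M; 0 < r; r \<le> K; u \<in> M; v \<in> M; d u v > 0\<rbrakk> \<Longrightarrow> \<exists>y\<in>M. c * r \<le> d x y \<and> d x y \<le> r"
proof -
  obtain c where c: "c > 0" "\<And>x u v r. \<lbrakk>x \<in> M; u \<in> M; v \<in> M; r > 0; r < d u v\<rbrakk>
        \<Longrightarrow> \<exists>y\<in>M. c * r \<le> d x y \<and> d x y \<le> r"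
    using assms(1) unfolding punif_perfect_def by blast
  define \<eta> where "\<eta> = (if d u v > 0 then d u v else 1)"
  have "\<eta> > 0" by (simp add: \<eta>_def)
  show thesis
  proof (rule that[of "c * min 1 (\<eta> / (2 * K))"])
    show "c * min 1 (\<eta> / (2 * K)) > 0" using c(1) \<open>K > 0\<close> \<open>\<eta> > 0\<close> by simp
    fix x r assume x: "x \<in> M" "0 < r" "r \<le> K" and uv: "u \<in> M" "v \<in> M" "d u v > 0"
    define r' where "r' = min r (\<eta> / 2)"
    have "r' > 0" "r' < d u v" "r' \<le> r" using x uv by (auto simp: r'_def \<eta>_def)
    then obtain y where y: "y \<in> M" "c * r' \<le> d x y" "d x y \<le> r'" using c(2) x(1) uv(1,2) by blast
    have "min 1 (\<eta> / (2 * K)) * r \<le> r'"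
    proof (cases "r \<le> \<eta> / 2")
      case True
      then show ?thesis using x by (simp add: r'_def mult_left_le_one_le min_def)
    next
      case False
      have "min 1 (\<eta> / (2 * K)) * r \<le> \<eta> / (2 * K) * K"
        by (rule mult_mono) (use x \<open>K > 0\<close> \<open>\<eta> > 0\<close> in auto)
      then show ?thesis using False \<open>K > 0\<close> by (simp add: r'_def)
    qed
    then have "c * (min 1 (\<eta> / (2 * K)) * r) \<le> c * r'" using c(1) by (intro mult_left_mono) auto
    then show "\<exists>y\<in>M. c * min 1 (\<eta> / (2 * K)) * r \<le> d x y \<and> d x y \<le> r"
      using y \<open>r' \<le> r\<close> by (intro bexI[of _ y]) (auto simp: mult.assoc)
  qed
qed

text \<open>A space of diameter zero is uniformly perfect vacuously and offers no point at a
  prescribed distance; it is set apart as the second alternative.\<close>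

lemma punif_perfect_dichotomy:
  assumes "punif_perfect M d" "pseudometric_on M d" "K > 0"
  shows "\<exists>c>0. \<forall>x\<in>M. \<forall>r. 0 < r \<and> r \<le> K \<longrightarrow>
    (\<exists>y\<in>M. c * r \<le> d x y \<and> d x y \<le> r) \<or> (\<forall>u\<in>M. \<forall>v\<in>M. d u v = 0)"
proof (cases "\<forall>u\<in>M. \<forall>v\<in>M. d u v = 0")
  case True
  then show ?thesis by (intro exI[of _ 1]) simp
next
  case False
  then obtain u v where uv: "u \<in> M" "v \<in> M" "d u v > 0"
    using pseudometric_on_nonneg[OF assms(2)] by force
  obtain c where "c > 0" "\<And>x r. \<lbrakk>x \<in> M; 0 < r; r \<le> K\<rbrakk> \<Longrightarrow> \<exists>y\<in>M. c * r \<le> d x y \<and> d x y \<le> r"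
    using punif_perfect_bounded[OF assms, of u v] uv by metis
  then show ?thesis by blast
qed

text \<open>From a part of diameter zero, the point is found in the other part: as
  \<open>g = 0\<close>, the passage over the base points costs nothing.\<close>

lemma punif_perfect_join:
  assumes "punif_perfect A dA" "punif_perfect B dB" "g = 0" and cA: "pcompact A dA" and cB: "pcompact B dB"
  shows "punif_perfect (A <+> B) J"
proof -
  obtain K0 where K0: "\<And>p q. p \<in> A <+> B \<Longrightarrow> q \<in> A <+> B \<Longrightarrow> J p q \<le> K0"
    using pcompact_bounded[OF pcompact_join[OF cA cB]] by metis
  define K where "K = max K0 1"
  have K: "K > 0" "\<And>p q. p \<in> A <+> B \<Longrightarrow> q \<in> A <+> B \<Longrightarrow> J p q \<le> K"
    using K0 by (auto simp: K_def le_max_iff_disj)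
  obtain cA where cA: "cA > 0" "\<And>x r. \<lbrakk>x \<in> A; 0 < r; r \<le> K\<rbrakk> \<Longrightarrow>
      (\<exists>y\<in>A. cA * r \<le> dA x y \<and> dA x y \<le> r) \<or> (\<forall>u\<in>A. \<forall>v\<in>A. dA u v = 0)"
    using punif_perfect_dichotomy[OF assms(1) pm_A K(1)] by blast
  obtain cB where cB: "cB > 0" "\<And>x r. \<lbrakk>x \<in> B; 0 < r; r \<le> K\<rbrakk> \<Longrightarrow>
      (\<exists>y\<in>B. cB * r \<le> dB x y \<and> dB x y \<le> r) \<or> (\<forall>u\<in>B. \<forall>v\<in>B. dB u v = 0)"
    using punif_perfect_dichotomy[OF assms(2) pm_B K(1)] by blast
  show ?thesis
    unfolding punif_perfect_def
  proof (intro exI[of _ "min cA cB"] conjI ballI allI impI)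
    fix p u v and r :: real
    assume p: "p \<in> A <+> B" and uv: "u \<in> A <+> B" "v \<in> A <+> B" and r: "0 < r" "r < J u v"
    have rK: "r \<le> K" using r(2) K(2)[OF uv] by simp
    have le: "min cA cB * r \<le> cA * r" "min cA cB * r \<le> cB * r" using r(1) by (auto intro!: mult_right_mono)
    \<comment> \<open>Two parts of diameter zero would make all distances of the join zero, against
      \<open>0 < r < J u v\<close>.\<close>
    have triv: "\<not> ((\<forall>u\<in>A. \<forall>v\<in>A. dA u v = 0) \<and> (\<forall>u\<in>B. \<forall>v\<in>B. dB u v = 0))"
    proof
      assume "(\<forall>u\<in>A. \<forall>v\<in>A. dA u v = 0) \<and> (\<forall>u\<in>B. \<forall>v\<in>B. dB u v = 0)"
      then have "J u v = 0" using uv a b \<open>g = 0\<close> by auto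
      then show False using r by simp
    qed
    show "\<exists>q\<in>A <+> B. min cA cB * r \<le> J p q \<and> J p q \<le> r"
    proof (cases p)
      case (Inl x)
      then have x: "x \<in> A" using p by simp
      consider y where "y \<in> A" "cA * r \<le> dA x y" "dA x y \<le> r"
        | y where "\<forall>u\<in>A. \<forall>v\<in>A. dA u v = 0" "y \<in> B" "cB * r \<le> dB b y" "dB b y \<le> r"
        using cA(2)[OF x r(1) rK] cB(2)[OF b r(1) rK] triv by blast
      then show ?thesis
      proof cases
        case (1 y)
        then show ?thesis using le Inl by (intro bexI[of _ "Inl y"]) auto
      next
        case (2 y)
        then show ?thesis using le Inl x a \<open>g = 0\<close> by (intro bexI[of _ "Inr y"]) auto
      qed
    next
      case (Inr x)
      then have x: "x \<in> B" using p by simp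
      consider y where "y \<in> B" "cB * r \<le> dB x y" "dB x y \<le> r"
        | y where "\<forall>u\<in>B. \<forall>v\<in>B. dB u v = 0" "y \<in> A" "cA * r \<le> dA a y" "dA a y \<le> r"
        using cB(2)[OF x r(1) rK] cA(2)[OF a r(1) rK] triv by blast
      then show ?thesis
      proof cases
        case (1 y)
        then show ?thesis using le Inr by (intro bexI[of _ "Inr y"]) auto
      next
        case (2 y)
        then show ?thesis using le Inr x b \<open>g = 0\<close> pseudometric_onD(2)[OF pm_A a, of y]
          by (intro bexI[of _ "Inl y"]) auto
      qed
    qed
  qed (use cA(1) cB(1) in simp)
qed

text \<open>The parts are mapped to the left and the right third of the Cantor set. Points closer
  than the positive gap are in the same part, so continuity can be checked on each part
  alone.\<close>

lemma pcantor_join: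
  assumes "pcantor A dA" "pcantor B dB" "g > 0"
  shows "pcantor (A <+> B) J"
proof -
  obtain \<theta> where \<theta>: "bij_betw \<theta> A cantor_set"
     "\<And>x e. x \<in> A \<Longrightarrow> e > 0 \<Longrightarrow> \<exists>\<delta>>0. \<forall>y\<in>A. dA x y < \<delta> \<longrightarrow> \<bar>\<theta> x - \<theta> y\<bar> < e"
    using assms(1) unfolding pcantor_def by blast
  obtain \<eta> where \<eta>: "bij_betw \<eta> B cantor_set"
     "\<And>x e. x \<in> B \<Longrightarrow> e > 0 \<Longrightarrow> \<exists>\<delta>>0. \<forall>y\<in>B. dB x y < \<delta> \<longrightarrow> \<bar>\<eta> x - \<eta> y\<bar> < e"
    using assms(2) unfolding pcantor_def by blast
  define h where "h = case_sum (\<lambda>x. \<theta> x / 3) (\<lambda>y. (\<eta> y + 2) / 3)"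
  have "bij_betw h (A <+> B) cantor_set"
    unfolding bij_betw_def
  proof
    have C: "0 \<le> c" "c \<le> 1" if "c \<in> cantor_set" for c
      using that by (auto simp: cantor_set_def dest!: spec[of _ "0::nat"])
    have rng: "\<theta> x \<in> cantor_set" "\<eta> y \<in> cantor_set" if "x \<in> A" "y \<in> B" for x y
      using that \<theta>(1) \<eta>(1) by (auto simp: bij_betw_def)
    have less: "\<theta> x / 3 < (\<eta> y + 2) / 3" if "x \<in> A" "y \<in> B" for x y
      using C(2)[OF rng(1)[OF that]] C(1)[OF rng(2)[OF that]] by (simp add: field_simps)
    show "inj_on h (A <+> B)"
    proof (rule inj_onI)
      fix p q assume pq: "p \<in> A <+> B" "q \<in> A <+> B" "h p = h q"
      have inj: "\<theta> x = \<theta> y \<Longrightarrow> x \<in> A \<Longrightarrow> y \<in> A \<Longrightarrow> x = y" "\<eta> u = \<eta> v \<Longrightarrow> u \<in> B \<Longrightarrow> v \<in> B \<Longrightarrow> u = v" for x y u v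
        using \<theta>(1) \<eta>(1) by (auto simp: bij_betw_def dest: inj_onD)
      show "p = q"
      proof (cases p; cases q)
        fix x y assume "p = Inl x" "q = Inl y" then show ?thesis using pq inj(1) by (simp add: h_def)
      next
        fix x y assume "p = Inl x" "q = Inr y" then show ?thesis using pq less[of x y] by (simp add: h_def)
      next
        fix x y assume "p = Inr x" "q = Inl y" then show ?thesis using pq less[of y x] by (simp add: h_def)
      next
        fix x y assume "p = Inr x" "q = Inr y" then show ?thesis using pq inj(2) by (simp add: h_def)
      qed
    qed
    have "h ` (A <+> B) = (\<lambda>x. x / 3) ` \<theta> ` A \<union> (\<lambda>x. (x + 2) / 3) ` \<eta> ` B"
      by (auto simp: h_def Plus_def image_Un image_image)
    also have "\<dots> = (\<lambda>x. x / 3) ` cantor_set \<union> (\<lambda>x. (x + 2) / 3) ` cantor_set"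
      using \<theta>(1) \<eta>(1) by (simp add: bij_betw_def)
    also have "\<dots> = cantor_set" by (rule cantor_set_self_similar[symmetric])
    finally show "h ` (A <+> B) = cantor_set" .
  qed
  moreover have "\<exists>\<delta>>0. \<forall>q\<in>A <+> B. J p q < \<delta> \<longrightarrow> \<bar>h p - h q\<bar> < e" if p: "p \<in> A <+> B" "e > 0" for p e
  proof (cases p)
    case (Inl x)
    then have x: "x \<in> A" using p by auto
    obtain \<delta> where \<delta>: "\<delta> > 0" "\<forall>y\<in>A. dA x y < \<delta> \<longrightarrow> \<bar>\<theta> x - \<theta> y\<bar> < e"
      using \<theta>(2)[OF x p(2)] by blast
    have "\<bar>h p - h q\<bar> < e" if q: "q \<in> A <+> B" "J p q < min \<delta> g" for q
    proof (cases q)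
      case (Inl y)
      then have "\<bar>\<theta> x - \<theta> y\<bar> < e" using \<delta>(2) q \<open>p = Inl x\<close> by auto
      then show ?thesis using Inl \<open>p = Inl x\<close> by (simp add: h_def diff_divide_distrib[symmetric])
    next
      case (Inr y)
      then have "y \<in> B" using q by auto
      then show ?thesis
        using q(2) Inr \<open>p = Inl x\<close> pseudometric_on_nonneg[OF pm_A x a] pseudometric_on_nonneg[OF pm_B b, of y] by simp
    qed
    then show ?thesis using \<delta>(1) assms(3) by (intro exI[of _ "min \<delta> g"]) auto
  next
    case (Inr x)
    then have x: "x \<in> B" using p by auto
    obtain \<delta> where \<delta>: "\<delta> > 0" "\<forall>y\<in>B. dB x y < \<delta> \<longrightarrow> \<bar>\<eta> x - \<eta> y\<bar> < e"
      using \<eta>(2)[OF x p(2)] by blast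
    have "\<bar>h p - h q\<bar> < e" if q: "q \<in> A <+> B" "J p q < min \<delta> g" for q
    proof (cases q)
      case (Inr y)
      then have "\<bar>\<eta> x - \<eta> y\<bar> < e" using \<delta>(2) q \<open>p = Inr x\<close> by auto
      then show ?thesis using Inr \<open>p = Inr x\<close> by (simp add: h_def diff_divide_distrib[symmetric])
    next
      case (Inl y)
      then have "y \<in> A" using q by auto
      then show ?thesis
        using q(2) Inl \<open>p = Inr x\<close> pseudometric_on_nonneg[OF pm_B b x] pseudometric_on_nonneg[OF pm_A _ a, of y] by simp
    qed
    then show ?thesis using \<delta>(1) assms(3) by (intro exI[of _ "min \<delta> g"]) auto
  qed
  ultimately show ?thesis unfolding pcantor_def by blast
qed

text \<open>With \<open>B\<close> of diameter zero and the gap closed, collapsing \<open>B\<close>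
  to the base point \<open>a\<close> preserves all distances.\<close>

lemma realizes_join_left:
  assumes "realizes x A dA" "g = 0" "\<And>u v. u \<in> B \<Longrightarrow> v \<in> B \<Longrightarrow> dB u v = 0"
  shows "realizes x (A <+> B) J"
proof -
  have "case_sum (\<lambda>x. x) (\<lambda>_. a) ` (A <+> B) = A" using a b by (force simp: Plus_def image_Un image_image)
  from realizes_surj[OF assms(1) this] show ?thesis
    by (rule realizes_cong)
       (use assms(2,3) a b pseudometric_onD(1,2)[OF pm_A] in \<open>auto elim!: PlusE\<close>)
qed

lemma realizes_join_right:
  assumes "realizes x B dB" "g = 0" "\<And>u v. u \<in> A \<Longrightarrow> v \<in> A \<Longrightarrow> dA u v = 0"
  shows "realizes x (A <+> B) J"
proof -
  have "case_sum (\<lambda>_. b) (\<lambda>y. y) ` (A <+> B) = B" using a b by (force simp: Plus_def image_Un image_image)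
  from realizes_surj[OF assms(1) this] show ?thesis
    by (rule realizes_cong)
       (use assms(2,3) a b pseudometric_onD(1,2)[OF pm_B] in \<open>auto elim!: PlusE\<close>)
qed

end

text \<open>A distance of the join contains at most one distance of each part and one gap, so each
  error enters at most once.\<close>

lemma join_dist_diff_le:
  assumes "\<And>u v. u \<in> A \<Longrightarrow> v \<in> A \<Longrightarrow> \<bar>dA u v - dA' u v\<bar> \<le> eA"
    and "\<And>u v. u \<in> B \<Longrightarrow> v \<in> B \<Longrightarrow> \<bar>dB u v - dB' u v\<bar> \<le> eB"
    and "a \<in> A" "b \<in> B" "p \<in> A <+> B" "q \<in> A <+> B"
  shows "\<bar>join_dist dA a dB b g p q - join_dist dA' a dB' b g' p q\<bar> \<le> eA + eB + \<bar>g - g'\<bar>"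
proof -
  have nn: "0 \<le> eA" "0 \<le> eB"
    using order_trans[OF abs_ge_zero assms(1)[OF assms(3,3)]] order_trans[OF abs_ge_zero assms(2)[OF assms(4,4)]] .
  show ?thesis
  proof (cases p; cases q)
    fix x y assume "p = Inl x" "q = Inl y"
    then show ?thesis using assms(1)[of x y] assms(5,6) nn by simp
  next
    fix x y assume "p = Inl x" "q = Inr y"
    then show ?thesis using assms(1)[of x a] assms(2)[of b y] assms(3-6) nn by simp
  next
    fix x y assume "p = Inr x" "q = Inl y"
    then show ?thesis using assms(1)[of y a] assms(2)[of b x] assms(3-6) nn by simp
  next
    fix x y assume "p = Inr x" "q = Inr y"
    then show ?thesis using assms(2)[of x y] assms(5,6) nn by simp
  qed
qed

section \<open>Ultrametric sequence spaces\<close>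

definition seqs :: "(nat \<Rightarrow> nat) \<Rightarrow> (nat \<Rightarrow> nat) set" where
  "seqs k = {x. \<forall>n. x n < k n}"

text \<open>For decreasing \<open>r\<close> this is an ultrametric whose balls are cylinder
  sets.\<close>

definition udist :: "(nat \<Rightarrow> real) \<Rightarrow> (nat \<Rightarrow> nat) \<Rightarrow> (nat \<Rightarrow> nat) \<Rightarrow> real" where
  "udist r x y = (if x = y then 0 else r (LEAST n. x n \<noteq> y n))"

text \<open>Tychonoff for the finite digit sets, taken inside the real sequences, where compactness
  gives convergent subsequences. An integer coordinate that converges is eventually
  constant.\<close>

lemma seqs_convergent_subsequence:
  assumes "range \<sigma> \<subseteq> seqs k"
  obtains l \<rho> where "l \<in> seqs k" "strict_mono (\<rho> :: nat \<Rightarrow> nat)"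
    "\<forall>i. \<forall>\<^sub>F m in sequentially. \<sigma> (\<rho> m) i = l i"
proof -
  define S where "S = {x. \<forall>n. x n \<in> real ` {..<k n}}"
  have "S = PiE UNIV (\<lambda>n. real ` {..<k n})"
    by (auto simp: S_def PiE_def Pi_def)
  moreover have "compactin (product_topology (\<lambda>_. euclideanreal) UNIV) (PiE UNIV (\<lambda>n. real ` {..<k n}))"
    by (simp add: compactin_PiE finite_imp_compact)
  ultimately have "compact S"
    by (simp add: euclidean_product_topology)
  moreover have "\<forall>m. (\<lambda>i. real (\<sigma> m i)) \<in> S"
    using assms by (auto simp: S_def seqs_def)
  ultimately obtain l \<rho> where l: "l \<in> S" "strict_mono \<rho>" "((\<lambda>m i. real (\<sigma> m i)) \<circ> \<rho>) \<longlonglongrightarrow> l"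
    by (rule seq_compactE[OF compact_imp_seq_compact])
  have "\<forall>i. \<exists>t. t < k i \<and> l i = real t" using l(1) by (auto simp: S_def)
  then obtain t where t: "\<And>i. t i < k i" "\<And>i. l i = real (t i)" by metis
  have "\<forall>\<^sub>F m in sequentially. \<sigma> (\<rho> m) i = t i" for i
  proof -
    have "(\<lambda>m. real (\<sigma> (\<rho> m) i)) \<longlonglongrightarrow> real (t i)"
      using l(3) t(2) by (simp add: tendsto_fun_iff)
    then have "\<forall>\<^sub>F m in sequentially. dist (real (\<sigma> (\<rho> m) i)) (real (t i)) < 1"
      by (rule tendstoD) simp
    then show ?thesis by eventually_elim (auto simp: dist_real_def)
  qed
  moreover have "t \<in> seqs k" using t(1) by (simp add: seqs_def)
  ultimately show thesis using l(2) that by blast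
qed

text \<open>Halving makes the radii tend to zero and gains, in two steps, the factor 4 of
  \<open>separated_card_le\<close>.\<close>

locale scale_seq =
  fixes r :: "nat \<Rightarrow> real"
  assumes r_pos: "r n > 0" and r_half: "r (Suc n) \<le> r n / 2"
begin

lemma r_less: "r (Suc n) < r n"
  using r_pos[of n] r_half[of n] by linarith

lemma r_strict: "m < n \<Longrightarrow> r n < r m"
proof (induction n)
  case (Suc n)
  then show ?case using r_less[of n] by (cases "m = n") auto
qed simp

lemma r_mono: "m \<le> n \<Longrightarrow> r n \<le> r m"
  using r_strict le_eq_less_or_eq by fastforce

lemma r_less_iff: "r m < r n \<longleftrightarrow> n < m"
  using r_strict r_mono not_le by (metis not_less)

lemma r_le_iff: "r m \<le> r n \<longleftrightarrow> n \<le> m"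
  using r_less_iff[of n m] by (meson not_le)

lemma r_le_power: "r n \<le> r 0 / 2 ^ n"
proof (induction n)
  case (Suc n)
  have "r (Suc n) \<le> r n / 2" by (rule r_half)
  also have "\<dots> \<le> (r 0 / 2 ^ n) / 2" using Suc by simp
  finally show ?case by simp
qed simp

lemma r_tendsto_0: "r \<longlonglongrightarrow> 0"
proof (rule tendsto_sandwich[OF _ _ tendsto_const])
  have "(\<lambda>n. r 0 * (1 / 2) ^ n) \<longlonglongrightarrow> r 0 * 0"
    by (intro tendsto_intros LIMSEQ_power_zero) simp
  then show "(\<lambda>n. r 0 / 2 ^ n) \<longlonglongrightarrow> 0" by (simp add: power_divide)
  show "\<forall>\<^sub>F n in sequentially. 0 \<le> r n" using r_pos less_imp_le by (intro always_eventually) blast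
  show "\<forall>\<^sub>F n in sequentially. r n \<le> r 0 / 2 ^ n" using r_le_power by (intro always_eventually) blast
qed

lemma ex_r_less: "e > 0 \<Longrightarrow> \<exists>n. r n < e"
  using order_tendstoD(2)[OF r_tendsto_0] by (metis eventually_sequentially order_refl)

lemma udist_cases:
  obtains "x = y" "udist r x y = 0"
  | n where "udist r x y = r n" "x n \<noteq> y n" "\<And>i. i < n \<Longrightarrow> x i = y i"
proof (cases "x = y")
  case False
  then have "\<exists>n. x n \<noteq> y n" by auto
  then have 1: "x (LEAST n. x n \<noteq> y n) \<noteq> y (LEAST n. x n \<noteq> y n)" by (rule LeastI_ex)
  have 2: "x i = y i" if "i < (LEAST n. x n \<noteq> y n)" for i using not_less_Least[OF that] by simp
  show thesis by (rule that(2)[OF _ 1 2]) (simp_all add: udist_def False)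
qed (use that(1) in \<open>simp add: udist_def\<close>)

lemma udist_eq: 
  assumes "x n \<noteq> y n" "\<And>i. i < n \<Longrightarrow> x i = y i" shows "udist r x y = r n"
proof -
  have "(LEAST n. x n \<noteq> y n) = n"
    using assms by (intro Least_equality) (auto simp: not_less[symmetric])
  then show ?thesis using assms(1) by (auto simp: udist_def)
qed

lemma udist_le_iff: "udist r x y \<le> r n \<longleftrightarrow> (\<forall>i<n. x i = y i)"
proof (cases rule: udist_cases[of x y])
  case 1
  then show ?thesis using r_pos[of n] by (simp add: less_imp_le)
next
  case (2 m)
  have "n \<le> m \<longleftrightarrow> (\<forall>i<n. x i = y i)"
    using 2(2,3) by (meson leI less_le_trans)
  then show ?thesis by (simp add: 2(1) r_le_iff)
qed

lemma udist_less_iff: "udist r x y < r n \<longleftrightarrow> (\<forall>i\<le>n. x i = y i)"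
proof (cases rule: udist_cases[of x y])
  case 1
  then show ?thesis using r_pos[of n] by simp
next
  case (2 m)
  have "n < m \<longleftrightarrow> (\<forall>i\<le>n. x i = y i)"
    using 2(2,3) by (meson leI le_less_trans)
  then show ?thesis by (simp add: 2(1) r_less_iff)
qed

lemma udist_nonneg: "0 \<le> udist r x y"
  by (cases rule: udist_cases[of x y]) (use r_pos less_imp_le in auto)

lemma udist_commute: "udist r x y = udist r y x"
  by (simp add: udist_def eq_commute)

lemma udist_self [simp]: "udist r x x = 0"
  by (simp add: udist_def)

lemma udist_le_r0: "udist r x y \<le> r 0"
  by (simp add: udist_le_iff)

lemma udist_ultra: "udist r x z \<le> max (udist r x y) (udist r y z)"
proof (cases rule: udist_cases[of x z])
  case 1
  then show ?thesis using udist_nonneg[of x y] by simp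
next
  case (2 n)
  have "\<not> (udist r x y < r n \<and> udist r y z < r n)"
    using 2(2) by (auto simp: udist_less_iff)
  then show ?thesis using 2(1) by (auto simp: le_max_iff_disj not_less)
qed

lemma pseudometric_on_udist: "pseudometric_on M (udist r)"
  unfolding pseudometric_on_def
proof (intro conjI ballI)
  show "udist r x z \<le> udist r x y + udist r y z" for x y z
    using udist_ultra[of x z y] udist_nonneg[of x y] udist_nonneg[of y z] by simp
qed (auto simp: udist_commute)

lemma pcompact_udist:
  assumes "\<And>n. k n > 0" shows "pcompact (seqs k) (udist r)"
  unfolding pcompact_def
proof (intro conjI allI impI)
  show "seqs k \<noteq> {}" using assms by (auto simp: seqs_def intro: exI[of _ "\<lambda>_. 0"])
  fix \<sigma> :: "nat \<Rightarrow> nat \<Rightarrow> nat" assume "range \<sigma> \<subseteq> seqs k"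
  then obtain l \<rho> where l: "l \<in> seqs k" "strict_mono \<rho>"
    and ev: "\<forall>i. \<forall>\<^sub>F m in sequentially. \<sigma> (\<rho> m) i = l i"
    by (rule seqs_convergent_subsequence)
  have "(\<lambda>m. udist r (\<sigma> (\<rho> m)) l) \<longlonglongrightarrow> 0"
  proof (rule order_tendstoI)
    show "\<forall>\<^sub>F m in sequentially. a < udist r (\<sigma> (\<rho> m)) l" if "a < 0" for a
      using that udist_nonneg by (intro always_eventually) (metis less_le_trans)
    show "\<forall>\<^sub>F m in sequentially. udist r (\<sigma> (\<rho> m)) l < e" if e: "0 < e" for e
    proof -
      obtain n where n: "r n < e" using ex_r_less e by blast
      have "\<forall>\<^sub>F m in sequentially. \<forall>i\<in>{..n}. \<sigma> (\<rho> m) i = l i"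
        by (rule eventually_ball_finite) (use ev in auto)
      then show ?thesis
      proof (rule eventually_mono)
        fix m assume "\<forall>i\<in>{..n}. \<sigma> (\<rho> m) i = l i"
        then have "udist r (\<sigma> (\<rho> m)) l < r n" by (simp add: udist_less_iff)
        then show "udist r (\<sigma> (\<rho> m)) l < e" using n by simp
      qed
    qed
  qed
  then show "\<exists>l\<in>seqs k. \<exists>\<rho>. strict_mono \<rho> \<and> (\<lambda>n. udist r (\<sigma> (\<rho> n)) l) \<longlonglongrightarrow> 0"
    using l(1,2) by blast
qed (rule pseudometric_on_udist)

text \<open>Let \<open>n\<close> be the first index with \<open>r n \<le> \<rho>\<close>. Points
  within \<open>\<rho>\<close> agree before \<open>n\<close>; if they also agree at \<open>n\<close>
  and \<open>n + 1\<close>, their distance is at most \<open>r (n + 2) \<le> \<rho> / 4\<close>. So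
  two digits tell the points of a separated set apart.\<close>

lemma pdoubling_udist:
  assumes "\<And>n. k n \<le> K" shows "pdoubling (seqs k) (udist r)"
proof (rule pdoublingI)
  fix \<rho> F assume F: "(\<rho>::real) > 0" "finite F" "F \<subseteq> seqs k"
    and le: "\<And>x y. x \<in> F \<Longrightarrow> y \<in> F \<Longrightarrow> udist r x y \<le> \<rho>"
    and gt: "\<And>x y. x \<in> F \<Longrightarrow> y \<in> F \<Longrightarrow> x \<noteq> y \<Longrightarrow> \<rho> / 4 < udist r x y"
  define n where "n = (LEAST n. r n \<le> \<rho>)"
  have "\<exists>n. r n \<le> \<rho>" using ex_r_less[OF F(1)] less_imp_le by blast
  then have n: "r n \<le> \<rho>" unfolding n_def by (rule LeastI_ex)
  have n_le: "n \<le> m" if "r m \<le> \<rho>" for m unfolding n_def using that by (rule Least_le)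
  have "inj_on (\<lambda>x. (x n, x (Suc n))) F"
  proof (rule inj_onI, rule ccontr)
    fix x y assume xy: "x \<in> F" "y \<in> F" "(x n, x (Suc n)) = (y n, y (Suc n))" "x \<noteq> y"
    obtain m where m: "udist r x y = r m" "x m \<noteq> y m"
      using xy(4) by (cases rule: udist_cases[of x y]) auto
    have "n \<le> m" using le[OF xy(1,2)] m(1) n_le by simp
    then have "Suc (Suc n) \<le> m" using xy(3) m(2) by (metis Pair_inject Suc_leI le_neq_implies_less)
    then have "udist r x y \<le> r (Suc (Suc n))" using m(1) r_mono by simp
    also have "\<dots> \<le> \<rho> / 4" using r_half[of "Suc n"] r_half[of n] n by linarith
    finally show False using gt[OF xy(1,2,4)] by simp
  qed
  moreover have "(\<lambda>x. (x n, x (Suc n))) ` F \<subseteq> {..<K} \<times> {..<K}"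
  proof
    fix p assume "p \<in> (\<lambda>x. (x n, x (Suc n))) ` F"
    then obtain x where "x \<in> seqs k" "p = (x n, x (Suc n))" using F(3) by blast
    then show "p \<in> {..<K} \<times> {..<K}"
      using assms[of n] assms[of "Suc n"] by (auto simp: seqs_def intro: less_le_trans)
  qed
  ultimately have "card F \<le> card ({..<K} \<times> {..<K})"
    by (intro card_inj_on_le) auto
  then show "card F \<le> K * K" by simp
qed

text \<open>At index \<open>N\<close> there are \<open>N + 2\<close> digits, and sequences that
  differ only there are at mutual distance \<open>r N\<close>.\<close>

lemma not_pdoubling_udist: "\<not> pdoubling (seqs (\<lambda>n. n + 2)) (udist r)"
proof
  assume "pdoubling (seqs (\<lambda>n. n + 2)) (udist r)"
  then obtain N where N: "separated_card_le N (seqs (\<lambda>n. n + 2)) (udist r)"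
    by (auto simp: pdoubling_def)
  define h where "h j = (\<lambda>i. if i = N then j else 0)" for j :: nat
  have h: "udist r (h i) (h j) = r N" if "i \<noteq> j" for i j
    by (rule udist_eq) (use that in \<open>auto simp: h_def\<close>)
  have "card (h ` {..<N + 2}) \<le> N"
  proof (rule separated_card_leD[OF N, of "r N"])
    show "h ` {..<N + 2} \<subseteq> seqs (\<lambda>n. n + 2)" by (auto simp: h_def seqs_def)
    show "udist r x y \<le> r N" if xy: "x \<in> h ` {..<N + 2}" "y \<in> h ` {..<N + 2}" for x y
    proof -
      obtain i j where "x = h i" "y = h j" using xy by blast
      then show ?thesis using h[of i j] r_pos[of N] by (cases "i = j") auto
    qed
    show "r N / 4 < udist r x y" if "x \<in> h ` {..<N + 2}" "y \<in> h ` {..<N + 2}" "x \<noteq> y" for x y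
    proof -
      obtain i j where "x = h i" "y = h j" "i \<noteq> j" using \<open>x \<in> _\<close> \<open>y \<in> _\<close> \<open>x \<noteq> y\<close> by blast
      then show ?thesis using h[of i j] r_pos[of N] by simp
    qed
  qed (use r_pos in auto)
  moreover have "inj h" by (rule injI) (metis h_def)
  ultimately show False by (simp add: card_image inj_on_subset)
qed

lemma punif_disconnected_udist: "punif_disconnected M (udist r)"
  unfolding punif_disconnected_def
proof (intro exI[of _ 1] conjI allI impI, simp, elim conjE)
  fix n and z :: "nat \<Rightarrow> nat \<Rightarrow> nat" and e :: real
  assume e: "0 \<le> e" "\<forall>i<n. udist r (z i) (z (Suc i)) \<le> e"
  have "udist r (z 0) (z m) \<le> e" if "m \<le> n" for m
    using that
  proof (induction m)
    case (Suc m)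
    then have "udist r (z 0) (z m) \<le> e" "udist r (z m) (z (Suc m)) \<le> e" using e(2) by auto
    then show ?case using udist_ultra[of "z 0" "z (Suc m)" "z m"] by linarith
  qed (simp add: e)
  then show "1 * udist r (z 0) (z n) \<le> e" by simp
qed

text \<open>Changing the digit at the first index \<open>n\<close> with
  \<open>r n \<le> \<rho>\<close> moves a point by exactly \<open>r n\<close>, which is at least
  \<open>c * \<rho>\<close> because \<open>\<rho> < r (n - 1)\<close>.\<close>

lemma punif_perfect_udist:
  assumes k: "\<And>n. k n \<ge> 2" and c: "c > 0" "\<And>n. c * r n \<le> r (Suc n)"
  shows "punif_perfect (seqs k) (udist r)"
  unfolding punif_perfect_def
proof (intro exI[of _ c] conjI ballI allI impI c)
  fix x u v and \<rho> :: real assume x: "x \<in> seqs k" and \<rho>: "0 < \<rho>" "\<rho> < udist r u v"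
  define n where "n = (LEAST n. r n \<le> \<rho>)"
  have "\<exists>n. r n \<le> \<rho>" using ex_r_less[OF \<rho>(1)] less_imp_le by blast
  then have n: "r n \<le> \<rho>" unfolding n_def by (rule LeastI_ex)
  \<comment> \<open>No distance exceeds \<open>r 0\<close>, and \<open>\<rho>\<close> is strictly
    below a distance; so \<open>n\<close> has a predecessor.\<close>
  have "n \<noteq> 0" using n \<rho>(2) udist_le_r0[of u v] by (intro notI) simp
  then obtain m where m: "n = Suc m" by (cases n) auto
  have "\<rho> < r m" using not_less_Least[of m "\<lambda>n. r n \<le> \<rho>"] m by (simp add: n_def)
  define y where "y = x(n := (if x n = 0 then 1 else 0))"
  have "1 < k n" "0 < k n" using k[of n] by linarith+
  then have "y \<in> seqs k" using x by (auto simp: seqs_def y_def)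
  moreover have d: "udist r x y = r n" by (rule udist_eq) (auto simp: y_def)
  moreover have "c * \<rho> \<le> c * r m" using \<open>\<rho> < r m\<close> c(1) by simp
  ultimately show "\<exists>y\<in>seqs k. c * \<rho> \<le> udist r x y \<and> udist r x y \<le> \<rho>"
    using n c(2)[of m] m by (intro bexI[of _ y]) auto
qed

section \<open>Binary sequences as ternary expansions with digits 0 and 2\<close>

definition cantor_code :: "(nat \<Rightarrow> nat) \<Rightarrow> real" where
  "cantor_code x = (\<Sum>n. 2 * real (x n) / 3 ^ Suc n)"

lemma cantor_code_summable: "x \<in> seqs (\<lambda>_. 2) \<Longrightarrow> summable (\<lambda>n. 2 * real (x n) / 3 ^ Suc n)"
proof (rule summable_comparison_test'[of "\<lambda>n. 2 / 3 * (1 / 3) ^ n" 0])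
  show "summable (\<lambda>n. 2 / 3 * (1 / 3 :: real) ^ n)" by (intro summable_mult summable_geometric) simp
  show "norm (2 * real (x n) / 3 ^ Suc n) \<le> 2 / 3 * (1 / 3) ^ n" if "x \<in> seqs (\<lambda>_. 2)" for n
  proof -
    have "real (x n) \<le> 1" using that by (simp add: seqs_def less_2_cases_iff) (metis One_nat_def le_numeral_extra(3,4) less_2_cases_iff of_nat_0 of_nat_1 zero_le_one)
    then show ?thesis by (simp add: power_divide divide_simps)
  qed
qed

lemma cantor_code_Suc:
  assumes "x \<in> seqs (\<lambda>_. 2)"
  shows "cantor_code x = (cantor_code (\<lambda>n. x (Suc n)) + 2 * real (x 0)) / 3"
proof -
  have sh: "(\<lambda>n. x (Suc n)) \<in> seqs (\<lambda>_. 2)" using assms by (simp add: seqs_def)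
  have "cantor_code x = 2 * real (x 0) / 3 + (\<Sum>n. 2 * real (x (Suc n)) / 3 ^ Suc (Suc n))"
    unfolding cantor_code_def using suminf_split_head[OF cantor_code_summable[OF assms]] by simp
  also have "(\<Sum>n. 2 * real (x (Suc n)) / 3 ^ Suc (Suc n)) = (\<Sum>n. (2 * real (x (Suc n)) / 3 ^ Suc n) / 3)"
    by (simp add: mult.commute)
  also have "\<dots> = cantor_code (\<lambda>n. x (Suc n)) / 3"
    unfolding cantor_code_def by (rule suminf_divide[OF cantor_code_summable[OF sh]])
  finally show ?thesis by (simp add: add_divide_distrib)
qed

lemma cantor_code_in:
  assumes "x \<in> seqs (\<lambda>_. 2)" shows "cantor_code x \<in> (cantor_step ^^ n) {0..1}"
  using assms
proof (induction n arbitrary: x)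
  case 0
  have le: "2 * real (x n) / 3 ^ Suc n \<le> 2 / 3 * (1 / 3) ^ n" for n
  proof -
    have "x n \<le> 1" using 0 by (simp add: seqs_def less_Suc_eq_le[symmetric] numeral_2_eq_2)
    then show ?thesis by (simp add: power_divide divide_simps)
  qed
  have s: "summable (\<lambda>n. 2 / 3 * (1 / 3 :: real) ^ n)" by (intro summable_mult summable_geometric) simp
  have "cantor_code x \<le> (\<Sum>n. 2 / 3 * (1 / 3) ^ n)"
    unfolding cantor_code_def by (rule suminf_le[OF le cantor_code_summable[OF 0] s])
  also have "\<dots> = 1" by (subst suminf_mult) (auto simp: suminf_geometric intro: summable_geometric)
  finally have "cantor_code x \<le> 1" .
  moreover have "0 \<le> cantor_code x"
    unfolding cantor_code_def by (rule suminf_nonneg[OF cantor_code_summable[OF 0]]) simp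
  ultimately show ?case by simp
next
  case (Suc n)
  have sh: "(\<lambda>n. x (Suc n)) \<in> seqs (\<lambda>_. 2)" using Suc.prems by (simp add: seqs_def)
  have "x 0 = 0 \<or> x 0 = 1" using Suc.prems by (auto simp: seqs_def less_2_cases_iff)
  then show ?case
    using Suc.IH[OF sh] cantor_code_Suc[OF Suc.prems] by (auto simp: cantor_step_def)
qed

lemma cantor_code_in_cantor_set: "x \<in> seqs (\<lambda>_. 2) \<Longrightarrow> cantor_code x \<in> cantor_set"
  by (simp add: cantor_set_eq cantor_code_in)

lemma cantor_code_range: "x \<in> seqs (\<lambda>_. 2) \<Longrightarrow> 0 \<le> cantor_code x \<and> cantor_code x \<le> 1"
  using cantor_code_in[of x 0] by simp

lemma abs_third_le:
  fixes X Y :: real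
  assumes "X = Y / 3" "\<bar>Y\<bar> \<le> 1 / 3 ^ n" shows "\<bar>X\<bar> \<le> 1 / 3 ^ Suc n"
proof -
  have "\<bar>X\<bar> = \<bar>Y\<bar> / 3" using assms(1) by simp
  also have "\<dots> \<le> 1 / 3 ^ n / 3" using assms(2) by (intro divide_right_mono) auto
  finally show ?thesis by (simp add: mult.commute)
qed

lemma cantor_code_close:
  assumes "x \<in> seqs (\<lambda>_. 2)" "y \<in> seqs (\<lambda>_. 2)" "\<And>i. i < n \<Longrightarrow> x i = y i"
  shows "\<bar>cantor_code x - cantor_code y\<bar> \<le> 1 / 3 ^ n"
  using assms
proof (induction n arbitrary: x y)
  case 0
  then show ?case using cantor_code_range[of x] cantor_code_range[of y] by (simp add: abs_le_iff)
next
  case (Suc n)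
  have sh: "(\<lambda>n. x (Suc n)) \<in> seqs (\<lambda>_. 2)" "(\<lambda>n. y (Suc n)) \<in> seqs (\<lambda>_. 2)"
    using Suc.prems by (simp_all add: seqs_def)
  have "\<bar>cantor_code (\<lambda>n. x (Suc n)) - cantor_code (\<lambda>n. y (Suc n))\<bar> \<le> 1 / 3 ^ n"
    by (rule Suc.IH[OF sh]) (simp add: Suc.prems(3))
  moreover have "cantor_code x - cantor_code y =
      (cantor_code (\<lambda>n. x (Suc n)) - cantor_code (\<lambda>n. y (Suc n))) / 3"
    using cantor_code_Suc[OF Suc.prems(1)] cantor_code_Suc[OF Suc.prems(2)] Suc.prems(3)[of 0]
    by (simp add: field_simps)
  ultimately show ?case by (metis abs_third_le)
qed

text \<open>Codes of tails lie in \<open>[0, 1]\<close>, so they cannot compensate for a difference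
  of 2 in the leading ternary digit.\<close>

lemma cantor_code_inj:
  assumes "x \<in> seqs (\<lambda>_. 2)" "y \<in> seqs (\<lambda>_. 2)" "cantor_code x = cantor_code y"
  shows "x n = y n"
  using assms
proof (induction n arbitrary: x y)
  case 0
  have sh: "(\<lambda>n. x (Suc n)) \<in> seqs (\<lambda>_. 2)" "(\<lambda>n. y (Suc n)) \<in> seqs (\<lambda>_. 2)"
    using 0 by (simp_all add: seqs_def)
  have "x 0 < 2" "y 0 < 2" using 0 by (simp_all add: seqs_def)
  then show ?case
    using cantor_code_Suc[OF 0(1)] cantor_code_Suc[OF 0(2)] 0(3) cantor_code_range[OF sh(1)] cantor_code_range[OF sh(2)]
    by (auto simp: less_2_cases_iff)
next
  case (Suc n)
  have sh: "(\<lambda>n. x (Suc n)) \<in> seqs (\<lambda>_. 2)" "(\<lambda>n. y (Suc n)) \<in> seqs (\<lambda>_. 2)"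
    using Suc.prems by (simp_all add: seqs_def)
  have "x 0 < 2" "y 0 < 2" using Suc.prems by (simp_all add: seqs_def)
  then have "cantor_code (\<lambda>n. x (Suc n)) = cantor_code (\<lambda>n. y (Suc n))"
    using cantor_code_Suc[OF Suc.prems(1)] cantor_code_Suc[OF Suc.prems(2)] Suc.prems(3)
      cantor_code_range[OF sh(1)] cantor_code_range[OF sh(2)]
    by (auto simp: less_2_cases_iff)
  from Suc.IH[OF sh this] show ?case .
qed

text \<open>Self-similarity assigns to \<open>c\<close> a digit \<open>b c\<close> and a rest
  \<open>T c\<close>, and iterating \<open>T\<close> produces the sequence. Codes of tails and
  iterated rests obey the same recursion, so their difference at \<open>m\<close> is a third of that
  at \<open>m + 1\<close>; being bounded by 1 everywhere, it vanishes.\<close>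

lemma cantor_code_surj:
  assumes "c \<in> cantor_set" obtains x where "x \<in> seqs (\<lambda>_. 2)" "cantor_code x = c"
proof -
  have "\<forall>c. \<exists>b c'. c \<in> cantor_set \<longrightarrow> b < (2::nat) \<and> c' \<in> cantor_set \<and> c = (c' + 2 * real b) / 3"
  proof
    fix c
    show "\<exists>b c'. c \<in> cantor_set \<longrightarrow> b < (2::nat) \<and> c' \<in> cantor_set \<and> c = (c' + 2 * real b) / 3"
    proof (cases "c \<in> cantor_set")
      case True
      then consider c' where "c' \<in> cantor_set" "c = c' / 3" | c' where "c' \<in> cantor_set" "c = (c' + 2) / 3"
        using cantor_set_self_similar by blast
      then show ?thesis
      proof cases
        case (1 c')
        then show ?thesis by (intro exI[of _ 0] exI[of _ c']) simp
      next
        case (2 c')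
        then show ?thesis by (intro exI[of _ 1] exI[of _ c']) simp
      qed
    qed simp
  qed
  then obtain b T where bT: "\<And>c. c \<in> cantor_set \<Longrightarrow> b c < (2::nat) \<and> T c \<in> cantor_set \<and> c = (T c + 2 * real (b c)) / 3"
    unfolding choice_iff by blast
  define x where "x n = b ((T ^^ n) c)" for n
  have Tn: "(T ^^ n) c \<in> cantor_set" for n
    by (induction n) (use assms bT in auto)
  have x: "(\<lambda>i. x (i + n)) \<in> seqs (\<lambda>_. 2)" for n
    using bT[OF Tn] by (auto simp: seqs_def x_def)
  have "\<bar>cantor_code (\<lambda>i. x (i + m)) - (T ^^ m) c\<bar> \<le> 1 / 3 ^ n" for n m
  proof (induction n arbitrary: m)
    case 0
    have "0 \<le> (T ^^ m) c \<and> (T ^^ m) c \<le> 1"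
      using Tn[of m] by (auto simp: cantor_set_def dest!: spec[of _ "0::nat"])
    then show ?case using cantor_code_range[OF x[of m]] by (simp add: abs_le_iff)
  next
    case (Suc n)
    have "cantor_code (\<lambda>i. x (i + m)) - (T ^^ m) c = (cantor_code (\<lambda>i. x (i + Suc m)) - (T ^^ Suc m) c) / 3"
      using cantor_code_Suc[OF x[of m]] bT[OF Tn[of m]] by (simp add: x_def field_simps)
    then show ?case using Suc.IH[of "Suc m"] by (metis abs_third_le)
  qed
  from this[of 0] have "\<bar>cantor_code x - c\<bar> \<le> 1 / 3 ^ n" for n by simp
  moreover have "(\<lambda>n. 1 / 3 ^ n :: real) \<longlonglongrightarrow> 0"
    using LIMSEQ_power_zero[of "1 / 3 :: real"] by (simp add: power_divide)
  ultimately have "\<bar>cantor_code x - c\<bar> \<le> 0" by (intro LIMSEQ_le_const) auto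
  then show thesis using x[of 0] that by simp
qed

lemma pcantor_udist: "pcantor (seqs (\<lambda>_. 2)) (udist r)"
  unfolding pcantor_def
proof (intro exI[of _ cantor_code] conjI ballI allI impI)
  show "bij_betw cantor_code (seqs (\<lambda>_. 2)) cantor_set"
    unfolding bij_betw_def
  proof
    show "inj_on cantor_code (seqs (\<lambda>_. 2))" by (intro inj_onI ext) (rule cantor_code_inj)
    show "cantor_code ` seqs (\<lambda>_. 2) = cantor_set"
      using cantor_code_in_cantor_set cantor_code_surj by blast
  qed
  fix x and e :: real assume x: "x \<in> seqs (\<lambda>_. 2)" and "e > 0"
  have "(\<lambda>n. 1 / 3 ^ n :: real) \<longlonglongrightarrow> 0"
    using LIMSEQ_power_zero[of "1 / 3 :: real"] by (simp add: power_divide)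
  then obtain n where n: "1 / 3 ^ n < e"
    using order_tendstoD(2)[OF _ \<open>e > 0\<close>] by (metis (mono_tags, lifting) eventually_sequentially order_refl)
  have "\<bar>cantor_code x - cantor_code y\<bar> < e" if "y \<in> seqs (\<lambda>_. 2)" "udist r x y < r n" for y
    using cantor_code_close[OF x that(1), of n] that(2) n by (force simp: udist_less_iff)
  then show "\<exists>\<delta>>0. \<forall>y\<in>seqs (\<lambda>_. 2). udist r x y < \<delta> \<longrightarrow> \<bar>cantor_code x - cantor_code y\<bar> < e"
    using r_pos[of n] by blast
qed

end

section \<open>Recovering the distances between diametral points\<close>

text \<open>The points \<open>p\<close> and \<open>q\<close> count if both attain the diameter
  together with one and the same point \<open>w\<close>. In a chain with diametral clusters at its
  two ends, this selects the distances within these clusters.\<close>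

definition far_dists :: "'a set \<Rightarrow> ('a \<Rightarrow> 'a \<Rightarrow> real) \<Rightarrow> real set" where
  "far_dists M d = {t. \<exists>p\<in>M. \<exists>q\<in>M. \<exists>w\<in>M. t = d p q \<and> (\<forall>u\<in>M. \<forall>v\<in>M. d u v \<le> d p w) \<and> d q w = d p w}"

lemma far_dists_surj:
  assumes "\<phi> ` M = N" "\<And>m m'. m \<in> M \<Longrightarrow> m' \<in> M \<Longrightarrow> dN (\<phi> m) (\<phi> m') = d m m'"
  shows "far_dists N dN = far_dists M d"
  unfolding far_dists_def assms(1)[symmetric] by (simp add: assms(2))

lemma far_dists_realizes:
  assumes "realizes x M d" "realizes x N dN" shows "far_dists M d = far_dists N dN"
proof -
  obtain X where X: "nonempty_compact X" "x = isometry_class X" by (rule ex_isometry_class)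
  obtain \<phi> where "\<phi> ` M = mspace X" "\<And>m m'. m \<in> M \<Longrightarrow> m' \<in> M \<Longrightarrow> mdist X (\<phi> m) (\<phi> m') = d m m'"
    using realizes_onto[OF assms(1) X] by blast
  moreover obtain \<psi> where "\<psi> ` N = mspace X" "\<And>m m'. m \<in> N \<Longrightarrow> m' \<in> N \<Longrightarrow> mdist X (\<psi> m) (\<psi> m') = dN m m'"
    using realizes_onto[OF assms(2) X] by blast
  ultimately show ?thesis
    using far_dists_surj[of \<phi> M "mspace X" "mdist X" d] far_dists_surj[of \<psi> N "mspace X" "mdist X" dN] by simp
qed

context pointed_join
begin

text \<open>\<open>eA\<close> and \<open>eB\<close> bound the distances to the base points as well
  as those within the parts. Both are positive, so the total can only be reached across the
  gap.\<close>

lemma join_le_diameter: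
  assumes A: "\<And>x. x \<in> A \<Longrightarrow> dA x a \<le> eA" "\<And>x y. x \<in> A \<Longrightarrow> y \<in> A \<Longrightarrow> dA x y \<le> eA" "eA > 0"
    and B: "\<And>y. y \<in> B \<Longrightarrow> dB b y \<le> eB" "\<And>x y. x \<in> B \<Longrightarrow> y \<in> B \<Longrightarrow> dB x y \<le> eB" "eB > 0"
    and pq: "p \<in> A <+> B" "q \<in> A <+> B"
  shows "J p q \<le> eA + g + eB"
    and "J p q = eA + g + eB \<longleftrightarrow>
      (\<exists>x\<in>A. \<exists>y\<in>B. dA x a = eA \<and> dB b y = eB \<and> (p = Inl x \<and> q = Inr y \<or> p = Inr y \<and> q = Inl x))"
proof -
  have "J p q \<le> eA + g + eB \<and> (J p q = eA + g + eB \<longleftrightarrow>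
      (\<exists>x\<in>A. \<exists>y\<in>B. dA x a = eA \<and> dB b y = eB \<and> (p = Inl x \<and> q = Inr y \<or> p = Inr y \<and> q = Inl x)))"
  proof (cases p; cases q)
    fix x y assume s: "p = Inl x" "q = Inl y"
    then show ?thesis using A(2)[of x y] B(3) g pq by simp
  next
    fix x y assume s: "p = Inr x" "q = Inr y"
    then show ?thesis using B(2)[of x y] A(3) g pq by simp
  next
    fix x y assume s: "p = Inl x" "q = Inr y"
    then have "dA x a \<le> eA" "dB b y \<le> eB" using A(1) B(1) pq by auto
    then show ?thesis using s pq by auto
  next
    fix x y assume s: "p = Inr y" "q = Inl x"
    then have "dA x a \<le> eA" "dB b y \<le> eB" using A(1) B(1) pq by auto
    then show ?thesis using s pq by auto
  qed
  then show "J p q \<le> eA + g + eB"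
    and "J p q = eA + g + eB \<longleftrightarrow>
      (\<exists>x\<in>A. \<exists>y\<in>B. dA x a = eA \<and> dB b y = eB \<and> (p = Inl x \<and> q = Inr y \<or> p = Inr y \<and> q = Inl x))"
    by blast+
qed

text \<open>A diametral pair has one point on each side, so two points with a common diametral
  partner lie on the same side, at maximal distance from its base point.\<close>

lemma far_dists_join:
  assumes A: "\<And>x. x \<in> A \<Longrightarrow> dA x a \<le> eA" "\<And>x y. x \<in> A \<Longrightarrow> y \<in> A \<Longrightarrow> dA x y \<le> eA" "eA > 0"
    and B: "\<And>y. y \<in> B \<Longrightarrow> dB b y \<le> eB" "\<And>x y. x \<in> B \<Longrightarrow> y \<in> B \<Longrightarrow> dB x y \<le> eB" "eB > 0"
    and neA: "\<exists>x\<in>A. dA x a = eA" and neB: "\<exists>y\<in>B. dB b y = eB"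
  shows "far_dists (A <+> B) J = {dA x x' | x x'. x \<in> A \<and> x' \<in> A \<and> dA x a = eA \<and> dA x' a = eA} \<union>
     {dB y y' | y y'. y \<in> B \<and> y' \<in> B \<and> dB b y = eB \<and> dB b y' = eB}" (is "_ = ?FA \<union> ?FB")
proof -
  have le: "J p q \<le> eA + g + eB"
    and eq: "J p q = eA + g + eB \<longleftrightarrow>
      (\<exists>x\<in>A. \<exists>y\<in>B. dA x a = eA \<and> dB b y = eB \<and> (p = Inl x \<and> q = Inr y \<or> p = Inr y \<and> q = Inl x))"
    if "p \<in> A <+> B" "q \<in> A <+> B" for p q
    by (rule join_le_diameter; use A B that in blast)+
  obtain x0 where x0: "x0 \<in> A" "dA x0 a = eA" using neA by blast
  obtain y0 where y0: "y0 \<in> B" "dB b y0 = eB" using neB by blast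
  have max: "(\<forall>u\<in>A <+> B. \<forall>v\<in>A <+> B. J u v \<le> J p w) \<longleftrightarrow> J p w = eA + g + eB"
    if pw: "p \<in> A <+> B" "w \<in> A <+> B" for p w
  proof
    assume "\<forall>u\<in>A <+> B. \<forall>v\<in>A <+> B. J u v \<le> J p w"
    then have "J (Inl x0) (Inr y0) \<le> J p w" using x0 y0 by blast
    then show "J p w = eA + g + eB" using le[OF pw] x0 y0 by simp
  qed (use le in auto)
  show ?thesis
  proof
    show "far_dists (A <+> B) J \<subseteq> ?FA \<union> ?FB"
    proof
      fix t assume "t \<in> far_dists (A <+> B) J"
      then obtain p q w where mem: "p \<in> A <+> B" "q \<in> A <+> B" "w \<in> A <+> B" and t: "t = J p q"
        and "\<forall>u\<in>A <+> B. \<forall>v\<in>A <+> B. J u v \<le> J p w" "J q w = J p w"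
        unfolding far_dists_def by blast
      then have e: "J p w = eA + g + eB" "J q w = eA + g + eB" using max by simp_all
      obtain x y where xy: "x \<in> A" "y \<in> B" "dA x a = eA" "dB b y = eB" "p = Inl x \<and> w = Inr y \<or> p = Inr y \<and> w = Inl x"
        using e(1) eq[OF mem(1,3)] by blast
      obtain x' y' where xy': "x' \<in> A" "y' \<in> B" "dA x' a = eA" "dB b y' = eB" "q = Inl x' \<and> w = Inr y' \<or> q = Inr y' \<and> w = Inl x'"
        using e(2) eq[OF mem(2,3)] by blast
      have "p = Inl x \<and> q = Inl x' \<or> p = Inr y \<and> q = Inr y'" using xy(5) xy'(5) by auto
      then show "t \<in> ?FA \<union> ?FB"
      proof
        assume "p = Inl x \<and> q = Inl x'"
        then have "t = dA x x'" using t by simp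
        then show ?thesis using xy xy' by blast
      next
        assume "p = Inr y \<and> q = Inr y'"
        then have "t = dB y y'" using t by simp
        then show ?thesis using xy xy' by blast
      qed
    qed
    have "?FA \<subseteq> far_dists (A <+> B) J"
    proof
      fix t assume "t \<in> ?FA"
      then obtain x x' where x: "t = dA x x'" "x \<in> A" "x' \<in> A" "dA x a = eA" "dA x' a = eA" by blast
      have "J (Inl x) (Inr y0) = eA + g + eB" "J (Inl x') (Inr y0) = eA + g + eB" using x y0 by auto
      then show "t \<in> far_dists (A <+> B) J"
        unfolding far_dists_def mem_Collect_eq using x y0 max[of "Inl x" "Inr y0"]
        by (intro bexI[of _ "Inl x"] bexI[of _ "Inl x'"] bexI[of _ "Inr y0"] conjI) auto
    qed
    moreover have "?FB \<subseteq> far_dists (A <+> B) J"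
    proof
      fix t assume "t \<in> ?FB"
      then obtain y y' where y: "t = dB y y'" "y \<in> B" "y' \<in> B" "dB b y = eB" "dB b y' = eB" by blast
      have "J (Inr y) (Inl x0) = eA + g + eB" "J (Inr y') (Inl x0) = eA + g + eB" using y x0 by auto
      then show "t \<in> far_dists (A <+> B) J"
        unfolding far_dists_def mem_Collect_eq using y x0 max[of "Inr y" "Inl x0"]
        by (intro bexI[of _ "Inr y"] bexI[of _ "Inr y'"] bexI[of _ "Inl x0"] conjI) auto
    qed
    ultimately show "?FA \<union> ?FB \<subseteq> far_dists (A <+> B) J" by blast
  qed
qed

end

section \<open>The interpolating spaces\<close>

abbreviation binary :: "(nat \<Rightarrow> nat) set" where
  "binary \<equiv> seqs (\<lambda>_. 2)"

text \<open>The gap is proportional to \<open>h\<close>, so it closes together with the Cantor set.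
  With \<open>\<kappa> = 0\<close> uniform perfectness survives; a positive \<open>\<kappa>\<close>
  separates the pieces, as gluing Cantor sets demands.\<close>

definition half_dist where
  "half_dist \<kappa> h r s d a = join_dist (\<lambda>x y. h * udist r x y) (\<lambda>_. 0) (\<lambda>x y. s * d x y) a (\<kappa> * h)"

text \<open>The halves meet at \<open>b\<close> and \<open>e\<close>, diametral to the points
  \<open>a\<close> and \<open>c\<close> that carry the Cantor sets; this pushes the Cantor sets to
  the far ends.\<close>

definition full_dist where
  "full_dist \<kappa> h r s dX a b s' dY c e =
     join_dist (half_dist \<kappa> h r s dX a) (Inr b) (half_dist \<kappa> h r s' dY c) (Inr e) (\<kappa> * h)"

lemma zero_in_binary: "(\<lambda>_. 0) \<in> binary" and one_in_binary: "(\<lambda>_. 1) \<in> binary"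
  by (simp_all add: seqs_def)

locale half_space = scale_seq r for r +
  fixes X :: "'a set" and dX and a b and \<kappa> h s :: real
  assumes cX: "pcompact X dX" and aX: "a \<in> X" and bX: "b \<in> X"
    and diam: "\<And>x y. x \<in> X \<Longrightarrow> y \<in> X \<Longrightarrow> dX x y \<le> dX a b"
    and \<kappa>: "\<kappa> \<ge> 0" and h: "h \<ge> 0" and s: "s \<ge> 0"
begin

abbreviation "HS \<equiv> binary <+> X"
abbreviation "HD \<equiv> half_dist \<kappa> h r s dX a"

lemma pmX: "pseudometric_on X dX"
  using cX by (simp add: pcompact_def)

lemma cK: "pcompact binary (\<lambda>x y. h * udist r x y)"
  by (rule pcompact_scale[OF pcompact_udist h]) simp

sublocale pointed_join binary "\<lambda>x y. h * udist r x y" "\<lambda>_. 0" X "\<lambda>x y. s * dX x y" a "\<kappa> * h"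
proof
  show "pseudometric_on binary (\<lambda>x y. h * udist r x y)"
    using cK by (simp add: pcompact_def)
  show "pseudometric_on X (\<lambda>x y. s * dX x y)" by (rule pseudometric_on_scale[OF pmX s])
qed (use zero_in_binary aX \<kappa> h in auto)

lemma pcompact_half: "pcompact HS HD"
  unfolding half_dist_def by (rule pcompact_join[OF cK pcompact_scale[OF cX s]])

text \<open>Eccentricity of the junction point \<open>Inr b\<close>: through the Cantor set, over
  the gap, and across \<open>X\<close> from \<open>a\<close> to \<open>b\<close>.\<close>

definition ecc :: real where
  "ecc = h * r 0 + \<kappa> * h + s * dX a b"

text \<open>Each distance uses at most one distance of each kind, and \<open>h * r 0\<close> and
  \<open>s * dX a b\<close> are the largest ones; here the choice of a diametral pair
  enters.\<close>

lemma half_dist_le_ecc: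
  assumes "p \<in> HS" "q \<in> HS" shows "HD p q \<le> ecc"
proof -
  have K: "0 \<le> h * udist r x y" "h * udist r x y \<le> h * r 0" for x y
    using h udist_nonneg udist_le_r0 by (simp_all add: mult_left_mono)
  have X: "0 \<le> s * dX x y" "s * dX x y \<le> s * dX a b" if "x \<in> X" "y \<in> X" for x y
    using that s diam pseudometric_on_nonneg[OF pmX] by (simp_all add: mult_left_mono)
  have kh: "0 \<le> \<kappa> * h" using \<kappa> h by simp
  show ?thesis
  proof (cases p; cases q)
    fix x y assume "p = Inl x" "q = Inl y"
    then show ?thesis using K[of x y] X[OF aX bX] kh by (simp add: half_dist_def ecc_def)
  next
    fix x y assume "p = Inr x" "q = Inr y"
    then show ?thesis using assms K[of "\<lambda>_. 0" "\<lambda>_. 0"] X[of x y] kh by (simp add: half_dist_def ecc_def)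
  next
    fix x y assume "p = Inl x" "q = Inr y"
    then show ?thesis using assms K[of x "\<lambda>_. 0"] X[OF aX, of y] kh by (simp add: half_dist_def ecc_def)
  next
    fix x y assume "p = Inr y" "q = Inl x"
    then show ?thesis using assms K[of x "\<lambda>_. 0"] X[OF aX, of y] kh by (simp add: half_dist_def ecc_def)
  qed
qed

lemma ecc_pos: "h > 0 \<Longrightarrow> ecc > 0"
  using r_pos[of 0] \<kappa> s pseudometric_on_nonneg[OF pmX aX bX] unfolding ecc_def
  by (intro add_pos_nonneg) auto

text \<open>Points of \<open>X\<close> miss the positive term \<open>h * r 0\<close>, and in the
  Cantor set the full distance from the base point means a different digit at index 0.\<close>

lemma half_dist_eq_ecc_iff:
  assumes "p \<in> HS" "h > 0"
  shows "HD p (Inr b) = ecc \<longleftrightarrow> (\<exists>x\<in>binary. x 0 \<noteq> 0 \<and> p = Inl x)"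
proof (cases p)
  case (Inl x)
  have "udist r x (\<lambda>_. 0) = r 0 \<longleftrightarrow> x 0 \<noteq> 0"
    using udist_less_iff[of x "\<lambda>_. 0" 0] udist_le_r0[of x "\<lambda>_. 0"] by auto
  then show ?thesis using Inl assms by (auto simp: half_dist_def ecc_def)
next
  case (Inr y)
  have "s * dX y b \<le> s * dX a b" using Inr assms s diam bX by (simp add: mult_left_mono)
  moreover have "h * r 0 > 0" "\<kappa> * h \<ge> 0" using assms(2) r_pos[of 0] \<kappa> by simp_all
  ultimately show ?thesis using Inr by (auto simp: half_dist_def ecc_def)
qed

definition far_cluster_dists :: "real set" where
  "far_cluster_dists = {h * udist r x x' | x x'. x \<in> binary \<and> x' \<in> binary \<and> x 0 \<noteq> 0 \<and> x' 0 \<noteq> 0}"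

lemma dists_at_ecc:
  assumes "h > 0"
  shows "{HD p p' | p p'. p \<in> HS \<and> p' \<in> HS \<and> HD p (Inr b) = ecc \<and> HD p' (Inr b) = ecc} = far_cluster_dists"
    (is "?L = _")
proof (intro set_eqI iffI)
  fix t assume "t \<in> ?L"
  then obtain p p' where p: "p \<in> HS" "p' \<in> HS" "t = HD p p'" "HD p (Inr b) = ecc" "HD p' (Inr b) = ecc" by blast
  obtain x x' where "x \<in> binary" "x 0 \<noteq> 0" "p = Inl x" "x' \<in> binary" "x' 0 \<noteq> 0" "p' = Inl x'"
    using p half_dist_eq_ecc_iff[OF _ assms] by metis
  then show "t \<in> far_cluster_dists" using p(3) unfolding far_cluster_dists_def by (auto simp: half_dist_def)
next
  fix t assume "t \<in> far_cluster_dists"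
  then obtain x x' where x: "x \<in> binary" "x 0 \<noteq> 0" "x' \<in> binary" "x' 0 \<noteq> 0" "t = h * udist r x x'"
    unfolding far_cluster_dists_def by blast
  then have "t = HD (Inl x) (Inl x')" "HD (Inl x) (Inr b) = ecc" "HD (Inl x') (Inr b) = ecc"
    using half_dist_eq_ecc_iff[OF _ assms, of "Inl x"] half_dist_eq_ecc_iff[OF _ assms, of "Inl x'"]
    by (auto simp: half_dist_def)
  then show "t \<in> ?L" using x by blast
qed

text \<open>Binary sequences with non-zero first digit agree at index 0, so \<open>r 0\<close> does
  not occur. The later radii arise by changing one digit of the constant sequence 1.\<close>

lemma far_cluster_dists_eq: "far_cluster_dists = insert 0 (range (\<lambda>n. h * r (Suc n)))"
proof (intro set_eqI iffI)
  fix t assume "t \<in> far_cluster_dists"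
  then obtain x x' where x: "x \<in> binary" "x' \<in> binary" "x 0 \<noteq> 0" "x' 0 \<noteq> 0" "t = h * udist r x x'"
    unfolding far_cluster_dists_def by blast
  have "x 0 < 2" "x' 0 < 2" using x by (simp_all add: seqs_def)
  then have e0: "x 0 = x' 0" using x by simp
  show "t \<in> insert 0 (range (\<lambda>n. h * r (Suc n)))"
  proof (cases rule: udist_cases[of x x'])
    case 1
    then show ?thesis using x by simp
  next
    case (2 n)
    then obtain m where "n = Suc m" using e0 by (cases n) auto
    then have "t = h * r (Suc m)" using 2(1) x by simp
    then show ?thesis by blast
  qed
next
  fix t assume "t \<in> insert 0 (range (\<lambda>n. h * r (Suc n)))"
  then consider "t = 0" | n where "t = h * r (Suc n)" by blast
  then show "t \<in> far_cluster_dists"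
  proof cases
    case 1
    then show ?thesis unfolding far_cluster_dists_def using one_in_binary
      by (auto intro!: exI[of _ "\<lambda>_. 1"])
  next
    case (2 n)
    define y :: "nat \<Rightarrow> nat" where "y = (\<lambda>_. 1)(Suc n := 0)"
    have "y \<in> binary" "y 0 \<noteq> 0" by (auto simp: y_def seqs_def)
    moreover have "udist r (\<lambda>_. 1) y = r (Suc n)" by (rule udist_eq) (auto simp: y_def)
    ultimately show ?thesis unfolding far_cluster_dists_def using one_in_binary 2
      by (intro CollectI exI[of _ "\<lambda>_. 1"] exI[of _ y]) auto
  qed
qed

lemma half_dist_commute: "p \<in> HS \<Longrightarrow> q \<in> HS \<Longrightarrow> HD p q = HD q p"
  using pseudometric_onD(2)[OF pseudometric_on_join] by (simp add: half_dist_def)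

end

locale full_space = L: half_space r X dX a b \<kappa> h s + R: half_space r Y dY c e \<kappa> h s'
  for r and X :: "'a set" and dX a b \<kappa> h s and Y :: "'b set" and dY c e s'
begin

abbreviation "FS \<equiv> (binary <+> X) <+> (binary <+> Y)"
abbreviation "FD \<equiv> full_dist \<kappa> h r s dX a b s' dY c e"

sublocale F: pointed_join L.HS L.HD "Inr b" R.HS R.HD "Inr e" "\<kappa> * h"
proof
  show "pseudometric_on L.HS L.HD" "pseudometric_on R.HS R.HD"
    using L.pcompact_half R.pcompact_half by (simp_all add: pcompact_def)
qed (use L.bX R.bX L.\<kappa> L.h in auto)

section \<open>Properties of the whole chain\<close>

lemma pcompact_full: "pcompact FS FD"
  unfolding full_dist_def by (rule F.pcompact_join[OF L.pcompact_half R.pcompact_half])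

lemma pdoubling_full_iff:
  assumes "h > 0" "s > 0" "s' > 0"
  shows "pdoubling FS FD \<longleftrightarrow> pdoubling X dX \<and> pdoubling Y dY"
proof -
  have "pdoubling binary (udist r)" by (rule L.pdoubling_udist[of _ 2]) simp
  then show ?thesis
    unfolding full_dist_def F.pdoubling_join_iff
    unfolding half_dist_def L.pdoubling_join_iff R.pdoubling_join_iff using assms
    by (simp add: pdoubling_scale_iff)
qed

lemma punif_disconnected_full_iff:
  assumes "h > 0" "s > 0" "s' > 0"
  shows "punif_disconnected FS FD \<longleftrightarrow> punif_disconnected X dX \<and> punif_disconnected Y dY"
  unfolding full_dist_def F.punif_disconnected_join_iff
  unfolding half_dist_def L.punif_disconnected_join_iff R.punif_disconnected_join_iff using assms
  by (simp add: punif_disconnected_scale_iff L.punif_disconnected_udist)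

lemma punif_perfect_full:
  assumes "h > 0" "s > 0" "s' > 0" "\<kappa> = 0" "punif_perfect X dX" "punif_perfect Y dY"
    and ratio: "\<eta> > 0" "\<And>n. \<eta> * r n \<le> r (Suc n)"
  shows "punif_perfect FS FD"
proof -
  have K: "punif_perfect binary (\<lambda>x y. h * udist r x y)"
    by (rule punif_perfect_scale[OF L.punif_perfect_udist[OF _ ratio] assms(1)]) simp
  have "punif_perfect L.HS L.HD"
    unfolding half_dist_def
    by (rule L.punif_perfect_join[OF K punif_perfect_scale[OF assms(5,2)] _ L.cK pcompact_scale[OF L.cX L.s]])
       (simp add: assms)
  moreover have "punif_perfect R.HS R.HD"
    unfolding half_dist_def
    by (rule R.punif_perfect_join[OF K punif_perfect_scale[OF assms(6,3)] _ R.cK pcompact_scale[OF R.cX R.s]])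
       (simp add: assms)
  ultimately show ?thesis
    unfolding full_dist_def
    by (intro F.punif_perfect_join L.pcompact_half R.pcompact_half) (simp_all add: assms)
qed

text \<open>If the scales drop faster than geometrically, the points of the binary sequence space far
  from its base point see arbitrarily wide empty annuli.\<close>

lemma not_punif_perfect_full:
  assumes "h > 0" and ratio: "\<And>\<eta>. \<eta> > 0 \<Longrightarrow> \<exists>n. r (Suc n) < \<eta> * r n"
  shows "\<not> punif_perfect FS FD"
proof
  assume "punif_perfect FS FD"
  then obtain c where c: "c > 0" "\<And>x u v \<rho>. \<lbrakk>x \<in> FS; u \<in> FS; v \<in> FS; \<rho> > 0; \<rho> < FD u v\<rbrakk>
        \<Longrightarrow> \<exists>y\<in>FS. c * \<rho> \<le> FD x y \<and> FD x y \<le> \<rho>"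
    unfolding punif_perfect_def by blast
  obtain n where n: "r (Suc n) < c / 2 * r n" using ratio[of "c / 2"] c(1) by auto
  \<comment> \<open>For this \<open>n\<close>, the range from \<open>c * \<rho>\<close> to
    \<open>\<rho>\<close> falls strictly between the consecutive distances
    \<open>h * r (Suc n)\<close> and \<open>h * r n\<close>.\<close>
  define \<rho> where "\<rho> = h * r n / 2"
  \<comment> \<open>The constant sequence 1 is at distance \<open>h * r 0\<close> from the base
    point, so everything outside its own Cantor set is farther away than
    \<open>\<rho>\<close>.\<close>
  define p :: "((nat \<Rightarrow> nat) + 'a) + ((nat \<Rightarrow> nat) + 'b)" where "p = Inl (Inl (\<lambda>_. 1))"
  have p: "p \<in> FS" using one_in_binary by (simp add: p_def)
  have ud: "udist r (\<lambda>_. Suc 0) (\<lambda>_. 0) = r 0" by (rule L.udist_eq) auto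
  have pos: "h * r m > 0" for m using assms(1) L.r_pos by simp
  have n0: "h * r n \<le> h * r 0" using assms(1) L.r_mono by simp
  have "\<rho> > 0" using pos[of n] by (simp add: \<rho>_def)
  moreover have "\<rho> < FD p (Inl (Inl (\<lambda>_. 0)))"
    using n0 pos[of n] by (simp add: full_dist_def half_dist_def p_def ud \<rho>_def)
  ultimately obtain q where q: "q \<in> FS" "c * \<rho> \<le> FD p q" "FD p q \<le> \<rho>"
    using c(2)[OF p p, of "Inl (Inl (\<lambda>_. 0))" \<rho>] zero_in_binary by auto
  have big: "FD p q \<ge> h * r 0" if nq: "\<And>x. q \<noteq> Inl (Inl x)"
  proof -
    have nnX: "0 \<le> s * dX a y" if "y \<in> X" for y
      using pseudometric_on_nonneg[OF L.pmX L.aX that] L.s by simp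
    have nnR: "0 \<le> R.HD (Inr e) z" if "z \<in> R.HS" for z
      using pseudometric_on_nonneg[OF F.pm_B F.b that] .
    have kh: "\<kappa> * h \<ge> 0" using L.\<kappa> L.h by simp
    show ?thesis
    proof (cases q)
      case (Inl z)
      then obtain y where "z = Inr y" "y \<in> X" using nq q(1) by (cases z) auto
      then show ?thesis using Inl nnX[of y] kh by (simp add: p_def full_dist_def half_dist_def ud)
    next
      case (Inr z)
      then have z: "z \<in> R.HS" using q(1) by simp
      have "FD p q = L.HD (Inl (\<lambda>_. 1)) (Inr b) + \<kappa> * h + R.HD (Inr e) z"
        using Inr by (simp add: p_def full_dist_def)
      moreover have "L.HD (Inl (\<lambda>_. 1)) (Inr b) \<ge> h * r 0"
        using nnX[OF L.bX] kh by (simp add: half_dist_def ud)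
      ultimately show ?thesis using nnR[OF z] kh by linarith
    qed
  qed
  show False
  proof (cases "\<exists>x. q = Inl (Inl x)")
    case False
    then have "h * r 0 \<le> \<rho>" using big q(3) by force
    then show False using n0 pos[of n] by (simp add: \<rho>_def)
  next
    case True
    then obtain x where x: "q = Inl (Inl x)" by blast
    then have d: "FD p q = h * udist r (\<lambda>_. 1) x" by (simp add: p_def full_dist_def half_dist_def)
    show False
    proof (cases rule: L.udist_cases[of "\<lambda>_. 1" x])
      case 1
      then show False using d q(2) c(1) \<open>\<rho> > 0\<close> by (simp add: mult_le_0_iff)
    next
      case (2 m)
      show False
      proof (cases "m \<le> n")
        case True
        then have "h * r n \<le> h * r m" using assms(1) L.r_mono by simp
        then show False using 2(1) d q(3) pos[of n] by (simp add: \<rho>_def)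
      next
        case False
        then have "h * r m \<le> h * r (Suc n)" using assms(1) L.r_mono[of "Suc n" m] by simp
        also have "\<dots> < h * (c / 2 * r n)" using n assms(1) by simp
        also have "\<dots> = c * \<rho>" by (simp add: \<rho>_def)
        finally show False using 2(1) d q(2) by simp
      qed
    qed
  qed
qed

lemma pcantor_full:
  assumes "h > 0" "s > 0" "s' > 0" "\<kappa> > 0" "pcantor X dX" "pcantor Y dY"
  shows "pcantor FS FD"
proof -
  have K: "pcantor binary (\<lambda>x y. h * udist r x y)"
    by (rule pcantor_scale[OF L.pcantor_udist assms(1)])
  have kh: "\<kappa> * h > 0" using assms by simp
  have "pcantor L.HS L.HD"
    unfolding half_dist_def by (rule L.pcantor_join[OF K pcantor_scale[OF assms(5,2)] kh])
  moreover have "pcantor R.HS R.HD"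
    unfolding half_dist_def by (rule R.pcantor_join[OF K pcantor_scale[OF assms(6,3)] kh])
  ultimately show ?thesis
    unfolding full_dist_def by (rule F.pcantor_join[OF _ _ kh])
qed

lemma full_dist_left: "FD (Inl (Inr x)) (Inl (Inr y)) = s * dX x y"
  and full_dist_right: "FD (Inr (Inr u)) (Inr (Inr v)) = s' * dY u v"
  by (simp_all add: full_dist_def half_dist_def)

lemma realizes_full_left:
  assumes "realizes x X dX" "s = 1" "h = 0" "s' = 0"
  shows "realizes x FS FD"
proof -
  have "realizes x L.HS L.HD"
    unfolding half_dist_def
    by (rule L.realizes_join_right) (use assms in auto)
  then show ?thesis
    unfolding full_dist_def
    by (rule F.realizes_join_left) (use assms in \<open>auto simp: half_dist_def elim!: PlusE\<close>)
qed

lemma realizes_full_right: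
  assumes "realizes y Y dY" "s' = 1" "h = 0" "s = 0"
  shows "realizes y FS FD"
proof -
  have "realizes y R.HS R.HD"
    unfolding half_dist_def
    by (rule R.realizes_join_right) (use assms in auto)
  then show ?thesis
    unfolding full_dist_def
    by (rule F.realizes_join_right) (use assms in \<open>auto simp: half_dist_def elim!: PlusE\<close>)
qed

lemma ex_full_dist_diameter:
  assumes "h > 0"
  shows "\<exists>p\<in>FS. \<exists>q\<in>FS. FD p q = L.ecc + \<kappa> * h + R.ecc"
proof (intro bexI)
  have "L.HD (Inl (\<lambda>_. 1)) (Inr b) = L.ecc" "R.HD (Inl (\<lambda>_. 1)) (Inr e) = R.ecc"
    using L.half_dist_eq_ecc_iff[OF _ assms, of "Inl (\<lambda>_. 1)"] R.half_dist_eq_ecc_iff[OF _ assms, of "Inl (\<lambda>_. 1)"]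
      one_in_binary by auto
  then show "FD (Inl (Inl (\<lambda>_. 1))) (Inr (Inl (\<lambda>_. 1))) = L.ecc + \<kappa> * h + R.ecc"
    using R.half_dist_commute[of "Inr e" "Inl (\<lambda>_. 1)"] one_in_binary R.bX by (simp add: full_dist_def)
qed (use one_in_binary in auto)

text \<open>Both ends carry the same Cantor set at the same scale, so the two sides contribute the
  same distances.\<close>

lemma far_dists_full:
  assumes "h > 0"
  shows "far_dists FS FD = insert 0 (range (\<lambda>n. h * r (Suc n)))"
proof -
  have one: "L.HD (Inl (\<lambda>_. 1)) (Inr b) = L.ecc" "R.HD (Inl (\<lambda>_. 1)) (Inr e) = R.ecc"
    using L.half_dist_eq_ecc_iff[OF _ assms, of "Inl (\<lambda>_. 1)"] R.half_dist_eq_ecc_iff[OF _ assms, of "Inl (\<lambda>_. 1)"]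
      one_in_binary by auto
  have comm: "R.HD (Inr e) p = R.HD p (Inr e)" if "p \<in> R.HS" for p
    by (rule R.half_dist_commute) (use that R.bX in auto)
  have "far_dists FS FD =
     {L.HD p p' | p p'. p \<in> L.HS \<and> p' \<in> L.HS \<and> L.HD p (Inr b) = L.ecc \<and> L.HD p' (Inr b) = L.ecc} \<union>
     {R.HD p p' | p p'. p \<in> R.HS \<and> p' \<in> R.HS \<and> R.HD (Inr e) p = R.ecc \<and> R.HD (Inr e) p' = R.ecc}"
    unfolding full_dist_def
  proof (rule F.far_dists_join)
    show "\<exists>p\<in>L.HS. L.HD p (Inr b) = L.ecc"
      by (rule bexI[of _ "Inl (\<lambda>_. 1)"]) (use one one_in_binary in auto)
    show "\<exists>p\<in>R.HS. R.HD (Inr e) p = R.ecc"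
      by (rule bexI[of _ "Inl (\<lambda>_. 1)"]) (use one comm one_in_binary in auto)
  qed (use L.half_dist_le_ecc R.half_dist_le_ecc L.bX R.bX L.ecc_pos[OF assms] R.ecc_pos[OF assms] in auto)
  also have "{R.HD p p' | p p'. p \<in> R.HS \<and> p' \<in> R.HS \<and> R.HD (Inr e) p = R.ecc \<and> R.HD (Inr e) p' = R.ecc} =
     {R.HD p p' | p p'. p \<in> R.HS \<and> p' \<in> R.HS \<and> R.HD p (Inr e) = R.ecc \<and> R.HD p' (Inr e) = R.ecc}"
    by (intro Collect_cong ex_cong1 conj_cong refl) (simp_all add: comm)
  finally show ?thesis
    unfolding L.dists_at_ecc[OF assms] R.dists_at_ecc[OF assms] L.far_cluster_dists_eq R.far_cluster_dists_eq
    by simp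
qed

end

section \<open>Dependence of the chain on its parameters\<close>

lemma half_dist_diff_le:
  assumes "\<And>x y. \<bar>h * udist r x y - h' * udist r' x y\<bar> \<le> \<epsilon>"
    and "\<And>x y. x \<in> X \<Longrightarrow> y \<in> X \<Longrightarrow> \<bar>dX x y\<bar> \<le> D" and "a \<in> X" "p \<in> binary <+> X" "q \<in> binary <+> X"
  shows "\<bar>half_dist \<kappa> h r s dX a p q - half_dist \<kappa> h' r' s' dX a p q\<bar> \<le> \<epsilon> + \<bar>s - s'\<bar> * D + \<bar>\<kappa> * h - \<kappa> * h'\<bar>"
  unfolding half_dist_def
proof (rule join_dist_diff_le[OF _ _ zero_in_binary assms(3,4,5)])
  show "\<bar>s * dX x y - s' * dX x y\<bar> \<le> \<bar>s - s'\<bar> * D" if "x \<in> X" "y \<in> X" for x y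
    using mult_left_mono[OF assms(2)[OF that], of "\<bar>s - s'\<bar>"]
    by (simp add: left_diff_distrib[symmetric] abs_mult)
qed (rule assms(1))

lemma full_dist_diff_le:
  assumes K: "\<And>x y. \<bar>h * udist r x y - h' * udist r' x y\<bar> \<le> \<epsilon>"
    and X: "\<And>x y. x \<in> X \<Longrightarrow> y \<in> X \<Longrightarrow> \<bar>dX x y\<bar> \<le> D" "a \<in> X" "b \<in> X"
    and Y: "\<And>x y. x \<in> Y \<Longrightarrow> y \<in> Y \<Longrightarrow> \<bar>dY x y\<bar> \<le> E" "c \<in> Y" "e \<in> Y"
    and pq: "p \<in> (binary <+> X) <+> (binary <+> Y)" "q \<in> (binary <+> X) <+> (binary <+> Y)"
  shows "\<bar>full_dist \<kappa> h r s dX a b t dY c e p q - full_dist \<kappa> h' r' s' dX a b t' dY c e p q\<bar>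
    \<le> (\<epsilon> + \<bar>s - s'\<bar> * D + \<bar>\<kappa> * h - \<kappa> * h'\<bar>) + (\<epsilon> + \<bar>t - t'\<bar> * E + \<bar>\<kappa> * h - \<kappa> * h'\<bar>) + \<bar>\<kappa> * h - \<kappa> * h'\<bar>"
  unfolding full_dist_def
  by (rule join_dist_diff_le[OF half_dist_diff_le[OF K X(1,2)] half_dist_diff_le[OF K Y(1,2)] _ _ pq])
     (use X(3) Y(3) in auto)

section \<open>Coding the Hilbert cube\<close>

text \<open>The factor 4 leaves room for the perturbation \<open>1 + c n\<close> between 1 and 2 in
  \<open>radii\<close>, which still at least halve at each step.\<close>

locale weights =
  fixes w :: "nat \<Rightarrow> real"
  assumes w_0: "w 0 = 1" and w_pos: "w n > 0" and w_Suc: "w (Suc n) \<le> w n / 4"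
begin

lemma w_le: "w n \<le> 1 / 4 ^ n"
proof (induction n)
  case (Suc n)
  have "w (Suc n) \<le> w n / 4" by (rule w_Suc)
  also have "\<dots> \<le> (1 / 4 ^ n) / 4" using Suc by simp
  finally show ?case by simp
qed (simp add: w_0)

lemma w_le_1: "w n \<le> 1"
proof -
  have "1 / 4 ^ n \<le> (1 :: real)" by simp
  then show ?thesis using w_le[of n] by linarith
qed

end

definition radii :: "(nat \<Rightarrow> real) \<Rightarrow> (nat \<Rightarrow> real) \<Rightarrow> nat \<Rightarrow> real" where
  "radii w c n = w n * (1 + c n)"

context weights
begin

lemma scale_seq_radii:
  assumes "c \<in> cube" shows "scale_seq (radii w c)"
proof
  fix n
  show "radii w c n > 0" using w_pos[of n] cubeD(1)[OF assms, of n] by (simp add: radii_def)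
  have "radii w c (Suc n) \<le> w (Suc n) * 2"
    unfolding radii_def using w_pos[of "Suc n"] cubeD(2)[OF assms, of "Suc n"] by (intro mult_left_mono) auto
  also have "\<dots> \<le> w n / 2" using w_Suc[of n] by simp
  also have "\<dots> \<le> radii w c n / 2"
    unfolding radii_def using w_pos[of n] cubeD(1)[OF assms, of n] by (simp add: algebra_simps)
  finally show "radii w c (Suc n) \<le> radii w c n / 2" .
qed

lemma radii_le_2: "c \<in> cube \<Longrightarrow> radii w c n \<le> 2"
  unfolding radii_def using mult_mono[of "w n" 1 "1 + c n" 2] w_le_1[of n] cubeD[of c n] by simp

end

text \<open>The first two entries normalise the scale, the third one is a free parameter that is used to
  keep the coded spaces away from two given ones.\<close>

definition cube_code :: "real \<Rightarrow> (nat \<Rightarrow> real) \<Rightarrow> nat \<Rightarrow> real" where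
  "cube_code l q n = (if n < 2 then 0 else if n = 2 then l else q (n - 3))"

lemma cube_code_in_cube: "l \<in> {0..1} \<Longrightarrow> q \<in> cube \<Longrightarrow> cube_code l q \<in> cube"
  by (auto simp: cube_code_def cube_def)

section \<open>The time parameter and a weighted distance on the cube\<close>

definition cube_time :: "(nat \<Rightarrow> real) \<Rightarrow> real" where
  "cube_time q = (\<Sum>n. q n / 2 ^ Suc n)"

text \<open>It has the weights of \<open>cube_time\<close>, and these decay more slowly than any
  sequence satisfying \<open>weights\<close>. So times and radii are all Lipschitz for it.\<close>

definition cube_dist :: "(nat \<Rightarrow> real) \<Rightarrow> (nat \<Rightarrow> real) \<Rightarrow> real" where
  "cube_dist q q' = (\<Sum>n. \<bar>q n - q' n\<bar> / 2 ^ Suc n)"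

lemma summable_half_powers:
  fixes u :: "nat \<Rightarrow> real"
  assumes "\<And>n. \<bar>u n\<bar> \<le> 1" shows "summable (\<lambda>n. u n / 2 ^ Suc n)"
proof (rule summable_comparison_test'[of "\<lambda>n. (1 / 2) ^ Suc n" 0])
  show "summable (\<lambda>n. (1 / 2 :: real) ^ Suc n)" using power_half_series sums_summable by blast
  show "norm (u n / 2 ^ Suc n) \<le> (1 / 2) ^ Suc n" for n
    using assms[of n] by (simp add: power_divide divide_simps)
qed

lemma cube_diff_le_1: "q \<in> cube \<Longrightarrow> q' \<in> cube \<Longrightarrow> \<bar>q n - q' n\<bar> \<le> 1"
  using cubeD[of q n] cubeD[of q' n] by (simp add: abs_le_iff)

lemma summable_cube_time: "q \<in> cube \<Longrightarrow> summable (\<lambda>n. q n / 2 ^ Suc n)"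
  using cubeD[of q] by (intro summable_half_powers) (simp add: abs_le_iff)

lemma summable_cube_dist: "q \<in> cube \<Longrightarrow> q' \<in> cube \<Longrightarrow> summable (\<lambda>n. \<bar>q n - q' n\<bar> / 2 ^ Suc n)"
  using cube_diff_le_1 by (intro summable_half_powers) simp

lemma half_powers_suminf: "(\<Sum>n. 1 / 2 ^ Suc n :: real) = 1"
  using sums_unique[OF power_half_series] by (simp add: power_divide)

lemma one_minus_cube_time:
  assumes "q \<in> cube" shows "1 - cube_time q = cube_time (\<lambda>n. 1 - q n)"
proof -
  have "summable (\<lambda>n. 1 / 2 ^ Suc n :: real)" using summable_half_powers[of "\<lambda>_. 1"] by simp
  then have "(\<Sum>n. 1 / 2 ^ Suc n) - cube_time q = (\<Sum>n. 1 / 2 ^ Suc n - q n / 2 ^ Suc n)"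
    unfolding cube_time_def by (rule suminf_diff[OF _ summable_cube_time[OF assms]])
  then show ?thesis unfolding half_powers_suminf by (simp add: cube_time_def diff_divide_distrib)
qed

lemma cube_time_nonneg: "q \<in> cube \<Longrightarrow> 0 \<le> cube_time q"
  unfolding cube_time_def using cubeD(1)[of q] by (intro suminf_nonneg summable_cube_time) auto

lemma one_minus_in_cube: "q \<in> cube \<Longrightarrow> (\<lambda>n. 1 - q n) \<in> cube"
  by (auto simp: cube_def)

lemma cube_time_le_1: "q \<in> cube \<Longrightarrow> cube_time q \<le> 1"
  using one_minus_cube_time[of q] cube_time_nonneg[OF one_minus_in_cube, of q] by simp

lemma cube_time_eq_0: "q \<in> cube \<Longrightarrow> cube_time q = 0 \<Longrightarrow> q n = 0"
  using suminf_eq_zero_iff[OF summable_cube_time, of q] cubeD(1)[of q] by (simp add: cube_time_def)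

lemma cube_time_eq_1: "q \<in> cube \<Longrightarrow> cube_time q = 1 \<Longrightarrow> q n = 1"
  using cube_time_eq_0[OF one_minus_in_cube, of q n] one_minus_cube_time[of q] by simp

lemma cube_time_0: "cube_time (\<lambda>_. 0) = 0"
  by (simp add: cube_time_def)

lemma cube_time_1: "cube_time (\<lambda>_. 1) = 1"
  using half_powers_suminf by (simp add: cube_time_def)

lemma cube_time_diff_le:
  assumes "q \<in> cube" "q' \<in> cube" shows "\<bar>cube_time q - cube_time q'\<bar> \<le> cube_dist q q'"
proof -
  have "cube_time q - cube_time q' = (\<Sum>n. q n / 2 ^ Suc n - q' n / 2 ^ Suc n)"
    unfolding cube_time_def by (rule suminf_diff[OF summable_cube_time[OF assms(1)] summable_cube_time[OF assms(2)]])
  also have "\<dots> = (\<Sum>n. (q n - q' n) / 2 ^ Suc n)" by (simp add: diff_divide_distrib)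
  finally have "\<bar>cube_time q - cube_time q'\<bar> = \<bar>\<Sum>n. (q n - q' n) / 2 ^ Suc n\<bar>" by simp
  also have "\<dots> \<le> (\<Sum>n. \<bar>(q n - q' n) / 2 ^ Suc n\<bar>)"
    using summable_cube_dist[OF assms] by (intro summable_rabs) (simp add: abs_divide)
  also have "\<dots> = cube_dist q q'" by (simp add: cube_dist_def abs_divide)
  finally show ?thesis .
qed

lemma cube_dist_term_le:
  assumes "q \<in> cube" "q' \<in> cube" shows "\<bar>q n - q' n\<bar> / 2 ^ Suc n \<le> cube_dist q q'"
  unfolding cube_dist_def
  using sum_le_suminf[OF summable_cube_dist[OF assms], of "{n}"] by simp

lemma cube_dist_self: "cube_dist q q = 0"
  by (simp add: cube_dist_def)

lemma cube_dist_nonneg: "q \<in> cube \<Longrightarrow> q' \<in> cube \<Longrightarrow> 0 \<le> cube_dist q q'"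
  unfolding cube_dist_def by (intro suminf_nonneg summable_cube_dist) auto

text \<open>By the Weierstrass test the partial sums, which involve finitely many coordinates,
  converge uniformly.\<close>

lemma continuous_on_cube_dist:
  assumes "q \<in> cube" shows "continuous_on cube (cube_dist q)"
proof -
  have "uniform_limit cube (\<lambda>n x. \<Sum>i<n. \<bar>q i - x i\<bar> / 2 ^ Suc i) (\<lambda>x. \<Sum>i. \<bar>q i - x i\<bar> / 2 ^ Suc i) sequentially"
  proof (rule Weierstrass_m_test)
    show "norm (\<bar>q n - x n\<bar> / 2 ^ Suc n) \<le> (1 / 2) ^ Suc n" if "x \<in> cube" for n x
      using cube_diff_le_1[OF assms that, of n] by (simp add: power_divide divide_simps)
    show "summable (\<lambda>n. (1 / 2 :: real) ^ Suc n)" using power_half_series sums_summable by blast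
  qed
  moreover have "continuous_on cube (\<lambda>x. \<Sum>i<n. \<bar>q i - x i\<bar> / 2 ^ Suc i)" for n
    by (intro continuous_intros continuous_on_product_then_coordinatewise[OF continuous_on_id]) auto
  ultimately show ?thesis
    unfolding cube_dist_def by (intro uniform_limit_theorem[OF always_eventually]) auto
qed

text \<open>The range enumerates a strictly decreasing sequence from the top. If \<open>u\<close>
  and \<open>v\<close> agree below \<open>n\<close>, then \<open>u n\<close> is some
  \<open>v m\<close> with \<open>m \<ge> n\<close>, hence at most \<open>v n\<close>; the roles can
  be exchanged.\<close>

lemma strict_antimono_range_eq:
  fixes f g :: "nat \<Rightarrow> real"
  assumes f: "\<And>m n. m < n \<Longrightarrow> f n < f m" and g: "\<And>m n. m < n \<Longrightarrow> g n < g m" and "range f = range g"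
  shows "f n = g n"
proof (induction n rule: less_induct)
  case (less n)
  have *: "u n \<le> v n" if u: "\<And>m n. m < n \<Longrightarrow> u n < u m" and v: "\<And>m n. m < n \<Longrightarrow> v n < v m"
    and "range u \<subseteq> range v" and IH: "\<And>k. k < n \<Longrightarrow> u k = v k" for u v :: "nat \<Rightarrow> real"
  proof -
    obtain m where m: "u n = v m" using \<open>range u \<subseteq> range v\<close> by blast
    have "n \<le> m"
    proof (rule ccontr)
      assume "\<not> n \<le> m"
      then have "u m = v m" "u n < u m" using IH[of m] u[of m n] by simp_all
      then show False using m by simp
    qed
    then show ?thesis using m v[of n m] by (cases "n = m") auto
  qed
  have "f n \<le> g n" by (rule *) (use f g assms(3) less in auto)
  moreover have "g n \<le> f n" by (rule *) (use f g assms(3) less in auto)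
  ultimately show ?case by simp
qed

text \<open>Positivity of the radii allows the removal of 0. At index 1 both codes vanish, so both
  radii equal \<open>w 1\<close> and \<open>h = h'\<close> follows; then the other entries can be
  compared.\<close>

lemma far_dists_determine_code:
  assumes "weights w" "h > 0" "h' > 0" "c \<in> cube" "c' \<in> cube" "c 1 = 0" "c' 1 = 0"
    and "insert 0 (range (\<lambda>n. h * radii w c (Suc n))) = insert 0 (range (\<lambda>n. h' * radii w c' (Suc n)))"
  shows "c (Suc n) = c' (Suc n)"
proof -
  interpret weights w by fact
  interpret c: scale_seq "radii w c" by (rule scale_seq_radii[OF assms(4)])
  interpret c': scale_seq "radii w c'" by (rule scale_seq_radii[OF assms(5)])
  have nz: "h * radii w c (Suc n) \<noteq> 0" "h' * radii w c' (Suc n) \<noteq> 0" for n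
    using c.r_pos[of "Suc n"] c'.r_pos[of "Suc n"] assms(2,3) by simp_all
  have "range (\<lambda>n. h * radii w c (Suc n)) = range (\<lambda>n. h' * radii w c' (Suc n))"
    using assms(8) nz by (metis (no_types, lifting) insert_ident rangeE)
  then have eq: "h * radii w c (Suc n) = h' * radii w c' (Suc n)" for n
    by (intro strict_antimono_range_eq[of "\<lambda>n. h * radii w c (Suc n)" "\<lambda>n. h' * radii w c' (Suc n)"])
       (use c.r_strict c'.r_strict assms(2,3) in auto)
  have "h = h'" using eq[of 0] assms(6,7) w_pos[of 1] by (simp add: radii_def)
  then show ?thesis using eq[of n] assms(2) w_pos[of "Suc n"] by (simp add: radii_def)
qed

section \<open>Embedding the Hilbert cube\<close>

lemma ex_diametral_points:
  assumes "nonempty_compact X"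
  obtains a b where "a \<in> mspace X" "b \<in> mspace X"
    "\<And>x y. x \<in> mspace X \<Longrightarrow> y \<in> mspace X \<Longrightarrow> mdist X x y \<le> mdist X a b"
proof -
  let ?T = "prod_topology (mtopology_of X) (mtopology_of X)"
  let ?D = "(\<lambda>p. mdist X (fst p) (snd p)) ` (mspace X \<times> mspace X)"
  have "compactin ?T (mspace X \<times> mspace X)"
    using assms by (auto simp: nonempty_compact_def compact_space_def compactin_Times)
  then have "compactin euclideanreal ?D"
    by (rule image_compactin) (use continuous_map_metric[of X] in \<open>simp add: case_prod_unfold\<close>)
  then have "compact ?D" by simp
  moreover have "?D \<noteq> {}" using assms by (simp add: nonempty_compact_def)
  ultimately obtain t where t: "t \<in> ?D" "\<forall>u\<in>?D. u \<le> t"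
    using compact_attains_sup[of ?D] by blast
  then obtain a b where "a \<in> mspace X" "b \<in> mspace X" "t = mdist X a b" by auto
  then show thesis using that[of a b] t(2) by auto
qed

text \<open>Since \<open>s = 1\<close> or \<open>s' = 1\<close>, one of \<open>X\<close> and \<open>Y\<close> is present at its original scale.
  This matters because dimensional functions need not be invariant under scaling.\<close>

definition interpolates :: "gh_space set \<Rightarrow> real \<Rightarrow> (nat \<Rightarrow> real) \<Rightarrow> real metric \<Rightarrow> real metric \<Rightarrow> bool" where
  "interpolates S \<kappa> w X Y \<longleftrightarrow> (\<forall>k h s s' a b c e z.
     k \<in> cube \<and> full_space (radii w k) (mspace X) (mdist X) a b \<kappa> h s (mspace Y) (mdist Y) c e s' \<and>
     0 < h \<and> 0 < s \<and> 0 < s' \<and> (s = 1 \<or> s' = 1) \<and>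
     realizes z ((binary <+> mspace X) <+> (binary <+> mspace Y))
       (full_dist \<kappa> h (radii w k) s (mdist X) a b s' (mdist Y) c e) \<longrightarrow> z \<in> S)"

lemma (in weights) full_spaceI:
  assumes "nonempty_compact X" "nonempty_compact Y" "k \<in> cube"
    and "a \<in> mspace X" "b \<in> mspace X" "\<And>x y. x \<in> mspace X \<Longrightarrow> y \<in> mspace X \<Longrightarrow> mdist X x y \<le> mdist X a b"
    and "c \<in> mspace Y" "e \<in> mspace Y" "\<And>x y. x \<in> mspace Y \<Longrightarrow> y \<in> mspace Y \<Longrightarrow> mdist Y x y \<le> mdist Y c e"
    and "\<kappa> \<ge> 0" "h \<ge> 0" "s \<ge> 0" "s' \<ge> 0"
  shows "full_space (radii w k) (mspace X) (mdist X) a b \<kappa> h s (mspace Y) (mdist Y) c e s'"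
proof -
  interpret scale_seq "radii w k" by (rule scale_seq_radii) fact
  show ?thesis
    by unfold_locales (use assms(3-) assms(1,2)[unfolded nonempty_compact_iff_pcompact] in auto)
qed

text \<open>A chain of two copies of \<open>X\<close> has a larger diameter than \<open>X\<close>.
  This provides a second end point when a single member is to be put on a cube.\<close>

lemma ex_second_member:
  assumes "weights w" "\<kappa> \<ge> 0" "x \<in> S" and X: "nonempty_compact X" "x = isometry_class X"
    and S: "interpolates S \<kappa> w X X"
  shows "\<exists>y\<in>S. y \<noteq> x"
proof -
  interpret weights w by fact
  obtain a b where ab: "a \<in> mspace X" "b \<in> mspace X"
    "\<And>x y. x \<in> mspace X \<Longrightarrow> y \<in> mspace X \<Longrightarrow> mdist X x y \<le> mdist X a b"
    using ex_diametral_points[OF X(1)] by metis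
  have comm: "mdist X a b = mdist X b a"
    using pseudometric_onD(2)[OF pseudometric_on_mdist ab(1,2)] .
  have k: "(\<lambda>_. 0) \<in> cube" by (simp add: cube_def)
  have fs: "full_space (radii w (\<lambda>_. 0)) (mspace X) (mdist X) a b \<kappa> 1 1 (mspace X) (mdist X) b a 1"
    by (rule full_spaceI[OF X(1) X(1) k ab ab(2,1) ab(3)[unfolded comm]]) (use assms in auto)
  then interpret full_space "radii w (\<lambda>_. 0)" "mspace X" "mdist X" a b \<kappa> 1 1 "mspace X" "mdist X" b a 1 .
  obtain z where z: "realizes z FS FD" using pcompact_imp_realizes[OF pcompact_full] by blast
  have "z \<in> S" using S[unfolded interpolates_def, rule_format, of "\<lambda>_. 0" a b 1 1 b a 1 z] fs z k by simp
  moreover have "z \<noteq> x"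
  proof
    assume "z = x"
    then obtain \<phi> where \<phi>: "\<phi> ` FS = mspace X" "\<And>m m'. m \<in> FS \<Longrightarrow> m' \<in> FS \<Longrightarrow> mdist X (\<phi> m) (\<phi> m') = FD m m'"
      using realizes_onto[OF z X(1)] X(2) by metis
    obtain p q where pq: "p \<in> FS" "q \<in> FS" "FD p q = L.ecc + \<kappa> * 1 + R.ecc"
      using ex_full_dist_diameter by auto
    have "FD p q \<le> mdist X a b" using \<phi> ab(3) pq(1,2) by (metis imageI)
    then show False
      using pq(3) L.r_pos[of 0] mdist_nonneg[of X b a] \<open>\<kappa> \<ge> 0\<close>
      unfolding L.ecc_def R.ecc_def mult_1_left mult_1_right by linarith
  qed
  ultimately show ?thesis by blast
qed

text \<open>By compactness, continuity and injectivity suffice. Interior points are told apart by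
  their codes, an interior point from an end by the choice of \<open>l\<close>, and the two ends by
  \<open>x \<noteq> y\<close>.\<close>

lemma cube_embedding:
  assumes "weights w" "\<kappa> \<ge> 0" "x \<in> S" "y \<in> S" "x \<noteq> y"
    and X: "nonempty_compact X" "x = isometry_class X" and Y: "nonempty_compact Y" "y = isometry_class Y"
    and S: "interpolates S \<kappa> w X Y"
  shows "\<exists>f. embedding_map hilbert_cube (gh_topology S) f \<and> {x, y} \<subseteq> f ` topspace hilbert_cube"
proof -
  interpret weights w by fact
  obtain a b where ab: "a \<in> mspace X" "b \<in> mspace X"
    "\<And>x y. x \<in> mspace X \<Longrightarrow> y \<in> mspace X \<Longrightarrow> mdist X x y \<le> mdist X a b"
    using ex_diametral_points[OF X(1)] by metis
  obtain c e where ce: "c \<in> mspace Y" "e \<in> mspace Y"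
    "\<And>x y. x \<in> mspace Y \<Longrightarrow> y \<in> mspace Y \<Longrightarrow> mdist Y x y \<le> mdist Y c e"
    using ex_diametral_points[OF Y(1)] by metis
  define h where "h q = cube_time q * (1 - cube_time q)" for q
  define s where "s q = min 1 (2 - 2 * cube_time q)" for q
  define s' where "s' q = min 1 (2 * cube_time q)" for q
  define rr where "rr l q = radii w (cube_code l q)" for l q
  define \<rho> where "\<rho> l q = full_dist \<kappa> (h q) (rr l q) (s q) (mdist X) a b (s' q) (mdist Y) c e" for l q
  define M where "M = (binary <+> mspace X) <+> (binary <+> mspace Y)"
  have range: "0 \<le> h q" "h q \<le> 1" "0 \<le> s q" "0 \<le> s' q" if "q \<in> cube" for q
    using cube_time_nonneg[OF that] cube_time_le_1[OF that]
    by (auto simp: h_def s_def s'_def intro: mult_le_one)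
  have fs: "full_space (rr l q) (mspace X) (mdist X) a b \<kappa> (h q) (s q) (mspace Y) (mdist Y) c e (s' q)"
    if "l \<in> {0..1}" "q \<in> cube" for l q
    unfolding rr_def by (rule full_spaceI[OF X(1) Y(1) cube_code_in_cube[OF that] ab ce])
       (use range[OF that(2)] \<open>\<kappa> \<ge> 0\<close> in auto)
  define F where "F l q = (SOME z. realizes z M (\<rho> l q))" for l q
  have F: "realizes (F l q) M (\<rho> l q)" if "l \<in> {0..1}" "q \<in> cube" for l q
  proof -
    interpret full_space "rr l q" "mspace X" "mdist X" a b \<kappa> "h q" "s q" "mspace Y" "mdist Y" c e "s' q"
      by (rule fs[OF that])
    show ?thesis
      unfolding F_def \<rho>_def M_def by (rule someI_ex[OF pcompact_imp_realizes[OF pcompact_full]])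
  qed
  have F0: "F l q = x" if l: "l \<in> {0..1}" "q \<in> cube" "cube_time q = 0" for l q
  proof -
    interpret full_space "rr l q" "mspace X" "mdist X" a b \<kappa> "h q" "s q" "mspace Y" "mdist Y" c e "s' q"
      by (rule fs[OF l(1,2)])
    have "realizes x M (\<rho> l q)"
      unfolding \<rho>_def M_def X(2)
      by (rule realizes_full_left[OF realizes_isometry_class[OF X(1)]])
         (simp_all add: h_def s_def s'_def l(3))
    then show ?thesis using realizes_unique F[OF l(1,2)] by blast
  qed
  have F1: "F l q = y" if l: "l \<in> {0..1}" "q \<in> cube" "cube_time q = 1" for l q
  proof -
    interpret full_space "rr l q" "mspace X" "mdist X" a b \<kappa> "h q" "s q" "mspace Y" "mdist Y" c e "s' q"
      by (rule fs[OF l(1,2)])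
    have "realizes y M (\<rho> l q)"
      unfolding \<rho>_def M_def Y(2)
      by (rule realizes_full_right[OF realizes_isometry_class[OF Y(1)]])
         (simp_all add: h_def s_def s'_def l(3))
    then show ?thesis using realizes_unique F[OF l(1,2)] by blast
  qed
  define inner where "inner = {q \<in> cube. cube_time q \<noteq> 0 \<and> cube_time q \<noteq> 1}"
  have inner: "q \<in> cube" "h q > 0" "s q > 0" "s' q > 0" "s q = 1 \<or> s' q = 1" if "q \<in> inner" for q
  proof -
    have "q \<in> cube" "0 < cube_time q" "cube_time q < 1"
      using that cube_time_nonneg[of q] cube_time_le_1[of q] by (auto simp: inner_def)
    then show "q \<in> cube" "h q > 0" "s q > 0" "s' q > 0" "s q = 1 \<or> s' q = 1"
      by (auto simp: h_def s_def s'_def)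
  qed
  have F_inner: "F l q \<in> S" if "l \<in> {0..1}" "q \<in> inner" for l q
    using S F[OF that(1) inner(1)[OF that(2)]] fs[OF that(1) inner(1)[OF that(2)]] inner[OF that(2)]
      cube_code_in_cube[OF that(1) inner(1)[OF that(2)]]
    unfolding interpolates_def \<rho>_def M_def rr_def by blast
  have far: "far_dists N d = insert 0 (range (\<lambda>n. h q * radii w (cube_code l q) (Suc n)))"
    if l: "l \<in> {0..1}" "q \<in> inner" and N: "realizes (F l q) N d" for l q and N :: "real set" and d
  proof -
    interpret full_space "rr l q" "mspace X" "mdist X" a b \<kappa> "h q" "s q" "mspace Y" "mdist Y" c e "s' q"
      by (rule fs[OF l(1) inner(1)[OF l(2)]])
    have "far_dists N d = far_dists M (\<rho> l q)"
      by (rule far_dists_realizes[OF N F[OF l(1) inner(1)[OF l(2)]]])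
    also have "\<dots> = insert 0 (range (\<lambda>n. h q * rr l q (Suc n)))"
      unfolding \<rho>_def M_def by (rule far_dists_full[OF inner(2)[OF l(2)]])
    finally show ?thesis by (simp add: rr_def)
  qed
  have determined: "cube_code l q (Suc n) = cube_code l' q' (Suc n)"
    if l: "l \<in> {0..1}" "q \<in> inner" "l' \<in> {0..1}" "q' \<in> inner" "F l q = F l' q'" for l q l' q' n
  proof -
    obtain Z where Z: "nonempty_compact Z" "F l q = isometry_class Z" by (rule ex_isometry_class)
    have Zr: "realizes (F l q) (mspace Z) (mdist Z)"
      unfolding Z(2) by (rule realizes_isometry_class[OF Z(1)])
    then have "realizes (F l' q') (mspace Z) (mdist Z)" using l(5) by simp
    note eq = trans[OF far[OF l(1,2) Zr, symmetric] far[OF l(3,4) this]]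
    show ?thesis
      by (rule far_dists_determine_code[OF \<open>weights w\<close> inner(2)[OF l(2)] inner(2)[OF l(4)]
            cube_code_in_cube[OF l(1) inner(1)[OF l(2)]] cube_code_in_cube[OF l(3) inner(1)[OF l(4)]] _ _ eq])
         (simp_all add: cube_code_def)
  qed
  \<comment> \<open>Index 1 of \<open>determined\<close> concerns entry 2 of the code, the free
    parameter.\<close>
  have same_l: "l = l'" if "l \<in> {0..1}" "q \<in> inner" "l' \<in> {0..1}" "q' \<in> inner" "F l q = F l' q'" for l q l' q'
    using determined[OF that, of 1] by (simp add: cube_code_def)
  \<comment> \<open>Each of \<open>x\<close> and \<open>y\<close> is hit by the interior chains of
    at most one \<open>l\<close>, so one of the three values 0, 1/2 and 1 is left over.\<close>
  have "\<exists>l\<in>{0..1}. \<forall>q\<in>inner. F l q \<noteq> x \<and> F l q \<noteq> y"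
  proof (rule ccontr)
    assume "\<not> ?thesis"
    then have ex: "\<exists>q\<in>inner. F l q = x \<or> F l q = y" if "l \<in> {0..1}" for l
      using that by blast
    obtain p0 p1 p2 where p: "p0 \<in> inner" "F 0 p0 = x \<or> F 0 p0 = y" "p1 \<in> inner" "F (1/2) p1 = x \<or> F (1/2) p1 = y"
      "p2 \<in> inner" "F 1 p2 = x \<or> F 1 p2 = y"
      using ex[of 0] ex[of "1/2"] ex[of 1] by auto
    have "F 0 p0 = F (1/2) p1 \<or> F 0 p0 = F 1 p2 \<or> F (1/2) p1 = F 1 p2" using p by metis
    then show False
      using same_l[of 0 p0 "1/2" p1] same_l[of 0 p0 1 p2] same_l[of "1/2" p1 1 p2] p by auto
  qed
  then obtain l where l: "l \<in> {0..1}" "\<And>q. q \<in> inner \<Longrightarrow> F l q \<noteq> x \<and> F l q \<noteq> y" by blast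
  have cases: "q = (\<lambda>_. 0) \<and> F l q = x \<or> q = (\<lambda>_. 1) \<and> F l q = y \<or> q \<in> inner" if "q \<in> cube" for q
    using F0[OF l(1) that] F1[OF l(1) that] cube_time_eq_0[OF that] cube_time_eq_1[OF that] that
    unfolding inner_def by blast
  have inj: "inj_on (F l) cube"
  proof (rule inj_onI)
    fix q q' assume q: "q \<in> cube" "q' \<in> cube" "F l q = F l q'"
    show "q = q'"
    proof (cases "q \<in> inner \<and> q' \<in> inner")
      case True
      show ?thesis
      proof
        fix n
        \<comment> \<open>Index \<open>n + 2\<close> concerns entry \<open>n + 3\<close> of the
          code, where \<open>q n\<close> is stored.\<close>
        show "q n = q' n" using determined[OF l(1) _ l(1) _ q(3), of "n + 2"] True by (simp add: cube_code_def)
      qed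
    next
      case False
      then show ?thesis
        using cases[OF q(1)] cases[OF q(2)] q(3) l(2)[of q] l(2)[of q'] \<open>x \<noteq> y\<close> by metis
    qed
  qed
  have FS: "F l q \<in> S" if "q \<in> cube" for q
    using cases[OF that] F_inner[OF l(1)] assms(3,4) by metis
  \<comment> \<open>Factor 3 for each of the two Cantor sets, factor 2 for \<open>s\<close> and
    \<open>s'\<close> times the diameters of the two spaces, and three gaps.\<close>
  define C where "C = 6 + 2 * mdist X a b + 2 * mdist Y c e + 3 * \<kappa>"
  have C: "C > 0"
    using mdist_nonneg[of X a b] mdist_nonneg[of Y c e] \<open>\<kappa> \<ge> 0\<close> unfolding C_def by linarith
  have lip: "\<bar>\<rho> l q u v - \<rho> l q' u v\<bar> \<le> C * cube_dist q q'"
    if q: "q \<in> cube" "q' \<in> cube" and uv: "u \<in> M" "v \<in> M" for q q' u v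
  proof -
    define \<delta> where "\<delta> = cube_dist q q'"
    have t: "\<bar>cube_time q - cube_time q'\<bar> \<le> \<delta>"
      unfolding \<delta>_def by (rule cube_time_diff_le[OF q])
    have h_diff: "\<bar>h q - h q'\<bar> \<le> \<delta>"
    proof -
      have "h q - h q' = (cube_time q - cube_time q') * (1 - cube_time q - cube_time q')"
        by (simp add: h_def algebra_simps)
      moreover have "\<bar>1 - cube_time q - cube_time q'\<bar> \<le> 1"
        using cube_time_nonneg[OF q(1)] cube_time_le_1[OF q(1)] cube_time_nonneg[OF q(2)] cube_time_le_1[OF q(2)]
        by (simp add: abs_le_iff)
      ultimately have "\<bar>h q - h q'\<bar> \<le> \<bar>cube_time q - cube_time q'\<bar> * 1"
        unfolding abs_mult by (simp add: abs_mult mult_left_le)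
      then show ?thesis using t by simp
    qed
    have s_diff: "\<bar>s q - s q'\<bar> \<le> 2 * \<delta>" "\<bar>s' q - s' q'\<bar> \<le> 2 * \<delta>"
      using t by (auto simp: s_def s'_def min_def abs_le_iff)
    \<comment> \<open>Entries 0 to 2 do not depend on \<open>q\<close>; for the later ones
      \<open>w n\<close> is at most the weight \<open>1 / 2 ^ Suc m\<close> in
      \<open>cube_dist\<close>.\<close>
    have r_diff: "\<bar>rr l q n - rr l q' n\<bar> \<le> \<delta>" for n
    proof (cases "n \<le> 2")
      case True
      then have "rr l q n = rr l q' n" by (auto simp: rr_def radii_def cube_code_def)
      then show ?thesis using cube_dist_nonneg[OF q] by (simp add: \<delta>_def)
    next
      case False
      then obtain m where m: "n = m + 3" by (metis add.commute le_Suc_ex not_less_eq_eq numeral_2_eq_2 numeral_3_eq_3)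
      have "rr l q n - rr l q' n = w n * (q m - q' m)"
        by (simp add: rr_def radii_def cube_code_def m algebra_simps)
      then have "\<bar>rr l q n - rr l q' n\<bar> = w n * \<bar>q m - q' m\<bar>"
        using w_pos[of n] by (simp add: abs_mult)
      also have "\<dots> \<le> 1 / 2 ^ Suc m * \<bar>q m - q' m\<bar>"
      proof (rule mult_right_mono)
        have "(2::real) ^ Suc m \<le> 4 ^ n"
        proof -
          have "(2::real) ^ Suc m \<le> 2 ^ n" by (rule power_increasing) (simp_all add: m)
          also have "\<dots> \<le> 4 ^ n" by (rule power_mono) simp_all
          finally show ?thesis .
        qed
        then have "1 / 4 ^ n \<le> 1 / (2::real) ^ Suc m" by (intro divide_left_mono) simp_all
        then show "w n \<le> 1 / 2 ^ Suc m" using w_le[of n] by linarith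
      qed simp
      also have "\<dots> \<le> \<delta>" using cube_dist_term_le[OF q, of m] by (simp add: \<delta>_def)
      finally show ?thesis .
    qed
    \<comment> \<open>The 3 consists of 2, a bound of the radii, for the change of \<open>h\<close>,
      and of 1, a bound of \<open>h\<close>, for the change of the radii.\<close>
    have K: "\<bar>h q * udist (rr l q) u v - h q' * udist (rr l q') u v\<bar> \<le> 3 * \<delta>" for u v
    proof (cases "u = v")
      case True
      then show ?thesis using cube_dist_nonneg[OF q] by (simp add: udist_def \<delta>_def)
    next
      case False
      define n where "n = (LEAST n. u n \<noteq> v n)"
      have rb: "0 \<le> rr l q n" "rr l q n \<le> 2"
        using radii_le_2[OF cube_code_in_cube[OF l(1) q(1)], of n] scale_seq.r_pos[OF scale_seq_radii[OF cube_code_in_cube[OF l(1) q(1)]], of n]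
        by (simp_all add: rr_def)
      have "h q * rr l q n - h q' * rr l q' n = (h q - h q') * rr l q n + h q' * (rr l q n - rr l q' n)"
        by (simp add: algebra_simps)
      then have "\<bar>h q * rr l q n - h q' * rr l q' n\<bar> \<le> \<bar>h q - h q'\<bar> * rr l q n + h q' * \<bar>rr l q n - rr l q' n\<bar>"
        using abs_triangle_ineq[of "(h q - h q') * rr l q n" "h q' * (rr l q n - rr l q' n)"] rb range(1)[OF q(2)]
        by (simp add: abs_mult)
      also have "\<dots> \<le> \<delta> * 2 + 1 * \<delta>"
        using h_diff r_diff[of n] rb range[OF q(2)] by (intro add_mono mult_mono) auto
      finally show ?thesis using False by (simp add: udist_def n_def)
    qed
    have "\<bar>\<rho> l q u v - \<rho> l q' u v\<bar>
      \<le> (3 * \<delta> + \<bar>s q - s q'\<bar> * mdist X a b + \<bar>\<kappa> * h q - \<kappa> * h q'\<bar>)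
        + (3 * \<delta> + \<bar>s' q - s' q'\<bar> * mdist Y c e + \<bar>\<kappa> * h q - \<kappa> * h q'\<bar>) + \<bar>\<kappa> * h q - \<kappa> * h q'\<bar>"
      unfolding \<rho>_def
      by (rule full_dist_diff_le[OF K _ ab(1,2) _ ce(1,2)]) (use ab(3) ce(3) uv in \<open>simp_all add: M_def\<close>)
    also have "\<dots> \<le> (3 * \<delta> + 2 * \<delta> * mdist X a b + \<kappa> * \<delta>) + (3 * \<delta> + 2 * \<delta> * mdist Y c e + \<kappa> * \<delta>) + \<kappa> * \<delta>"
    proof -
      have "\<bar>\<kappa> * h q - \<kappa> * h q'\<bar> = \<kappa> * \<bar>h q - h q'\<bar>"
        using \<open>\<kappa> \<ge> 0\<close> by (simp add: right_diff_distrib[symmetric] abs_mult)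
      also have "\<dots> \<le> \<kappa> * \<delta>" using h_diff \<open>\<kappa> \<ge> 0\<close> by (rule mult_left_mono)
      finally have k: "\<bar>\<kappa> * h q - \<kappa> * h q'\<bar> \<le> \<kappa> * \<delta>" .
      show ?thesis
        by (intro add_mono k mult_right_mono s_diff order_refl mdist_nonneg)
    qed
    also have "\<dots> = C * cube_dist q q'" by (simp add: C_def \<delta>_def algebra_simps)
    finally show ?thesis .
  qed
  interpret S: Metric_space S gh_dist by (rule Metric_space_gh_dist)
  have cont: "continuous_map hilbert_cube (gh_topology S) (F l)"
    unfolding S.continuous_map_to_metric topspace_hilbert_cube
  proof (intro ballI allI impI)
    fix q and \<epsilon> :: real assume q: "q \<in> cube" and \<epsilon>: "0 < \<epsilon>"
    define U where "U = {q' \<in> cube. cube_dist q q' < \<epsilon> / C}"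
    have "openin (top_of_set cube) (cube \<inter> cube_dist q -` {..<\<epsilon> / C})"
      by (rule continuous_openin_preimage_gen[OF continuous_on_cube_dist[OF q]]) simp
    moreover have "cube \<inter> cube_dist q -` {..<\<epsilon> / C} = U" by (auto simp: U_def)
    ultimately have "openin hilbert_cube U" by (simp add: hilbert_cube_eq)
    moreover have "q \<in> U" using q \<epsilon> C by (simp add: U_def cube_dist_self)
    moreover have "F l q' \<in> S.mball (F l q) \<epsilon>" if "q' \<in> U" for q'
    proof -
      have q': "q' \<in> cube" "cube_dist q q' < \<epsilon> / C" using that by (simp_all add: U_def)
      then have lt: "C * cube_dist q q' < \<epsilon>" using C by (simp add: field_simps)
      \<comment> \<open>The distortion is below \<open>\<epsilon>\<close>, twice the bound taken
        here; the other half of \<open>\<epsilon>\<close> makes the inequality strict, as the open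
        ball needs.\<close>
      have "gh_dist (F l q) (F l q') \<le> \<epsilon> / 2"
        by (rule gh_dist_le[OF F[OF l(1) q] F[OF l(1) q'(1)]])
           (use \<epsilon> lt lip[OF q q'(1)] in \<open>fastforce+\<close>)
      then show ?thesis using FS[OF q] FS[OF q'(1)] \<epsilon> by (simp add: S.in_mball)
    qed
    ultimately show "\<exists>U. openin hilbert_cube U \<and> q \<in> U \<and> (\<forall>y\<in>U. F l y \<in> S.mball (F l q) \<epsilon>)" by blast
  qed
  have "embedding_map hilbert_cube (gh_topology S) (F l)"
    by (rule continuous_imp_embedding_map[OF cont compact_space_hilbert_cube S.Hausdorff_space_mtopology])
       (use inj in \<open>simp add: topspace_hilbert_cube\<close>)
  moreover have "(\<lambda>_. 0) \<in> cube" "(\<lambda>_. 1) \<in> cube" by (simp_all add: cube_def)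
  then have "x \<in> F l ` cube" "y \<in> F l ` cube"
    using F0[OF l(1) _ cube_time_0] F1[OF l(1) _ cube_time_1] by (metis imageI)+
  ultimately show ?thesis by (intro exI[of _ "F l"]) (simp add: topspace_hilbert_cube)
qed

section \<open>Members of the classes\<close>

definition geometric_weights :: "nat \<Rightarrow> real" where
  "geometric_weights n = 1 / 4 ^ n"

text \<open>The square in the exponent makes consecutive weights differ by the factor
  \<open>4 ^ (2 * n + 1)\<close>, so their ratios tend to zero.\<close>

definition fast_weights :: "nat \<Rightarrow> real" where
  "fast_weights n = 1 / 4 ^ (n * n)"

lemma weights_geometric: "weights geometric_weights"
  by unfold_locales (simp_all add: geometric_weights_def)

lemma fast_weights_Suc: "fast_weights (Suc n) = fast_weights n / 4 ^ (2 * n + 1)"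
proof -
  have "Suc n * Suc n = n * n + (2 * n + 1)" by simp
  then show ?thesis unfolding fast_weights_def by (simp only: power_add) simp
qed

lemma weights_fast: "weights fast_weights"
proof
  fix n
  have pos: "fast_weights n > 0" for n by (simp add: fast_weights_def)
  have "(4::real) ^ 1 \<le> 4 ^ (2 * n + 1)" by (rule power_increasing) simp_all
  then have "fast_weights n / 4 ^ (2 * n + 1) \<le> fast_weights n / 4"
    using pos[of n] by (intro divide_left_mono) simp_all
  then show "fast_weights (Suc n) \<le> fast_weights n / 4" unfolding fast_weights_Suc .
qed (simp_all add: fast_weights_def)

text \<open>A factor 4 is lost by the weights and at most another 2 by the perturbations
  \<open>1 + k n\<close> between 1 and 2.\<close>

lemma radii_geometric_ratio:
  assumes "k \<in> cube"
  shows "1 / 8 * radii geometric_weights k n \<le> radii geometric_weights k (Suc n)"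
proof -
  have "1 / 8 * radii geometric_weights k n \<le> geometric_weights n / 4"
    using cubeD(2)[OF assms, of n] by (simp add: radii_def geometric_weights_def divide_simps)
  also have "\<dots> \<le> radii geometric_weights k (Suc n)"
    using cubeD(1)[OF assms, of "Suc n"] by (simp add: radii_def geometric_weights_def divide_simps)
  finally show ?thesis .
qed

text \<open>The perturbations cost at most a factor 2, against a weight ratio that tends to
  zero.\<close>

lemma radii_fast_ratio:
  assumes "k \<in> cube" "\<eta> > 0"
  shows "\<exists>n. radii fast_weights k (Suc n) < \<eta> * radii fast_weights k n"
proof -
  have "(\<lambda>n. (1 / 2 :: real) ^ n) \<longlonglongrightarrow> 0" by (rule LIMSEQ_power_zero) simp
  then obtain n where n: "(1 / 2 :: real) ^ n < \<eta>"
    using order_tendstoD(2)[OF _ assms(2)] by (metis (mono_tags, lifting) eventually_sequentially order_refl)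
  have pos: "fast_weights n > 0" by (simp add: fast_weights_def)
  have "radii fast_weights k (Suc n) \<le> fast_weights n / 4 ^ (2 * n + 1) * 2"
    unfolding radii_def fast_weights_Suc using cubeD(2)[OF assms(1), of "Suc n"] pos
    by (intro mult_left_mono) auto
  also have "\<dots> \<le> fast_weights n * (1 / 2) ^ n"
  proof -
    have "(2::real) * 2 ^ n \<le> 4 ^ (2 * n + 1)"
    proof -
      have "(2::real) * 2 ^ n = 2 ^ Suc n" by simp
      also have "\<dots> \<le> 4 ^ Suc n" by (rule power_mono) simp_all
      also have "\<dots> \<le> 4 ^ (2 * n + 1)" by (rule power_increasing) simp_all
      finally show ?thesis .
    qed
    then show ?thesis using pos by (simp add: power_divide divide_simps)
  qed
  also have "\<dots> < fast_weights n * \<eta>" using n pos by simp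
  also have "\<dots> \<le> \<eta> * radii fast_weights k n"
    using pos assms(2) cubeD(1)[OF assms(1), of n] by (simp add: radii_def algebra_simps)
  finally show ?thesis by blast
qed

section \<open>The unit interval as a building block\<close>

lemma compact_pcompact_dist:
  fixes A :: "'a::metric_space set"
  assumes "compact A" "A \<noteq> {}" shows "pcompact A dist"
  unfolding pcompact_def
proof (intro conjI allI impI)
  show "pseudometric_on A dist" by (auto simp: pseudometric_on_def dist_commute dist_triangle)
  fix \<sigma> :: "nat \<Rightarrow> 'a" assume "range \<sigma> \<subseteq> A"
  then have "\<forall>n. \<sigma> n \<in> A" by auto
  then obtain l r where "l \<in> A" "strict_mono r" "(\<sigma> \<circ> r) \<longlonglongrightarrow> l"
    using assms(1) unfolding compact_def by blast
  then show "\<exists>l\<in>A. \<exists>r. strict_mono r \<and> (\<lambda>n. dist (\<sigma> (r n)) l) \<longlonglongrightarrow> 0"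
    using tendsto_dist_iff[of "\<sigma> \<circ> r" l sequentially] by (auto simp: o_def)
qed (use assms in auto)

text \<open>Cells of length \<open>r / 4\<close>, counted from the minimum, contain at most one
  point each. The index 4 occurs only at distance exactly \<open>r\<close> and makes the fifth
  cell.\<close>

lemma pdoubling_unit_interval: "pdoubling {0..1::real} dist"
proof (rule pdoublingI)
  fix r F assume r: "(r::real) > 0" and F: "finite F" "F \<subseteq> {0..1::real}"
    and le: "\<And>x y. x \<in> F \<Longrightarrow> y \<in> F \<Longrightarrow> dist x y \<le> r"
    and gt: "\<And>x y. x \<in> F \<Longrightarrow> y \<in> F \<Longrightarrow> x \<noteq> y \<Longrightarrow> r / 4 < dist x y"
  show "card F \<le> 5"
  proof (cases "F = {}")
    case False
    define m where "m = Min F"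
    have m: "m \<in> F" "\<And>x. x \<in> F \<Longrightarrow> m \<le> x" using F(1) False by (auto simp: m_def)
    define k where "k x = \<lfloor>(x - m) / (r / 4)\<rfloor>" for x
    have "inj_on k F"
    proof (rule inj_onI, rule ccontr)
      fix x y assume xy: "x \<in> F" "y \<in> F" "k x = k y" "x \<noteq> y"
      have "\<bar>(x - m) / (r / 4) - (y - m) / (r / 4)\<bar> < 1" using xy(3) unfolding k_def by linarith
      then have "\<bar>(x - m) / (r / 4) - (y - m) / (r / 4)\<bar> * (r / 4) < 1 * (r / 4)"
        using r by (intro mult_strict_right_mono) simp_all
      moreover have "x - y = ((x - m) / (r / 4) - (y - m) / (r / 4)) * (r / 4)" using r by (simp add: field_simps)
      then have "\<bar>x - y\<bar> = \<bar>(x - m) / (r / 4) - (y - m) / (r / 4)\<bar> * (r / 4)"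
        using r by (metis abs_mult abs_of_pos divide_pos_pos zero_less_numeral)
      ultimately have "\<bar>x - y\<bar> < r / 4" by simp
      then show False using gt[OF xy(1,2,4)] by (simp add: dist_real_def)
    qed
    moreover have "k ` F \<subseteq> {0..4}"
    proof
      fix t assume "t \<in> k ` F"
      then obtain x where x: "x \<in> F" "t = k x" by blast
      have "0 \<le> x - m" "x - m \<le> r" using m(2)[OF x(1)] le[OF x(1) m(1)] by (auto simp: dist_real_def)
      then have "0 \<le> (x - m) / (r / 4)" "(x - m) / (r / 4) \<le> 4" using r by (simp_all add: field_simps)
      then show "t \<in> {0..4}" unfolding x(2) k_def by (simp add: le_floor_iff floor_le_iff)
    qed
    ultimately have "card F \<le> card {0..4::int}" by (intro card_inj_on_le) auto
    then show ?thesis by simp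
  qed simp
qed

text \<open>The chain \<open>0, 1/n, ..., 1\<close> joins points at distance 1 by steps of length
  \<open>1 / n\<close>.\<close>

lemma not_punif_disconnected_unit_interval: "\<not> punif_disconnected {0..1::real} dist"
proof
  assume "punif_disconnected {0..1::real} dist"
  then obtain \<delta> where \<delta>: "\<delta> > 0" "\<And>n z e. \<lbrakk>\<forall>i\<le>n. z i \<in> {0..1::real}; 0 \<le> e; \<forall>i<n. dist (z i) (z (Suc i)) \<le> e\<rbrakk>
      \<Longrightarrow> \<delta> * dist (z 0) (z n) \<le> e"
    unfolding punif_disconnected_def by blast
  obtain m :: nat where "inverse (real (Suc m)) < \<delta>"
    using reals_Archimedean[OF \<delta>(1)] by blast
  then obtain n :: nat where n: "n > 0" "1 / real n < \<delta>"
    by (metis inverse_eq_divide zero_less_Suc)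
  have "\<delta> * dist (real 0 / real n) (real n / real n) \<le> 1 / real n"
  proof (rule \<delta>(2)[of n "\<lambda>i. real i / real n"])
    show "\<forall>i<n. dist (real i / real n) (real (Suc i) / real n) \<le> 1 / real n"
      by (auto simp: dist_real_def diff_divide_distrib[symmetric] abs_if)
  qed (use n in auto)
  then show False using n by simp
qed

text \<open>Such a radius is below 1, so a step of length \<open>r / 2\<close> towards the farther
  end stays inside the interval.\<close>

lemma punif_perfect_unit_interval: "punif_perfect {0..1::real} dist"
  unfolding punif_perfect_def
proof (intro exI[of _ "1/2"] conjI ballI allI impI)
  fix x u v r :: real assume x: "x \<in> {0..1}" and uv: "u \<in> {0..1}" "v \<in> {0..1}" and r: "0 < r" "r < dist u v"
  have "r < 1" using uv r(2) by (auto simp: dist_real_def)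
  show "\<exists>y\<in>{0..1}. 1 / 2 * r \<le> dist x y \<and> dist x y \<le> r"
    by (rule bexI[of _ "if x \<le> 1 / 2 then x + r / 2 else x - r / 2"])
       (use x r(1) \<open>r < 1\<close> in \<open>auto simp: dist_real_def\<close>)
qed simp

text \<open>Three independent switches: bounded or unbounded numbers of digits for doubling, a point
  or an interval for uniform disconnectedness, and an extra point at gap 0 or 1 for uniform
  perfectness.\<close>

lemma ex_model:
  "\<exists>x. (x \<in> gh_Q 1 \<longleftrightarrow> P) \<and> (x \<in> gh_Q 2 \<longleftrightarrow> Q) \<and> (x \<in> gh_Q 3 \<longleftrightarrow> R)"
proof -
  define r where "r = radii geometric_weights (\<lambda>_. 0)"
  have zero: "(\<lambda>_. 0) \<in> cube" by (simp add: cube_def)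
  interpret scale_seq r
    unfolding r_def by (rule weights.scale_seq_radii[OF weights_geometric zero])
  define k where "k = (if P then (\<lambda>_. 2) else (\<lambda>n. n + 2 :: nat))"
  have k: "k n \<ge> 2" "k n > 0" for n by (simp_all add: k_def)
  define I where "I = (if Q then {0} else {0..1::real})"
  have I: "I \<noteq> {}" "0 \<in> I" "I \<subseteq> {0..1}" "compact I" by (auto simp: I_def)
  have cU: "pcompact (seqs k) (udist r)" by (rule pcompact_udist) (rule k)
  have cI: "pcompact I dist" by (rule compact_pcompact_dist[OF I(4,1)])
  have cO: "pcompact {0::real} dist" by (rule compact_pcompact_dist) auto
  have dU: "pdoubling (seqs k) (udist r) \<longleftrightarrow> P"
    using pdoubling_udist[of "\<lambda>_. 2" 2] not_pdoubling_udist by (simp add: k_def)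
  have dI: "pdoubling I dist"
    by (rule pdoubling_isometric[OF pdoubling_unit_interval, of id])
       (use I(3) cI in \<open>auto simp: pcompact_def\<close>)
  have dO: "pdoubling {0::real} dist"
    by (rule pdoubling_isometric[OF pdoubling_unit_interval, of id])
       (use cO in \<open>auto simp: pcompact_def\<close>)
  have uO: "punif_disconnected {0::real} dist"
    unfolding punif_disconnected_def by (intro exI[of _ 1]) force
  have uI: "punif_disconnected I dist \<longleftrightarrow> Q"
    using uO not_punif_disconnected_unit_interval by (simp add: I_def)
  have pO: "punif_perfect {0::real} dist"
    unfolding punif_perfect_def by (intro exI[of _ 1]) auto
  have pI: "punif_perfect I dist"
    using pO punif_perfect_unit_interval by (simp add: I_def)
  have pU: "punif_perfect (seqs k) (udist r)"
    by (rule punif_perfect_udist[of k "1/8"]) (use k radii_geometric_ratio[OF zero] in \<open>auto simp: r_def\<close>)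
  interpret A: pointed_join "seqs k" "udist r" "\<lambda>_. 0" I dist 0 0
    by unfold_locales (use cU cI I k in \<open>auto simp: pcompact_def seqs_def\<close>)
  have cA: "pcompact (seqs k <+> I) A.J" by (rule A.pcompact_join[OF cU cI])
  define g :: real where "g = (if R then 0 else 1)"
  interpret B: pointed_join "seqs k <+> I" A.J "Inl (\<lambda>_. 0)" "{0::real}" dist 0 g
    by unfold_locales (use cA cO A.a in \<open>auto simp: pcompact_def g_def\<close>)
  let ?M = "(seqs k <+> I) <+> {0::real}"
  have "pcompact ?M B.J" by (rule B.pcompact_join[OF cA cO])
  then obtain x where x: "realizes x ?M B.J" using pcompact_imp_realizes by blast
  have "pdoubling ?M B.J \<longleftrightarrow> P"
    unfolding B.pdoubling_join_iff A.pdoubling_join_iff using dU dI dO by simp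
  moreover have "punif_disconnected ?M B.J \<longleftrightarrow> Q"
    unfolding B.punif_disconnected_join_iff A.punif_disconnected_join_iff
    using punif_disconnected_udist uI uO by simp
  moreover have "punif_perfect ?M B.J \<longleftrightarrow> R"
  proof
    assume R
    have "punif_perfect (seqs k <+> I) A.J" by (rule A.punif_perfect_join[OF pU pI _ cU cI]) simp
    then show "punif_perfect ?M B.J" by (rule B.punif_perfect_join[OF _ pO _ cA cO]) (simp add: g_def \<open>R\<close>)
  next
    assume up: "punif_perfect ?M B.J"
    show R
    proof (rule ccontr)
      assume "\<not> R"
      then have g: "g = 1" by (simp add: g_def)
      obtain c where c: "c > 0" "\<And>x u v \<rho>. \<lbrakk>x \<in> ?M; u \<in> ?M; v \<in> ?M; \<rho> > 0; \<rho> < B.J u v\<rbrakk>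
          \<Longrightarrow> \<exists>y\<in>?M. c * \<rho> \<le> B.J x y \<and> B.J x y \<le> \<rho>"
        using up unfolding punif_perfect_def by blast
      \<comment> \<open>All points other than the extra one are at least 1 away from it, so nothing
        lies in this annulus of outer radius \<open>1/2\<close>.\<close>
      have "\<exists>y\<in>?M. c * (1/2) \<le> B.J (Inr 0) y \<and> B.J (Inr 0) y \<le> 1/2"
        by (rule c(2)[of _ "Inr 0" "Inl (Inl (\<lambda>_. 0))"]) (use A.a g in auto)
      then obtain y where y: "y \<in> ?M" "c * (1/2) \<le> B.J (Inr 0) y" "B.J (Inr 0) y \<le> 1/2" by blast
      show False
      proof (cases y)
        case (Inl z)
        then have "0 \<le> A.J z (Inl (\<lambda>_. 0))"
          using y(1) A.a by (intro pseudometric_on_nonneg[OF B.pm_A]) auto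
        then show False using Inl y(3) g by simp
      next
        case (Inr z)
        then show False using y c(1) by simp
      qed
    qed
  qed
  ultimately show ?thesis using realizes_gh_Q[OF x] by blast
qed

text \<open>The value 2 imposes no condition, so a model that has a property exactly when its
  parameter is 1 serves all cases.\<close>

lemma gh_X_nonempty: "gh_X u v w \<noteq> {}"
proof -
  obtain x where "x \<in> gh_Q 1 \<longleftrightarrow> u = 1" "x \<in> gh_Q 2 \<longleftrightarrow> v = 1" "x \<in> gh_Q 3 \<longleftrightarrow> w = 1"
    using ex_model[of "u = 1" "v = 1" "w = 1"] by blast
  then have "x \<in> gh_X u v w" by (simp add: gh_X_def gh_E_def)
  then show ?thesis by blast
qed

lemma gh_CA_nonempty: "gh_CA \<noteq> {}"
proof -
  define r where "r = radii geometric_weights (\<lambda>_. 0)"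
  have zero: "(\<lambda>_. 0) \<in> cube" by (simp add: cube_def)
  interpret scale_seq r
    unfolding r_def by (rule weights.scale_seq_radii[OF weights_geometric zero])
  have "pcompact binary (udist r)" by (rule pcompact_udist) simp
  then obtain x where "realizes x binary (udist r)" using pcompact_imp_realizes by blast
  then have "x \<in> gh_CA" using realizes_gh_CA pcantor_udist by blast
  then show ?thesis by blast
qed

lemma gh_I_nonempty:
  assumes "dimensional_function D" shows "gh_I D \<noteq> {}"
proof -
  have "\<exists>Y :: real metric. nonempty_compact Y \<and> D (isometry_class Y) = \<infinity> \<and> mdiameter Y \<le> ereal 1"
    using assms zero_less_one unfolding dimensional_function_def by blast
  then show ?thesis by (auto simp: gh_I_def)
qed

section \<open>The interpolating spaces stay in the class\<close>

text \<open>The gap is closed for the sake of uniform perfectness. For the first two properties both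
  truth and failure carry over from X and Y by the equivalences for the chain; failure of the third
  is produced by \<open>fast_weights\<close>.\<close>

lemma interpolates_gh_X:
  assumes X: "nonempty_compact X" "isometry_class X \<in> gh_X u v w"
    and Y: "nonempty_compact Y" "isometry_class Y \<in> gh_X u v w"
  shows "interpolates (gh_X u v w) 0 (if w = 0 then fast_weights else geometric_weights) X Y"
  unfolding interpolates_def
proof (intro allI impI, elim conjE)
  let ?w = "if w = 0 then fast_weights else geometric_weights"
  fix k h s s' a b c e z
  assume k: "k \<in> cube" and h: "0 < h" "0 < s" "0 < s'"
    and fs: "full_space (radii ?w k) (mspace X) (mdist X) a b 0 h s (mspace Y) (mdist Y) c e s'"
    and z: "realizes z ((binary <+> mspace X) <+> (binary <+> mspace Y))
       (full_dist 0 h (radii ?w k) s (mdist X) a b s' (mdist Y) c e)"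
  interpret full_space "radii ?w k" "mspace X" "mdist X" a b 0 h s "mspace Y" "mdist Y" c e s' by (rule fs)
  note X' = X(2)[unfolded gh_X_def Int_iff realizes_gh_E[OF realizes_isometry_class[OF X(1)]]]
  note Y' = Y(2)[unfolded gh_X_def Int_iff realizes_gh_E[OF realizes_isometry_class[OF Y(1)]]]
  have "punif_perfect FS FD" if "w = 1"
  proof (rule punif_perfect_full[OF h refl, of "1/8"])
    show "1 / 8 * radii ?w k n \<le> radii ?w k (Suc n)" for n
      using radii_geometric_ratio[OF k, of n] that by simp
  qed (use X' Y' that in auto)
  moreover have "\<not> punif_perfect FS FD" if "w = 0"
    by (rule not_punif_perfect_full[OF h(1)]) (use radii_fast_ratio[OF k] that in simp)
  ultimately show "z \<in> gh_X u v w"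
    unfolding gh_X_def Int_iff realizes_gh_E[OF z] pdoubling_full_iff[OF h] punif_disconnected_full_iff[OF h]
    using X' Y' by blast
qed

lemma interpolates_gh_CA:
  assumes X: "nonempty_compact X" "isometry_class X \<in> gh_CA"
    and Y: "nonempty_compact Y" "isometry_class Y \<in> gh_CA"
  shows "interpolates gh_CA 1 geometric_weights X Y"
  unfolding interpolates_def
proof (intro allI impI, elim conjE)
  fix k h s s' a b c e z
  assume k: "k \<in> cube" and h: "0 < h" "0 < s" "0 < s'"
    and fs: "full_space (radii geometric_weights k) (mspace X) (mdist X) a b 1 h s (mspace Y) (mdist Y) c e s'"
    and z: "realizes z ((binary <+> mspace X) <+> (binary <+> mspace Y))
       (full_dist 1 h (radii geometric_weights k) s (mdist X) a b s' (mdist Y) c e)"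
  interpret full_space "radii geometric_weights k" "mspace X" "mdist X" a b 1 h s "mspace Y" "mdist Y" c e s' by (rule fs)
  have cantor: "pcantor (mspace Z) (mdist Z)" if Z: "nonempty_compact Z" "isometry_class Z \<in> gh_CA" for Z
  proof -
    obtain Z' where Z': "nonempty_compact Z'" "isometry_class Z = isometry_class Z'" "pcantor (mspace Z') (mdist Z')"
      using gh_CA_realization[OF Z(2)] by metis
    obtain \<phi> where \<phi>: "\<phi> ` mspace Z' = mspace Z"
        "\<And>m m'. m \<in> mspace Z' \<Longrightarrow> m' \<in> mspace Z' \<Longrightarrow> mdist Z (\<phi> m) (\<phi> m') = mdist Z' m m'"
      using realizes_onto[OF realizes_isometry_class[OF Z'(1)] Z(1)] Z'(2) by metis
    show ?thesis by (rule pcantor_surj[OF Z'(3) \<phi>]) auto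
  qed
  have "pcantor FS FD" by (rule pcantor_full[OF h _ cantor[OF X] cantor[OF Y]]) simp
  then show "z \<in> gh_CA" by (rule realizes_gh_CA[OF z])
qed

text \<open>The piece of scale 1 sits isometrically inside the chain, and a value above infinity is
  infinite.\<close>

lemma interpolates_gh_I:
  assumes D: "dimensional_function D"
    and X: "nonempty_compact X" "isometry_class X \<in> gh_I D"
    and Y: "nonempty_compact Y" "isometry_class Y \<in> gh_I D"
  shows "interpolates (gh_I D) 0 geometric_weights X Y"
  unfolding interpolates_def
proof (intro allI impI, elim conjE)
  fix k h s s' a b c e z
  assume k: "k \<in> cube" and s: "s = 1 \<or> s' = 1"
    and fs: "full_space (radii geometric_weights k) (mspace X) (mdist X) a b 0 h s (mspace Y) (mdist Y) c e s'"
    and z: "realizes z ((binary <+> mspace X) <+> (binary <+> mspace Y))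
       (full_dist 0 h (radii geometric_weights k) s (mdist X) a b s' (mdist Y) c e)"
  interpret full_space "radii geometric_weights k" "mspace X" "mdist X" a b 0 h s "mspace Y" "mdist Y" c e s' by (rule fs)
  from s have "D (isometry_class X) \<le> D z \<or> D (isometry_class Y) \<le> D z"
  proof
    assume "s = 1"
    then have "D (isometry_class X) \<le> D z"
      by (intro dimensional_function_mono[OF D z realizes_isometry_class[OF X(1)], of "Inl \<circ> Inr"])
         (use full_dist_left \<open>s = 1\<close> in auto)
    then show ?thesis ..
  next
    assume "s' = 1"
    then have "D (isometry_class Y) \<le> D z"
      by (intro dimensional_function_mono[OF D z realizes_isometry_class[OF Y(1)], of "Inr \<circ> Inr"])
         (use full_dist_right \<open>s' = 1\<close> in auto)
    then show ?thesis ..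
  qed
  then show "z \<in> gh_I D"
    using X(2) Y(2) by (auto simp: gh_I_def top_unique)
qed

theorem theorem1p7:
  fixes S :: "gh_space set"
  assumes "(\<exists>u\<in>{0,1,2}. \<exists>v\<in>{0,1,2}. \<exists>w\<in>{0,1,2}. S = gh_X u v w)
         \<or> (\<exists>D. dimensional_function D \<and> S = gh_I D)
         \<or> S = gh_CA"
  shows "(\<forall>x\<in>S. \<forall>y\<in>S. \<exists>f. embedding_map hilbert_cube (gh_topology S) f \<and>
                           {x, y} \<subseteq> f ` topspace hilbert_cube)
         \<and> infinite_dimensional (gh_topology S)"
proof -
  have "\<exists>\<kappa> w. \<kappa> \<ge> 0 \<and> weights w \<and> S \<noteq> {} \<and> (\<forall>X Y. nonempty_compact X \<and> isometry_class X \<in> S \<and>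
      nonempty_compact Y \<and> isometry_class Y \<in> S \<longrightarrow> interpolates S \<kappa> w X Y)"
    using assms
  proof (elim disjE exE bexE conjE)
    fix u v w :: nat assume S: "S = gh_X u v w"
    show ?thesis
      unfolding S
      by (rule exI[of _ 0], rule exI[of _ "if w = 0 then fast_weights else geometric_weights"])
         (use gh_X_nonempty[of u v w] interpolates_gh_X weights_fast weights_geometric in auto)
  next
    fix D assume "dimensional_function D" "S = gh_I D"
    then show ?thesis
      by (intro exI[of _ 0] exI[of _ geometric_weights])
         (use gh_I_nonempty interpolates_gh_I weights_geometric in auto)
  next
    assume "S = gh_CA"
    then show ?thesis
      by (intro exI[of _ 1] exI[of _ geometric_weights])
         (use gh_CA_nonempty interpolates_gh_CA weights_geometric in auto)
  qed
  then obtain \<kappa> w where \<kappa>: "\<kappa> \<ge> 0" and w: "weights w" and "S \<noteq> {}"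
    and S: "\<And>X Y. \<lbrakk>nonempty_compact X; isometry_class X \<in> S; nonempty_compact Y; isometry_class Y \<in> S\<rbrakk>
      \<Longrightarrow> interpolates S \<kappa> w X Y" by blast
  have distinct: "\<exists>f. embedding_map hilbert_cube (gh_topology S) f \<and> {x, y} \<subseteq> f ` topspace hilbert_cube"
    if xy: "x \<in> S" "y \<in> S" "x \<noteq> y" for x y
  proof -
    obtain X where X: "nonempty_compact X" "x = isometry_class X" by (rule ex_isometry_class)
    obtain Y where Y: "nonempty_compact Y" "y = isometry_class Y" by (rule ex_isometry_class)
    have "interpolates S \<kappa> w X Y" by (rule S) (use X Y xy in auto)
    from cube_embedding[OF w \<kappa> xy X Y this] show ?thesis .
  qed
  have emb: "\<exists>f. embedding_map hilbert_cube (gh_topology S) f \<and> {x, y} \<subseteq> f ` topspace hilbert_cube"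
    if xy: "x \<in> S" "y \<in> S" for x y
  proof (cases "x = y")
    case True
    obtain X where X: "nonempty_compact X" "x = isometry_class X" by (rule ex_isometry_class)
    \<comment> \<open>Equal end points are served by the cube through \<open>x\<close> and any other
      member.\<close>
    have "interpolates S \<kappa> w X X" by (rule S) (use X xy in auto)
    then obtain y' where "y' \<in> S" "y' \<noteq> x" using ex_second_member[OF w \<kappa> xy(1) X] by blast
    then obtain f where "embedding_map hilbert_cube (gh_topology S) f" "{x, y'} \<subseteq> f ` topspace hilbert_cube"
      using distinct[OF xy(1), of y'] by metis
    then show ?thesis using True by blast
  qed (rule distinct[OF xy])
  moreover have "infinite_dimensional (gh_topology S)"
    using \<open>S \<noteq> {}\<close> emb infinite_dimensional_if_hilbert_cube_embeds
      Metric_space.Hausdorff_space_mtopology[OF Metric_space_gh_dist] by blast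
  ultimately show ?thesis by blast
qed

end
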